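(* Let $n\ge1$, $\lambda>0$, and let $d\nu=f\,d\gamma$ be a centered probability measure on $\mathbb{R}^n$ (i.e. $\int x\,d\nu=0$) in the class $\mathcal{P}(\lambda)$. Then $$\delta_{\rm LSI}(\nu)\,\ge\,\frac{c_1(\lambda)}{4}\bigg(\int_{\mathbb{R}^n}|f-1|\,d\gamma\bigg)^2=\frac{c_1(\lambda)}{4}\,\|\nu-\gamma\|_{\rm TV}^2,$$ where $c_1(\lambda)=\frac12\big(1-c(\lambda)\big)$, $c(\lambda)=\frac{1-\lambda+\lambda\log\lambda}{(1-\lambda)^2}$ for $\lambda\ne1$ and $c(1)=\frac12$.
   Context: $\gamma$ is the standard Gaussian measure on $\mathbb{R}^n$, $d\gamma(x) = (2\pi)^{-n/2}e^{-|x|^2/2}dx$. For a probability measure $d\nu=f\,d\gamma$, $\mathrm{H}(\nu)=\int_{\mathbb{R}^n} f\log f\,d\gamma$, $\mathrm{I}(\nu)=\int_{\mathbb{R}^n}\frac{|\nabla f|^2}{f}\,d\gamma$ (integral over $\{f>0\}$), and $\delta_{\rm LSI}(\nu)=\frac12\mathrm{I}(\nu)-\mathrm{H}(\nu)$. Standing convention: the density $f\ge 0$ is regular enough (weakly differentiable, $f\in W^{1,1}_{loc}$) for these quantities to be well-defined, and they are finite. The total variation norm is normalized so that $\|\nu-\gamma\|_{\rm TV}=\int|f-1|\,d\gamma$. $\mathcal{P}(\lambda)$ is the class of Borel probability measures $\nu$ on $\mathbb{R}^n$ satisfying a Poincaré inequality with constant $\lambda>0$: for every smooth $g:\mathbb{R}^n\to\mathbb{R}$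 with $\int g\,d\nu=0$, $\lambda\int_{\mathbb{R}^n} g^2\,d\nu\le\int_{\mathbb{R}^n}|\nabla g|^2\,d\nu$. *)

theory Defs
  imports "HOL-Probability.Probability"
begin

definition gauss_measure :: "(real ^ 'n) measure" where
  "gauss_measure =
     density lborel (\<lambda>x. ennreal ((2 * pi) powr (- real CARD('n) / 2) * exp (- (norm x)\<^sup>2 / 2)))"

definition partial_deriv :: "'n::finite \<Rightarrow> (real ^ 'n \<Rightarrow> real) \<Rightarrow> real ^ 'n \<Rightarrow> real" where
  "partial_deriv i g x = frechet_derivative g (at x) (axis i 1)"

definition grad :: "(real ^ 'n \<Rightarrow> real) \<Rightarrow> real ^ 'n \<Rightarrow> real ^ 'n" where
  "grad g x = (\<chi> i. partial_deriv i g x)"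

primrec C_diff :: "nat \<Rightarrow> (real ^ 'n::finite \<Rightarrow> real) \<Rightarrow> bool" where
  "C_diff 0 g \<longleftrightarrow> continuous_on UNIV g"
| "C_diff (Suc k) g \<longleftrightarrow> (\<forall>x. g differentiable (at x)) \<and> (\<forall>i. C_diff k (partial_deriv i g))"

definition smooth :: "(real ^ 'n \<Rightarrow> real) \<Rightarrow> bool" where
  "smooth g \<longleftrightarrow> (\<forall>k. C_diff k g)"

definition test_function :: "(real ^ 'n \<Rightarrow> real) \<Rightarrow> bool" where
  "test_function \<phi> \<longleftrightarrow> smooth \<phi> \<and> compact (closure {x. \<phi> x \<noteq> 0})"

definition locally_integrable ::
    "(real ^ 'n \<Rightarrow> 'b::{banach, second_countable_topology}) \<Rightarrow> bool" where
  "locally_integrable f \<longleftrightarrow> (\<forall>K. compact K \<longrightarrow> set_integrable lborel K f)"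

definition has_weak_gradient :: "(real ^ 'n \<Rightarrow> real) \<Rightarrow> (real ^ 'n \<Rightarrow> real ^ 'n) \<Rightarrow> bool" where
  "has_weak_gradient f G \<longleftrightarrow>
     (\<forall>\<phi> i. test_function \<phi> \<longrightarrow>
        (\<integral>x. f x * partial_deriv i \<phi> x \<partial>lborel) = - (\<integral>x. G x $ i * \<phi> x \<partial>lborel))"

definition W11_loc :: "(real ^ 'n \<Rightarrow> real) set" where
  "W11_loc = {f. locally_integrable f \<and> (\<exists>G. locally_integrable G \<and> has_weak_gradient f G)}"

text \<open>The weak gradient is determined only up to Lebesgue-null sets; an arbitrary
  representative is chosen.\<close>

definition weak_grad :: "(real ^ 'n \<Rightarrow> real) \<Rightarrow> real ^ 'n \<Rightarrow> real ^ 'n" where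
  "weak_grad f = (SOME G. locally_integrable G \<and> has_weak_gradient f G)"

text \<open>The functionals of \<open>\<nu> = density gauss_measure f\<close> are expressed through the
  density \<open>f\<close>. The convention \<open>0 log 0 = 0\<close> holds automatically because of the factor \<open>f x\<close>.\<close>

definition rel_entropy :: "(real ^ 'n \<Rightarrow> real) \<Rightarrow> real" where
  "rel_entropy f = (\<integral>x. f x * ln (f x) \<partial>gauss_measure)"

definition fisher_info :: "(real ^ 'n \<Rightarrow> real) \<Rightarrow> real" where
  "fisher_info f = (LINT x:{x. f x > 0}|gauss_measure. (norm (weak_grad f x))\<^sup>2 / f x)"

definition finite_entropy :: "(real ^ 'n \<Rightarrow> real) \<Rightarrow> bool" where
  "finite_entropy f \<longleftrightarrow> integrable gauss_measure (\<lambda>x. f x * ln (f x))"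

definition finite_fisher_info :: "(real ^ 'n \<Rightarrow> real) \<Rightarrow> bool" where
  "finite_fisher_info f \<longleftrightarrow>
     set_integrable gauss_measure {x. f x > 0} (\<lambda>x. (norm (weak_grad f x))\<^sup>2 / f x)"

definition deficit_LSI :: "(real ^ 'n \<Rightarrow> real) \<Rightarrow> real" where
  "deficit_LSI f = fisher_info f / 2 - rel_entropy f"

text \<open>Nonnegative integrals make the inequality meaningful in \<open>[0,\<infinity>]\<close> when \<open>g\<close> or its gradient
  is not square integrable; a Bochner integral would silently be \<open>0\<close> there.\<close>

definition poincare_class :: "real \<Rightarrow> (real ^ 'n) measure set" where
  "poincare_class lam = {\<nu>. prob_space \<nu> \<and> sets \<nu> = sets borel \<and>
     (\<forall>g. smooth g \<and> integrable \<nu> g \<and> (\<integral>x. g x \<partial>\<nu>) = 0 \<longrightarrow>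
        ennreal lam * (\<integral>\<^sup>+x. ennreal ((g x)\<^sup>2) \<partial>\<nu>) \<le> (\<integral>\<^sup>+x. ennreal ((norm (grad g x))\<^sup>2) \<partial>\<nu>))}"

definition centered :: "(real ^ 'n) measure \<Rightarrow> bool" where
  "centered \<nu> \<longleftrightarrow> integrable \<nu> (\<lambda>x. x) \<and> (\<integral>x. x \<partial>\<nu>) = 0"

text \<open>Total variation norm \<open>|M - N|(space M)\<close> of the signed measure \<open>M - N\<close>, for finite measures
  on the same \<open>\<sigma>\<close>-algebra. With this normalization two mutually singular probability measures
  are at distance 2.\<close>

definition tv_norm_diff :: "'a measure \<Rightarrow> 'a measure \<Rightarrow> real" where
  "tv_norm_diff M N =
     (SUP P\<in>{P. finite P \<and> disjoint P \<and> P \<subseteq> sets M}. \<Sum>A\<in>P. \<bar>measure M A - measure N A\<bar>)"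

definition c_const :: "real \<Rightarrow> real" where
  "c_const lam = (if lam = 1 then 1 / 2 else (1 - lam + lam * ln lam) / (1 - lam)\<^sup>2)"

definition c1_const :: "real \<Rightarrow> real" where
  "c1_const lam = (1 - c_const lam) / 2"

end

theory Submission
  imports Defs
begin

text \<open>
  Write \<open>\<gamma>\<close> for the Gaussian measure, \<open>I\<close> for the Fisher information and \<open>H\<close> for the entropy. The heart
  is the improved logarithmic Sobolev inequality \<open>H \<le> c(\<lambda>)/2 I\<close>; since \<open>(\<integral>\<bar>f - 1\<bar> d\<gamma>)\<^sup>2 \<le> 4 H\<close>, it gives
  \<open>I/2 - H \<ge> c\<^sub>1(\<lambda>) I \<ge> c\<^sub>1(\<lambda>) (\<integral>\<bar>f - 1\<bar> d\<gamma>)\<^sup>2 / 4\<close>.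

  By duality \<open>H = sup (\<integral>f ln g d\<gamma> - ln \<integral>g d\<gamma>)\<close>, so only smooth \<open>g\<close> bounded away from \<open>0\<close> and \<open>\<infinity>\<close> are
  needed and \<open>f\<close> enters linearly. With \<open>X \<sim> f\<gamma>\<close> and \<open>Z \<sim> \<gamma>\<close> independent, put
  \<open>v(t, y) = E g(y + sqrt(1 - t) Z)\<close>, \<open>S = \<nabla> ln v(t, \<cdot>)\<close> and \<open>Y\<^sub>t = tX + sqrt(t(1 - t)) Z\<close>. Then \<open>E ln v(t, Y\<^sub>t)\<close> runs
  from \<open>ln \<integral>g d\<gamma>\<close> to \<open>\<integral>f ln g d\<gamma>\<close>, and the heat equation with Gaussian integration by parts gives its derivative
  \<open>\<integral>\<nabla>f \<bullet> U d\<gamma> - E\<bar>S(Y\<^sub>t)\<bar>\<^sup>2 / 2\<close> where \<open>U(x) = E S(tx + sqrt(t(1 - t)) Z)\<close>. As \<open>\<nu> = f\<gamma>\<close> is centered, \<open>\<nabla>f\<close> has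
  mean \<open>0\<close> and \<open>U\<close> may be replaced by \<open>U - E U(X)\<close>, whose variance is at most \<open>\<rho> E\<bar>S(Y\<^sub>t)\<bar>\<^sup>2\<close> with
  \<open>\<rho> = t / (\<lambda>(1 - t) + t)\<close>: the Poincare inequality bounds it by \<open>E\<bar>\<nabla>U\<bar>\<^sup>2 / \<lambda>\<close>, and \<open>\<bar>\<nabla>U\<bar>\<^sup>2\<close> is at most
  \<open>t/(1 - t)\<close> times the conditional variance of \<open>S(Y\<^sub>t)\<close> by Bessel's inequality. Hence the derivative is
  at most \<open>\<rho> I / 2\<close>, and \<open>\<integral>\<^sub>0\<^sup>1 \<rho> dt = c(\<lambda>)\<close>.
\<close>

text \<open>Given X, the point \<open>tX + sqrt(t(1 - t)) Z\<close> has the law at time t of a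
  Brownian bridge from 0 to X. The flow therefore starts at 0 and ends at X, and all smoothing falls
  on g and U: f is met only in integrations by parts against smooth bounded functions, where a weak
  gradient suffices.

  The gain is all in \<rho>. Jensen's inequality alone bounds the second moment of U with \<rho> =
  1, which yields the classical inequality H \<le> I/2; passing to the variance makes \<rho> smaller
  than 1. Young's inequality is used with weight exactly \<rho>, so that its share of the variance
  of U is absorbed by the negative term and I receives the factor \<rho>/2.

  The technical obstacle sits at the zeros of f. The Fisher information sees only {f > 0}, whereas
  integration by parts sees the weak gradient everywhere. So the weak gradient of a nonnegative
  function has to vanish almost everywhere on its zero set, and this is proved through
  differentiability in L1.\<close>

definition grad_at :: "('a::real_inner \<Rightarrow> real) \<Rightarrow> 'a \<Rightarrow> 'a \<Rightarrow> bool" where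
  "grad_at f d x \<longleftrightarrow> (f has_derivative (\<lambda>h. d \<bullet> h)) (at x)"

section \<open>Product integrals over \<open>real^'n\<close> and the Gaussian density\<close>

lemma prod_Basis_vec:
  fixes h :: "'n::finite \<Rightarrow> 'b::comm_monoid_mult"
  assumes "\<And>i. k (axis i (1::real)) = h i"
  shows "(\<Prod>b\<in>Basis. k b) = (\<Prod>i\<in>UNIV. h i)"
proof -
  have B: "(Basis :: (real ^ 'n) set) = range (\<lambda>i. axis i 1)"
    by (auto simp: Basis_vec_def)
  have "inj (\<lambda>i::'n. axis i (1::real))"
    by (auto simp: inj_on_def axis_eq_axis)
  then show ?thesis
    unfolding B by (subst prod.reindex) (auto simp: assms)
qed

lemma nn_integral_lborel_vec_prod:
  fixes h :: "'n::finite \<Rightarrow> real \<Rightarrow> ennreal"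
  assumes [measurable]: "\<And>i. h i \<in> borel_measurable borel"
  shows "(\<integral>\<^sup>+x. (\<Prod>i\<in>UNIV. h i (x $ i)) \<partial>(lborel :: (real^'n) measure)) = (\<Prod>i\<in>UNIV. \<integral>\<^sup>+s. h i s \<partial>lborel)"
proof -
  define k where "k b = h (the_inv (\<lambda>i::'n. axis i (1::real)) b)" for b :: "real ^ 'n"
  have inj: "inj (\<lambda>i::'n. axis i (1::real))"
    by (auto simp: inj_on_def axis_eq_axis)
  have k: "k (axis i 1) = h i" for i
    by (simp add: k_def the_inv_f_f[OF inj])
  have "(\<integral>\<^sup>+x. (\<Prod>b\<in>Basis. k b (x \<bullet> b)) \<partial>(lborel :: (real^'n) measure)) = (\<Prod>b\<in>Basis. \<integral>\<^sup>+s. k b s \<partial>lborel)"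
    by (rule nn_integral_lborel_prod) (auto simp: k_def)
  moreover have "(\<Prod>b\<in>Basis. k b (x \<bullet> b)) = (\<Prod>i\<in>UNIV. h i (x $ i))" for x
    by (rule prod_Basis_vec) (simp add: k inner_axis)
  moreover have "(\<Prod>b\<in>Basis. \<integral>\<^sup>+s. k b s \<partial>lborel) = (\<Prod>i\<in>UNIV. \<integral>\<^sup>+s. h i s \<partial>lborel)"
    by (rule prod_Basis_vec) (simp add: k)
  ultimately show ?thesis by simp
qed

lemma integrable_lborel_vec_prod:
  fixes h :: "'n::finite \<Rightarrow> real \<Rightarrow> real"
  assumes [measurable]: "\<And>i. integrable lborel (h i)"
  shows "integrable lborel (\<lambda>x::real^'n. \<Prod>i\<in>UNIV. h i (x $ i))"
proof (rule integrableI_bounded)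
  have [measurable]: "\<And>i. h i \<in> borel_measurable borel"
    using borel_measurable_integrable[OF assms] by simp
  show "(\<lambda>x::real^'n. \<Prod>i\<in>UNIV. h i (x $ i)) \<in> borel_measurable lborel"
    by measurable
  have "(\<integral>\<^sup>+x. ennreal (norm (\<Prod>i\<in>UNIV. h i ((x::real^'n) $ i))) \<partial>lborel)
      = (\<integral>\<^sup>+x. (\<Prod>i\<in>UNIV. ennreal \<bar>h i ((x::real^'n) $ i)\<bar>) \<partial>lborel)"
    by (simp add: abs_prod prod_ennreal)
  also have "\<dots> = (\<Prod>i\<in>UNIV. \<integral>\<^sup>+s. ennreal \<bar>h i s\<bar> \<partial>lborel)"
    by (rule nn_integral_lborel_vec_prod) measurable
  also have "\<dots> < \<infinity>"
    using assms by (auto simp: ennreal_prod_eq_top less_top[symmetric] integrable_iff_bounded)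
  finally show "(\<integral>\<^sup>+x. ennreal (norm (\<Prod>i\<in>UNIV. h i ((x::real^'n) $ i))) \<partial>lborel) < \<infinity>" .
qed

lemma integrable_exp_neg_abs:
  assumes "c > 0"
  shows "integrable lborel (\<lambda>s::real. exp (- (\<bar>s\<bar> * c)))"
proof -
  define h where "h s = indicator {0<..} s *\<^sub>R exp (- (s * c))" for s :: real
  have h: "integrable lborel h"
    using integrable_I0i_exp_mscale[OF assms] by (simp add: h_def[abs_def] set_integrable_def)
  then have "integrable lborel (\<lambda>s. h (0 + (-1) * s))"
    by (subst lborel_integrable_real_affine_iff) auto
  \<comment> \<open>\<open>h\<close> lives on the open half line, so the two reflected copies miss
    the point \<open>0\<close>, where the function is \<open>1\<close>.\<close>
  then have "integrable lborel (\<lambda>s. h s + h (- s) + indicator {0} s)"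
    using h by (intro Bochner_Integration.integrable_add integrable_real_indicator) auto
  moreover have "h s + h (- s) + indicator {0} s = exp (- (\<bar>s\<bar> * c))" for s
    by (auto simp: h_def indicator_def)
  ultimately show ?thesis by simp
qed

definition gdens :: "real ^ 'n \<Rightarrow> real" where
  "gdens x = (2 * pi) powr (- real CARD('n) / 2) * exp (- (norm x)\<^sup>2 / 2)"

lemma norm_vec_square: "(norm (x::real^'n))\<^sup>2 = (\<Sum>i\<in>UNIV. (x $ i)\<^sup>2)"
  by (simp add: norm_vec_def L2_set_def sum_nonneg)

lemma gdens_prod: "gdens (x::real^'n) = (\<Prod>i\<in>UNIV. std_normal_density (x $ i))"
proof -
  have "(\<Prod>i\<in>(UNIV::'n set). std_normal_density (x $ i))
      = (1 / sqrt (2 * pi)) ^ CARD('n) * exp (- (norm x)\<^sup>2 / 2)"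
    unfolding std_normal_density_def
    by (simp add: prod_dividef power_divide norm_vec_square exp_sum[symmetric] sum_negf sum_divide_distrib)
  also have "(1 / sqrt (2 * pi)) ^ CARD('n) = (2 * pi) powr (- real CARD('n) / 2)"
  proof -
    have "1 / sqrt (2 * pi) = (2 * pi) powr (- (1/2))"
      by (simp add: powr_minus powr_half_sqrt divide_simps)
    then show ?thesis
      by (simp add: powr_power mult.commute)
  qed
  finally show ?thesis by (simp add: gdens_def)
qed

lemma gdens_pos [simp]: "gdens x > 0" and gdens_nonneg [simp]: "gdens x \<ge> 0"
  by (simp_all add: gdens_def)

lemma gdens_nonzero [simp]: "gdens x \<noteq> 0"
  using gdens_pos[of x] by linarith

lemma gdens_measurable [measurable]: "gdens \<in> borel_measurable borel"
  unfolding gdens_def by measurable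

lemma gauss_measure_gdens: "gauss_measure = density lborel (\<lambda>x. ennreal (gdens x))"
  by (simp add: gauss_measure_def gdens_def)

lemma sets_gauss [simp, measurable_cong]: "sets gauss_measure = sets borel"
  by (simp add: gauss_measure_gdens)

lemma space_gauss [simp]: "space gauss_measure = UNIV"
  by (simp add: gauss_measure_gdens)

lemma prob_space_gauss: "prob_space (gauss_measure :: (real^'n) measure)"
proof
  have "(\<integral>\<^sup>+x. ennreal (gdens x) \<partial>(lborel :: (real^'n) measure))
      = (\<integral>\<^sup>+x. (\<Prod>i\<in>UNIV. ennreal (std_normal_density (x $ i))) \<partial>(lborel :: (real^'n) measure))"
    by (simp add: gdens_prod prod_ennreal)
  also have "\<dots> = (\<Prod>i\<in>(UNIV::'n set). \<integral>\<^sup>+s. ennreal (std_normal_density s) \<partial>lborel)"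
    by (rule nn_integral_lborel_vec_prod) measurable
  also have "(\<integral>\<^sup>+s. ennreal (std_normal_density s) \<partial>lborel) = 1"
    using prob_space.emeasure_space_1[OF prob_space_normal_density[of 1 0]]
    by (simp add: emeasure_density)
  finally show "emeasure (gauss_measure :: (real^'n) measure) (space gauss_measure) = 1"
    by (simp add: gauss_measure_gdens emeasure_density)
qed

lemma integral_gauss:
  fixes h :: "real^'n \<Rightarrow> 'b::{banach, second_countable_topology}"
  assumes "h \<in> borel_measurable borel"
  shows "(\<integral>x. h x \<partial>gauss_measure) = (\<integral>x. gdens x *\<^sub>R h x \<partial>lborel)"
  unfolding gauss_measure_gdens using assms by (subst integral_density) auto

lemma integrable_gauss_iff:
  fixes h :: "real^'n \<Rightarrow> 'b::{banach, second_countable_topology}"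
  assumes "h \<in> borel_measurable borel"
  shows "integrable gauss_measure h \<longleftrightarrow> integrable lborel (\<lambda>x. gdens x *\<^sub>R h x)"
  unfolding gauss_measure_gdens using assms by (subst integrable_density) auto

lemma AE_gauss_iff: "(AE x in gauss_measure. P x) \<longleftrightarrow> (AE x in lborel. P x)"
  unfolding gauss_measure_gdens by (subst AE_density) (auto simp: less_le)

text \<open>Dominated convergence for the difference quotients, which the mean value inequality
  bounds by \<open>2 * B\<close>. The bound is local, within radius \<open>e\<close>, because the
  kernels below are dominated only for nearby centres and the derivative of
  \<open>sqrt (1 - t)\<close> only away from \<open>1\<close>. The variable ranges over any
  Euclidean space, so the same statement also differentiates in time.\<close>

lemma grad_at_integral:
  fixes F :: "'a::euclidean_space \<Rightarrow> 'b \<Rightarrow> real"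
  assumes e: "e > 0"
    and D: "\<And>x y. dist x x0 < e \<Longrightarrow> y \<in> space M \<Longrightarrow> grad_at (\<lambda>x. F x y) (d x y) x"
    and int: "\<And>x. dist x x0 < e \<Longrightarrow> integrable M (F x)"
    and dm: "d x0 \<in> borel_measurable M"
    and B: "integrable M B"
    and bd: "\<And>x y. dist x x0 < e \<Longrightarrow> y \<in> space M \<Longrightarrow> norm (d x y) \<le> B y"
  shows "grad_at (\<lambda>x. \<integral>y. F x y \<partial>M) (\<integral>y. d x0 y \<partial>M) x0 \<and> integrable M (d x0)"
proof -
  have dint: "integrable M (d x0)"
    by (rule Bochner_Integration.integrable_bound[OF B dm])
       (use bd[of x0] e in \<open>auto intro!: AE_I2 intro: order_trans[OF _ abs_ge_self]\<close>)
  have lip: "\<bar>F x y - F x0 y\<bar> \<le> B y * dist x x0" if "dist x x0 < e" "y \<in> space M" for x y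
  proof -
    have "norm (F x y - F x0 y) \<le> B y * norm (x - x0)"
    proof (rule differentiable_bound[where S = "ball x0 e" and f' = "\<lambda>x h. d x y \<bullet> h"])
      show "convex (ball x0 e)" by simp
      fix z assume z: "z \<in> ball x0 e"
      show "((\<lambda>x. F x y) has_derivative (\<lambda>h. d z y \<bullet> h)) (at z within ball x0 e)"
        using D[of z y] z that unfolding grad_at_def by (auto intro: has_derivative_at_withinI simp: dist_commute)
      have "onorm (\<lambda>h. d z y \<bullet> h) \<le> norm (d z y)"
        by (rule onorm_bound) (simp_all add: Cauchy_Schwarz_ineq2)
      also have "\<dots> \<le> B y" using bd[of z y] z that by (auto simp: dist_commute)
      finally show "onorm (\<lambda>h. d z y \<bullet> h) \<le> B y" .
    qed (use that e in \<open>auto simp: dist_commute\<close>)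
    then show ?thesis by (simp add: dist_norm)
  qed
  have "((\<lambda>x. \<integral>y. F x y \<partial>M) has_derivative (\<lambda>h. (\<integral>y. d x0 y \<partial>M) \<bullet> h)) (at x0)"
    unfolding has_derivative_at_within
  proof (intro conjI)
    show "bounded_linear ((\<bullet>) (\<integral>y. d x0 y \<partial>M))"
      by (rule bounded_linear_inner_right)
    show "((\<lambda>x. ((\<integral>y. F x y \<partial>M) - (\<integral>y. F x0 y \<partial>M) - (\<integral>y. d x0 y \<partial>M) \<bullet> (x - x0)) /\<^sub>R norm (x - x0)) \<longlongrightarrow> 0) (at x0)"
      unfolding tendsto_at_iff_sequentially comp_def
    proof (intro allI impI)
      fix X :: "nat \<Rightarrow> 'a" assume X: "\<forall>i. X i \<in> UNIV - {x0}" and lim: "X \<longlonglongrightarrow> x0"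
      from lim e have "\<forall>\<^sub>F i in sequentially. dist (X i) x0 < e"
        by (rule tendstoD)
      then obtain n0 where n0: "\<And>i. i \<ge> n0 \<Longrightarrow> dist (X i) x0 < e"
        by (auto simp: eventually_sequentially)
      define Y where "Y i = X (i + n0)" for i
      have Ye: "dist (Y i) x0 < e" and Yn: "Y i \<noteq> x0" for i
        using n0 X by (auto simp: Y_def)
      have Yl: "Y \<longlonglongrightarrow> x0"
        unfolding Y_def using lim by (rule LIMSEQ_ignore_initial_segment)
      define q where "q i y = (F (Y i) y - F x0 y - d x0 y \<bullet> (Y i - x0)) /\<^sub>R norm (Y i - x0)" for i y
      have F0: "integrable M (F x0)" using int e by simp
      have qint: "integrable M (q i)" for i
        unfolding q_def using F0 int[OF Ye] dint by (auto intro!: integrable_scaleR_right)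
      have "(\<lambda>i. \<integral>y. q i y \<partial>M) \<longlonglongrightarrow> (\<integral>y. 0 \<partial>M)"
      proof (rule integral_dominated_convergence[where w = "\<lambda>y. 2 * B y"])
        show "AE y in M. (\<lambda>i. q i y) \<longlonglongrightarrow> 0"
        proof (rule AE_I2)
          fix y assume y: "y \<in> space M"
          have "((\<lambda>x. F x y) has_derivative (\<lambda>h. d x0 y \<bullet> h)) (at x0)"
            using D[of x0 y] e y by (simp add: grad_at_def)
          then have "((\<lambda>x. (F x y - F x0 y - d x0 y \<bullet> (x - x0)) /\<^sub>R norm (x - x0)) \<longlongrightarrow> 0) (at x0)"
            by (simp add: has_derivative_at_within)
          then show "(\<lambda>i. q i y) \<longlonglongrightarrow> 0"
            unfolding q_def tendsto_at_iff_sequentially comp_def using Yl Yn by auto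
        qed
        show "AE y in M. norm (q i y) \<le> 2 * B y" for i
        proof (rule AE_I2)
          fix y assume y: "y \<in> space M"
          have p: "norm (Y i - x0) > 0" using Yn by simp
          have "\<bar>F (Y i) y - F x0 y - d x0 y \<bullet> (Y i - x0)\<bar> \<le> \<bar>F (Y i) y - F x0 y\<bar> + \<bar>d x0 y \<bullet> (Y i - x0)\<bar>"
            by simp
          also have "\<dots> \<le> B y * norm (Y i - x0) + B y * norm (Y i - x0)"
          proof (rule add_mono)
            show "\<bar>F (Y i) y - F x0 y\<bar> \<le> B y * norm (Y i - x0)"
              using lip[OF Ye y] by (simp add: dist_norm)
            have "\<bar>d x0 y \<bullet> (Y i - x0)\<bar> \<le> norm (d x0 y) * norm (Y i - x0)"
              by (rule Cauchy_Schwarz_ineq2)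
            also have "\<dots> \<le> B y * norm (Y i - x0)"
              using bd[of x0 y] e y by (intro mult_right_mono) auto
            finally show "\<bar>d x0 y \<bullet> (Y i - x0)\<bar> \<le> B y * norm (Y i - x0)" .
          qed
          finally show "norm (q i y) \<le> 2 * B y"
            using p by (simp add: q_def abs_mult field_simps)
        qed
      qed (use B qint in \<open>auto intro!: borel_measurable_integrable\<close>)
      moreover have "(\<integral>y. q i y \<partial>M) = ((\<integral>y. F (Y i) y \<partial>M) - (\<integral>y. F x0 y \<partial>M) - (\<integral>y. d x0 y \<partial>M) \<bullet> (Y i - x0)) /\<^sub>R norm (Y i - x0)" for i
        unfolding q_def using F0 int[OF Ye, of i] dint by simp
      ultimately have "(\<lambda>i. ((\<integral>y. F (X (i + n0)) y \<partial>M) - (\<integral>y. F x0 y \<partial>M) - (\<integral>y. d x0 y \<partial>M) \<bullet> (X (i + n0) - x0)) /\<^sub>R norm (X (i + n0) - x0)) \<longlonglongrightarrow> 0"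
        by (simp add: Y_def)
      then show "(\<lambda>i. ((\<integral>y. F (X i) y \<partial>M) - (\<integral>y. F x0 y \<partial>M) - (\<integral>y. d x0 y \<partial>M) \<bullet> (X i - x0)) /\<^sub>R norm (X i - x0)) \<longlonglongrightarrow> 0"
        by (rule LIMSEQ_offset)
    qed
  qed
  with dint show ?thesis
    by (simp add: grad_at_def)
qed

section \<open>Gaussian kernels\<close>

lemma grad_at_partial_deriv: "grad_at f d x \<Longrightarrow> partial_deriv i f x = d $ i"
  unfolding grad_at_def partial_deriv_def
  by (drule frechet_derivative_at) (auto simp: inner_axis dest: fun_cong[of _ _ "axis i 1"])

lemma grad_at_grad: "grad_at f d x \<Longrightarrow> grad f x = d"
  by (simp add: grad_def grad_at_partial_deriv vec_eq_iff)

lemma grad_at_differentiable: "grad_at f d x \<Longrightarrow> f differentiable (at x)"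
  by (auto simp: grad_at_def differentiable_def)

lemma grad_at_continuous:
  assumes "\<And>x. grad_at f (d x) x"
  shows "continuous_on UNIV f"
  using assms grad_at_differentiable differentiable_imp_continuous_within
  by (metis continuous_at_imp_continuous_on)

lemma grad_at_unique: "grad_at f d x \<Longrightarrow> grad_at f d' x \<Longrightarrow> d = d'"
  unfolding grad_at_def using has_derivative_unique[of f "\<lambda>h. d \<bullet> h" x "\<lambda>h. d' \<bullet> h"]
  by (metis vector_eq_rdot inner_commute)

lemma grad_at_cmult: "grad_at f d x \<Longrightarrow> grad_at (\<lambda>x. c * f x) (c *\<^sub>R d) x"
  unfolding grad_at_def by (auto intro!: derivative_eq_intros)

lemma integral_vec_nth:
  fixes v :: "'a \<Rightarrow> real^'n"
  shows "integrable M v \<Longrightarrow> (\<integral>y. v y \<partial>M) $ i = (\<integral>y. v y $ i \<partial>M)"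
  by (rule integral_bounded_linear[OF bounded_linear_vec_nth, symmetric])

lemma borel_measurable_vec_lambda [measurable (raw)]:
  fixes v :: "'n::finite \<Rightarrow> 'a \<Rightarrow> real"
  assumes "\<And>i. v i \<in> borel_measurable M"
  shows "(\<lambda>x. \<chi> i. v i x) \<in> borel_measurable M"
proof -
  have "(\<lambda>x. \<chi> i. v i x) = (\<lambda>x. \<Sum>i\<in>UNIV. v i x *\<^sub>R axis i 1)"
    by (auto simp: vec_eq_iff axis_def fun_eq_iff if_distrib cong: if_cong)
  then show ?thesis using assms by simp
qed

lemma poly_exp_bound: "\<exists>C\<ge>0. \<exists>d\<ge>0. \<forall>s::real. \<bar>poly p s\<bar> \<le> C * exp (d * \<bar>s\<bar>)"
proof (induction p)
  case 0
  show ?case by (auto intro!: exI[of _ 0])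
next
  case (pCons a p)
  then obtain C d where C: "C \<ge> 0" "d \<ge> 0" "\<And>s. \<bar>poly p s\<bar> \<le> C * exp (d * \<bar>s\<bar>)" by blast
  have "\<bar>poly (pCons a p) s\<bar> \<le> (\<bar>a\<bar> + C) * exp ((d + 1) * \<bar>s\<bar>)" for s
  proof -
    have "\<bar>poly (pCons a p) s\<bar> \<le> \<bar>a\<bar> * 1 + \<bar>s\<bar> * \<bar>poly p s\<bar>"
      by (simp add: abs_mult[symmetric])
    moreover have "\<bar>s\<bar> \<le> exp \<bar>s\<bar>"
      using exp_ge_add_one_self[of "\<bar>s\<bar>"] by linarith
    then have "\<bar>a\<bar> * 1 + \<bar>s\<bar> * \<bar>poly p s\<bar> \<le> \<bar>a\<bar> * exp ((d + 1) * \<bar>s\<bar>) + exp \<bar>s\<bar> * (C * exp (d * \<bar>s\<bar>))"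
      using C by (intro add_mono mult_left_mono mult_mono) auto
    moreover have "\<bar>a\<bar> * exp ((d + 1) * \<bar>s\<bar>) + exp \<bar>s\<bar> * (C * exp (d * \<bar>s\<bar>)) = (\<bar>a\<bar> + C) * exp ((d + 1) * \<bar>s\<bar>)"
      by (simp add: algebra_simps exp_add)
    ultimately show ?thesis by linarith
  qed
  with C show ?case by (intro exI[of _ "\<bar>a\<bar> + C"] conjI exI[of _ "d + 1"]) auto
qed

text \<open>Gaussian decay is weakened to exponential decay because the latter survives
  translations: moving the centre of the kernel by a bounded amount costs only a constant
  factor.\<close>

lemma poly_normal_bound: "\<exists>C\<ge>0. \<forall>s. \<bar>poly p s * std_normal_density s\<bar> \<le> C * exp (- \<bar>s\<bar>)"
proof -
  obtain C d where C: "C \<ge> 0" "d \<ge> 0" "\<And>s::real. \<bar>poly p s\<bar> \<le> C * exp (d * \<bar>s\<bar>)"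
    using poly_exp_bound[of p] by blast
  have "\<bar>poly p s * std_normal_density s\<bar> \<le> C * exp ((d + 1)\<^sup>2 / 2) * exp (- \<bar>s\<bar>)" for s
  proof -
    have n: "std_normal_density s \<le> exp (- s\<^sup>2 / 2)"
    proof -
      have "1 / sqrt (2 * pi) \<le> 1" using pi_gt3 by (simp add: divide_simps)
      then show ?thesis
        unfolding std_normal_density_def by (intro mult_left_le_one_le) auto
    qed
    have "\<bar>poly p s * std_normal_density s\<bar> \<le> C * exp (d * \<bar>s\<bar>) * exp (- s\<^sup>2 / 2)"
      unfolding abs_mult using C n by (intro mult_mono) (auto simp: zero_le_mult_iff)
    also have "\<dots> = C * exp (d * \<bar>s\<bar> - s\<^sup>2 / 2)" by (simp add: mult.assoc exp_add[symmetric])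
    also have "\<dots> \<le> C * exp ((d + 1)\<^sup>2 / 2 - \<bar>s\<bar>)"
    proof (rule mult_left_mono)
      \<comment> \<open>The centre \<open>d + 1\<close> of the square pays for the growth rate
        \<open>d\<close> of the polynomial and for the decay rate \<open>1\<close> wanted in the
        result.\<close>
      have "0 \<le> (\<bar>s\<bar> - (d + 1))\<^sup>2" by simp
      then have "d * \<bar>s\<bar> - s\<^sup>2 / 2 \<le> (d + 1)\<^sup>2 / 2 - \<bar>s\<bar>"
        by (simp add: power2_eq_square algebra_simps)
      then show "exp (d * \<bar>s\<bar> - s\<^sup>2 / 2) \<le> exp ((d + 1)\<^sup>2 / 2 - \<bar>s\<bar>)" by simp
    qed (use C in simp)
    finally show ?thesis by (simp add: mult.assoc exp_add[symmetric])
  qed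
  with C show ?thesis by (intro exI[of _ "C * exp ((d + 1)\<^sup>2 / 2)"]) auto
qed

text \<open>Weights that factor over the coordinates are stable under differentiation of the
  Gaussian kernel, which changes one factor at a time, so all derivatives of a kernel transform are
  again kernel transforms.\<close>

definition mpoly :: "('n::finite \<Rightarrow> real poly) \<Rightarrow> real^'n \<Rightarrow> real" where
  "mpoly p z = (\<Prod>i\<in>UNIV. poly (p i) (z $ i))"

text \<open>Differentiating the Gaussian kernel in direction \<open>i\<close> turns a polynomial weight \<open>p\<close> into \<open>herm i p\<close>.\<close>

definition herm :: "'n::finite \<Rightarrow> ('n \<Rightarrow> real poly) \<Rightarrow> 'n \<Rightarrow> real poly" where
  "herm i p = p(i := [:0, 1:] * p i - pderiv (p i))"

lemma borel_measurable_poly [measurable]: "poly (p::real poly) \<in> borel_measurable borel"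
  by (intro borel_measurable_continuous_onI continuous_intros)

lemma mpoly_measurable [measurable]: "mpoly p \<in> borel_measurable borel"
  unfolding mpoly_def by measurable

lemma mpoly_gdens: "gdens z * mpoly p z = (\<Prod>i\<in>UNIV. poly (p i) (z $ i) * std_normal_density (z $ i))"
  by (simp add: gdens_prod mpoly_def prod.distrib mult.commute)

lemma mpoly_gdens_bound:
  fixes p :: "'n::finite \<Rightarrow> real poly"
  shows "\<exists>C\<ge>0. \<forall>z. \<bar>gdens z * mpoly p z\<bar> \<le> C * exp (- (\<Sum>i\<in>UNIV. \<bar>z $ i\<bar>))"
proof -
  have "\<forall>i. \<exists>C\<ge>0. \<forall>s. \<bar>poly (p i) s * std_normal_density s\<bar> \<le> C * exp (- \<bar>s\<bar>)"
    using poly_normal_bound by auto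
  then obtain C where C: "\<And>i. C i \<ge> 0" "\<And>i s. \<bar>poly (p i) s * std_normal_density s\<bar> \<le> C i * exp (- \<bar>s\<bar>)"
    by metis
  have "\<bar>gdens z * mpoly p z\<bar> \<le> (\<Prod>i\<in>UNIV. C i) * exp (- (\<Sum>i\<in>UNIV. \<bar>z $ i\<bar>))" for z
  proof -
    have "\<bar>gdens z * mpoly p z\<bar> \<le> (\<Prod>i\<in>UNIV. C i * exp (- \<bar>z $ i\<bar>))"
      unfolding mpoly_gdens abs_prod using C by (intro prod_mono) auto
    then show ?thesis by (simp add: prod.distrib exp_sum[symmetric] sum_negf)
  qed
  then show ?thesis using C by (intro exI[of _ "\<Prod>i\<in>UNIV. C i"]) (auto intro: prod_nonneg)
qed

lemma integrable_exp_neg_sum_abs: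
  assumes "c > 0"
  shows "integrable lborel (\<lambda>z::real^'n. exp (- (\<Sum>i\<in>UNIV. \<bar>z $ i\<bar> * c)))"
proof -
  have "integrable lborel (\<lambda>z::real^'n. \<Prod>i\<in>UNIV. exp (- (\<bar>z $ i\<bar> * c)))"
    by (rule integrable_lborel_vec_prod) (rule integrable_exp_neg_abs[OF assms])
  then show ?thesis by (simp add: exp_sum[symmetric] sum_negf)
qed

text \<open>In one variable \<open>(p * \<phi>)' = (p' - s * p) * \<phi>\<close> for the normal
  density \<phi>, hence the minus sign in front of \<open>herm\<close>. It cancels against the minus
  sign in \<open>(\<eta> - \<tau> *\<^sub>R x) /\<^sub>R \<sigma>\<close> when kernel transforms are
  differentiated.\<close>

lemma grad_at_mpoly_gdens:
  "grad_at (\<lambda>z. gdens z * mpoly p z) (\<chi> i. - (gdens z * mpoly (herm i p) z)) z"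
proof -
  let ?k = "\<lambda>i s. poly (p i) s * std_normal_density s"
  let ?k' = "\<lambda>i s. - (poly (herm i p i) s * std_normal_density s)"
  have d: "(?k i has_field_derivative ?k' i s) (at s)" for i s
    unfolding std_normal_density_def herm_def
    by (rule derivative_eq_intros refl poly_DERIV | simp)+ (simp add: field_simps)
  have "((\<lambda>z. ?k i (z $ i)) has_derivative (\<lambda>h. ?k' i (z $ i) * h $ i)) (at z)" for i
    using d[of i "z $ i"] unfolding has_field_derivative_def
    by (rule has_derivative_compose[OF bounded_linear.has_derivative[OF bounded_linear_vec_nth has_derivative_ident]])
  then have "((\<lambda>z. \<Prod>i\<in>UNIV. ?k i (z $ i)) has_derivative
      (\<lambda>h. \<Sum>i\<in>UNIV. (?k' i (z $ i) * h $ i) * (\<Prod>j\<in>UNIV - {i}. ?k j (z $ j)))) (at z)"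
    by (rule has_derivative_prod)
  moreover have "(?k' i (z $ i) * c) * (\<Prod>j\<in>UNIV - {i}. ?k j (z $ j)) = - (gdens z * mpoly (herm i p) z) * c" for i c
  proof -
    have "gdens z * mpoly (herm i p) z
        = (poly (herm i p i) (z $ i) * std_normal_density (z $ i)) *
          (\<Prod>j\<in>UNIV - {i}. poly (herm i p j) (z $ j) * std_normal_density (z $ j))"
      unfolding mpoly_gdens by (rule prod.remove) auto
    also have "(\<Prod>j\<in>UNIV - {i}. poly (herm i p j) (z $ j) * std_normal_density (z $ j)) = (\<Prod>j\<in>UNIV - {i}. ?k j (z $ j))"
      by (rule prod.cong) (auto simp: herm_def)
    finally show ?thesis by simp
  qed
  then have "(\<Sum>i\<in>UNIV. (?k' i (z $ i) * h $ i) * (\<Prod>j\<in>UNIV - {i}. ?k j (z $ j)))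
      = (\<chi> i. - (gdens z * mpoly (herm i p) z)) \<bullet> h" for h
    unfolding inner_vec_def vec_lambda_beta inner_real_def by (intro sum.cong refl)
  moreover have "(\<lambda>z. gdens z * mpoly p z) = (\<lambda>z. \<Prod>i\<in>UNIV. ?k i (z $ i))"
    by (simp add: mpoly_gdens fun_eq_iff)
  ultimately show ?thesis
    unfolding grad_at_def by simp
qed

lemma integrable_gauss_mpoly:
  fixes p :: "'n::finite \<Rightarrow> real poly"
  shows "integrable gauss_measure (mpoly p)"
proof -
  obtain C where C: "C \<ge> 0" "\<And>z. \<bar>gdens z * mpoly p z\<bar> \<le> C * exp (- (\<Sum>i\<in>UNIV. \<bar>z $ i\<bar>))"
    using mpoly_gdens_bound[of p] by blast
  have "integrable lborel (\<lambda>z. gdens z * mpoly p z)"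
  proof (rule Bochner_Integration.integrable_bound)
    show "integrable lborel (\<lambda>z::real^'n. C * exp (- (\<Sum>i\<in>UNIV. \<bar>z $ i\<bar>)))"
      using integrable_exp_neg_sum_abs[of 1, where 'n = 'n] by simp
  qed (use C in \<open>auto simp: abs_mult intro!: AE_I2\<close>)
  then show ?thesis by (subst integrable_gauss_iff) auto
qed

lemma integrable_gauss_bounded:
  fixes h :: "real^'n \<Rightarrow> 'b::{banach, second_countable_topology}"
  assumes "h \<in> borel_measurable borel" "\<And>x. norm (h x) \<le> K"
  shows "integrable gauss_measure h"
proof -
  interpret prob_space "gauss_measure :: (real^'n) measure" by (rule prob_space_gauss)
  show ?thesis using assms by (intro integrable_const_bound[where B = K]) auto
qed

lemma integrable_mult_bounded:
  fixes k h :: "'a \<Rightarrow> real"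
  assumes k: "integrable M k" and h: "h \<in> borel_measurable M" "\<And>x. \<bar>h x\<bar> \<le> K"
  shows "integrable M (\<lambda>x. k x * h x)"
proof (rule Bochner_Integration.integrable_bound)
  show "integrable M (\<lambda>x. K * k x)" using k by simp
  show "(\<lambda>x. k x * h x) \<in> borel_measurable M"
    using h(1) borel_measurable_integrable[OF k] by simp
  have "\<bar>k x * h x\<bar> \<le> \<bar>K * k x\<bar>" for x
  proof -
    have "\<bar>h x\<bar> * \<bar>k x\<bar> \<le> \<bar>K\<bar> * \<bar>k x\<bar>"
      using h(2)[of x] by (intro mult_right_mono) auto
    then show ?thesis by (simp add: abs_mult mult.commute)
  qed
  then show "AE x in M. norm (k x * h x) \<le> norm (K * k x)" by simp
qed

lemma integrable_gauss_bounded_mult: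
  fixes h :: "real^'n \<Rightarrow> real"
  assumes "h \<in> borel_measurable borel" "\<And>x. \<bar>h x\<bar> \<le> K" "integrable gauss_measure k"
  shows "integrable gauss_measure (\<lambda>x. h x * k x)"
  using integrable_mult_bounded[OF assms(3), of h K] assms(1,2) by (simp add: mult.commute)

text \<open>For \<open>p = (\<lambda>_. 1)\<close> this averages \<open>h\<close> over a Gaussian:
  the heat semigroup when \<open>\<tau> = 1\<close>, and the conditional expectation of
  \<open>h\<close> at the flow point, given \<open>X = x\<close>, when \<open>\<tau> = t\<close> and
  \<open>\<sigma> = sqrt (t * (1 - t))\<close>. The polynomial weights produce its
  derivatives.\<close>

definition gker :: "(real^'n \<Rightarrow> real) \<Rightarrow> real \<Rightarrow> real \<Rightarrow> ('n \<Rightarrow> real poly) \<Rightarrow> real^'n \<Rightarrow> real" where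
  "gker h \<tau> \<sigma> p x = (\<integral>z. h (\<tau> *\<^sub>R x + \<sigma> *\<^sub>R z) * mpoly p z \<partial>gauss_measure)"

text \<open>The substitution \<open>\<eta> = \<tau> *\<^sub>R x + \<sigma> *\<^sub>R z\<close> moves
  the dependence on \<open>x\<close> from \<open>h\<close>, which is merely measurable, to the
  smooth kernel.\<close>

lemma gker_lborel:
  fixes h :: "real^'n \<Rightarrow> real"
  assumes [measurable]: "h \<in> borel_measurable borel" and "\<sigma> > 0"
  shows "gker h \<tau> \<sigma> p x = (\<integral>\<eta>. h \<eta> * (gdens ((\<eta> - \<tau> *\<^sub>R x) /\<^sub>R \<sigma>) * mpoly p ((\<eta> - \<tau> *\<^sub>R x) /\<^sub>R \<sigma>)) \<partial>lborel) / \<sigma> ^ CARD('n)"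
proof -
  let ?k = "\<lambda>\<eta>. h \<eta> * (gdens ((\<eta> - \<tau> *\<^sub>R x) /\<^sub>R \<sigma>) * mpoly p ((\<eta> - \<tau> *\<^sub>R x) /\<^sub>R \<sigma>))"
  have "(\<integral>\<eta>. ?k \<eta> \<partial>lborel) = (\<integral>\<eta>. ?k \<eta> \<partial>density (distr lborel borel (\<lambda>z. \<tau> *\<^sub>R x + \<sigma> *\<^sub>R z)) (\<lambda>_. ennreal (\<bar>\<sigma>\<bar> ^ DIM(real^'n))))"
    using \<open>\<sigma> > 0\<close> lborel_affine[of \<sigma> "\<tau> *\<^sub>R x"] by (simp add: ennreal_power)
  also have "\<dots> = (\<integral>z. \<sigma> ^ CARD('n) * ?k (\<tau> *\<^sub>R x + \<sigma> *\<^sub>R z) \<partial>lborel)"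
    using \<open>\<sigma> > 0\<close> by (subst integral_density) (auto simp: integral_distr)
  also have "\<dots> = \<sigma> ^ CARD('n) * (\<integral>z. gdens z * (h (\<tau> *\<^sub>R x + \<sigma> *\<^sub>R z) * mpoly p z) \<partial>lborel)"
    using \<open>\<sigma> > 0\<close> by (subst integral_mult_right_zero[symmetric]) (simp add: mult_ac)
  also have "\<dots> = \<sigma> ^ CARD('n) * gker h \<tau> \<sigma> p x"
    unfolding gker_def by (subst integral_gauss) auto
  finally show ?thesis using \<open>\<sigma> > 0\<close> by simp
qed

lemma gker_integrable:
  assumes [measurable]: "h \<in> borel_measurable borel" and K: "\<And>x. \<bar>h x\<bar> \<le> K"
  shows "integrable gauss_measure (\<lambda>z. h (\<tau> *\<^sub>R x + \<sigma> *\<^sub>R z) * mpoly p z)"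
  using K by (intro integrable_gauss_bounded_mult integrable_gauss_mpoly) auto

lemma gker_bound:
  assumes [measurable]: "h \<in> borel_measurable borel" and K: "\<And>x. \<bar>h x\<bar> \<le> K"
  shows "\<bar>gker h \<tau> \<sigma> p x\<bar> \<le> K * (\<integral>z. \<bar>mpoly p z\<bar> \<partial>gauss_measure)"
proof -
  have "\<bar>gker h \<tau> \<sigma> p x\<bar> \<le> (\<integral>z. \<bar>h (\<tau> *\<^sub>R x + \<sigma> *\<^sub>R z) * mpoly p z\<bar> \<partial>gauss_measure)"
    unfolding gker_def by (rule integral_abs_bound)
  also have "\<dots> \<le> (\<integral>z. K * \<bar>mpoly p z\<bar> \<partial>gauss_measure)"
    using K integrable_gauss_mpoly[of p]
    by (intro integral_mono[OF integrable_abs[OF gker_integrable[OF assms]]]) (auto simp: abs_mult intro!: mult_right_mono)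
  finally show ?thesis by simp
qed

lemma gker_grad:
  fixes h :: "real^'n \<Rightarrow> real"
  assumes [measurable]: "h \<in> borel_measurable borel" and K: "\<And>x. \<bar>h x\<bar> \<le> K" and s: "\<sigma> > 0"
  shows "grad_at (gker h \<tau> \<sigma> p) (\<chi> i. \<tau> / \<sigma> * gker h \<tau> \<sigma> (herm i p) x) x"
proof -
  define Z where "Z x \<eta> = (\<eta> - \<tau> *\<^sub>R x) /\<^sub>R \<sigma>" for x \<eta> :: "real^'n"
  have Z_meas [measurable]: "Z x \<in> borel_measurable borel" for x unfolding Z_def by measurable
  define \<Psi> where "\<Psi> p z = gdens z * mpoly p z" for p and z :: "real^'n"
  have Psi_meas [measurable]: "\<Psi> p \<in> borel_measurable borel" for p unfolding \<Psi>_def by measurable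
  have "\<forall>p. \<exists>C\<ge>0. \<forall>z. \<bar>\<Psi> p z\<bar> \<le> C * exp (- (\<Sum>i\<in>UNIV. \<bar>z $ i\<bar>))"
    unfolding \<Psi>_def using mpoly_gdens_bound by blast
  then obtain C where C: "\<And>p. C p \<ge> 0" "\<And>p z. \<bar>\<Psi> p z\<bar> \<le> C p * exp (- (\<Sum>i\<in>UNIV. \<bar>z $ i\<bar>))"
    by metis
  have K0: "K \<ge> 0" using K[of 0] by linarith
  \<comment> \<open>For centres within distance \<open>1\<close> of \<open>x\<close> the shift of
    \<open>Z\<close> is at most \<open>A\<close> in every coordinate. Summing over the coordinates
    gives the factor \<open>exp (real CARD('n) * A)\<close> in \<open>E\<close>.\<close>
  define A where "A = \<bar>\<tau>\<bar> * (norm x + 1) / \<sigma>"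
  define E where "E \<eta> = exp (real CARD('n) * A) * exp (- (\<Sum>i\<in>UNIV. \<bar>\<eta> $ i\<bar> * (1 / \<sigma>)))" for \<eta> :: "real^'n"
  have E0: "E \<eta> \<ge> 0" for \<eta> by (simp add: E_def)
  have E_int: "integrable lborel E"
    unfolding E_def using integrable_exp_neg_sum_abs[of "1/\<sigma>", where 'n = 'n] s by simp
  have PsiZ: "\<bar>h \<eta> * \<Psi> p (Z x' \<eta>)\<bar> \<le> K * C p * E \<eta>" if "dist x' x < 1" for x' \<eta> p
  proof -
    have nx: "norm x' \<le> norm x + 1"
      using that norm_triangle_ineq2[of x' x] by (simp add: dist_norm)
    have "\<bar>\<eta> $ i\<bar> * (1 / \<sigma>) - A \<le> \<bar>Z x' \<eta> $ i\<bar>" for i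
    proof -
      have "\<bar>\<eta> $ i\<bar> \<le> \<bar>\<eta> $ i - \<tau> * x' $ i\<bar> + \<bar>\<tau>\<bar> * \<bar>x' $ i\<bar>"
        by (simp add: abs_mult[symmetric])
      also have "\<bar>\<tau>\<bar> * \<bar>x' $ i\<bar> \<le> \<bar>\<tau>\<bar> * (norm x + 1)"
        using component_le_norm_cart[of x' i] nx by (intro mult_left_mono) auto
      finally have "\<bar>\<eta> $ i\<bar> \<le> \<bar>\<eta> $ i - \<tau> * x' $ i\<bar> + \<bar>\<tau>\<bar> * (norm x + 1)" by simp
      then have "(\<bar>\<eta> $ i\<bar> - \<bar>\<tau>\<bar> * (norm x + 1)) / \<sigma> \<le> \<bar>\<eta> $ i - \<tau> * x' $ i\<bar> / \<sigma>"
        using s by (intro divide_right_mono) auto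
      moreover have "\<bar>Z x' \<eta> $ i\<bar> = \<bar>\<eta> $ i - \<tau> * x' $ i\<bar> / \<sigma>"
        using s by (simp add: Z_def abs_mult divide_inverse mult.commute)
      ultimately show ?thesis by (simp add: A_def diff_divide_distrib)
    qed
    then have "(\<Sum>i\<in>(UNIV::'n set). \<bar>\<eta> $ i\<bar> * (1 / \<sigma>) - A) \<le> (\<Sum>i\<in>UNIV. \<bar>Z x' \<eta> $ i\<bar>)"
      by (rule sum_mono)
    then have "exp (- (\<Sum>i\<in>UNIV. \<bar>Z x' \<eta> $ i\<bar>)) \<le> E \<eta>"
      unfolding E_def exp_add[symmetric] by (simp add: sum_subtractf)
    then have "\<bar>\<Psi> p (Z x' \<eta>)\<bar> \<le> C p * E \<eta>"
      using C(2)[of p "Z x' \<eta>"] mult_left_mono[OF _ C(1)[of p]] by (blast intro: order_trans)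
    then show ?thesis
      unfolding abs_mult mult.assoc using K K0 by (intro mult_mono) auto
  qed
  define d where "d x' \<eta> = (\<chi> i. \<tau> / \<sigma> * (h \<eta> * \<Psi> (herm i p) (Z x' \<eta>)))" for x' \<eta>
  define B where "B \<eta> = (\<Sum>i\<in>UNIV. \<bar>\<tau> / \<sigma>\<bar> * (K * C (herm i p) * E \<eta>))" for \<eta>
  have *: "grad_at (\<lambda>x. \<integral>\<eta>. h \<eta> * \<Psi> p (Z x \<eta>) \<partial>lborel) (\<integral>\<eta>. d x \<eta> \<partial>lborel) x \<and> integrable lborel (d x)"
  proof (rule grad_at_integral[where e = 1 and B = B])
    fix x' \<eta> assume x': "dist x' x < 1"
    have "((\<lambda>x. \<Psi> p (Z x \<eta>)) has_derivative (\<lambda>k. (\<chi> i. - \<Psi> (herm i p) (Z x' \<eta>)) \<bullet> ((- (\<tau> / \<sigma>)) *\<^sub>R k))) (at x')"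
    proof (rule has_derivative_compose[where f = "\<lambda>x. Z x \<eta>"])
      show "((\<lambda>x. Z x \<eta>) has_derivative (\<lambda>k. (- (\<tau> / \<sigma>)) *\<^sub>R k)) (at x')"
        unfolding Z_def by (auto intro!: derivative_eq_intros simp: divide_inverse mult.commute)
      show "(\<Psi> p has_derivative (\<bullet>) (\<chi> i. - \<Psi> (herm i p) (Z x' \<eta>))) (at (Z x' \<eta>))"
        using grad_at_mpoly_gdens[of p "Z x' \<eta>"] unfolding grad_at_def \<Psi>_def .
    qed
    then have "((\<lambda>x. h \<eta> * \<Psi> p (Z x \<eta>)) has_derivative (\<lambda>k. h \<eta> * ((\<chi> i. - \<Psi> (herm i p) (Z x' \<eta>)) \<bullet> ((- (\<tau> / \<sigma>)) *\<^sub>R k)))) (at x')"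
      by (rule has_derivative_mult_right)
    moreover have "h \<eta> * ((\<chi> i. - \<Psi> (herm i p) (Z x' \<eta>)) \<bullet> ((- (\<tau> / \<sigma>)) *\<^sub>R k)) = d x' \<eta> \<bullet> k" for k
      by (simp add: d_def inner_vec_def sum_distrib_left mult_ac)
    ultimately show "grad_at (\<lambda>x. h \<eta> * \<Psi> p (Z x \<eta>)) (d x' \<eta>) x'"
      by (simp add: grad_at_def)
    have "norm (d x' \<eta>) \<le> (\<Sum>i\<in>UNIV. \<bar>d x' \<eta> $ i\<bar>)" by (rule norm_le_l1_cart)
    also have "\<dots> \<le> B \<eta>"
    proof (unfold B_def, rule sum_mono)
      fix i
      have "\<bar>d x' \<eta> $ i\<bar> = \<bar>\<tau> / \<sigma>\<bar> * \<bar>h \<eta> * \<Psi> (herm i p) (Z x' \<eta>)\<bar>"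
        by (simp add: d_def abs_mult)
      then show "\<bar>d x' \<eta> $ i\<bar> \<le> \<bar>\<tau> / \<sigma>\<bar> * (K * C (herm i p) * E \<eta>)"
        using mult_left_mono[OF PsiZ[OF x', of \<eta> "herm i p"] abs_ge_zero, of "\<tau> / \<sigma>"] by simp
    qed
    finally show "norm (d x' \<eta>) \<le> B \<eta>" .
  next
    fix x' assume "dist x' x < 1"
    note bd = PsiZ[OF this, of _ p]
    show "integrable lborel (\<lambda>\<eta>. h \<eta> * \<Psi> p (Z x' \<eta>))"
    proof (rule Bochner_Integration.integrable_bound)
      show "integrable lborel (\<lambda>\<eta>. K * C p * E \<eta>)" using E_int by simp
      show "AE \<eta> in lborel. norm (h \<eta> * \<Psi> p (Z x' \<eta>)) \<le> norm (K * C p * E \<eta>)"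
        using order_trans[OF bd abs_ge_self] by simp
    qed measurable
  next
    show "integrable lborel B"
      unfolding B_def[abs_def] using E_int by simp
    show "d x \<in> borel_measurable lborel"
      unfolding d_def by measurable
  qed simp
  then have dint: "integrable lborel (d x)" by simp
  from * have "grad_at (\<lambda>x. inverse (\<sigma> ^ CARD('n)) * (\<integral>\<eta>. h \<eta> * \<Psi> p (Z x \<eta>) \<partial>lborel)) (inverse (\<sigma> ^ CARD('n)) *\<^sub>R (\<integral>\<eta>. d x \<eta> \<partial>lborel)) x"
    by (intro grad_at_cmult) simp
  moreover have "inverse (\<sigma> ^ CARD('n)) * (\<integral>\<eta>. h \<eta> * \<Psi> p (Z x \<eta>) \<partial>lborel) = gker h \<tau> \<sigma> p x" for p x
    using gker_lborel[of h \<sigma> \<tau> p x] s by (simp add: \<Psi>_def Z_def divide_inverse)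
  moreover from this[of "herm i p" x for i] have "inverse (\<sigma> ^ CARD('n)) *\<^sub>R (\<integral>\<eta>. d x \<eta> \<partial>lborel) = (\<chi> i. \<tau> / \<sigma> * gker h \<tau> \<sigma> (herm i p) x)"
    using dint by (simp add: vec_eq_iff integral_vec_nth) (simp add: d_def)
  ultimately show ?thesis by simp
qed

lemma gker_continuous:
  assumes "h \<in> borel_measurable borel" "\<And>x. \<bar>h x\<bar> \<le> K" "\<sigma> > 0"
  shows "continuous_on UNIV (gker h \<tau> \<sigma> p)"
  using gker_grad[OF assms] by (rule grad_at_continuous)

lemma gker_measurable:
  assumes "h \<in> borel_measurable borel" "\<And>x. \<bar>h x\<bar> \<le> K" "\<sigma> > 0"
  shows "gker h \<tau> \<sigma> p \<in> borel_measurable borel"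
  using gker_continuous[OF assms] by (rule borel_measurable_continuous_onI)

text \<open>The scalar \<open>c\<close> is there for the induction: a partial derivative of a kernel
  transform is \<open>\<tau> / \<sigma>\<close> times another one.\<close>

lemma gker_C_diff:
  assumes "h \<in> borel_measurable borel" "\<And>x. \<bar>h x\<bar> \<le> K" "\<sigma> > 0"
  shows "C_diff k (\<lambda>x. c * gker h \<tau> \<sigma> p x)"
proof (induction k arbitrary: c p)
  case 0
  show ?case using gker_continuous[OF assms] by (auto intro!: continuous_intros)
next
  case (Suc k)
  note g = grad_at_cmult[OF gker_grad[OF assms]]
  have "partial_deriv i (\<lambda>x. c * gker h \<tau> \<sigma> p x) = (\<lambda>x. (c * (\<tau> / \<sigma>)) * gker h \<tau> \<sigma> (herm i p) x)" for i
    using grad_at_partial_deriv[OF g] by (auto simp: fun_eq_iff)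
  note pd = this
  show ?case
    unfolding C_diff.simps pd by (intro conjI allI Suc.IH grad_at_differentiable[OF g])
qed

section \<open>Gaussian moments, Stein's lemma and Bessel's inequality\<close>

definition mono_p :: "'n::finite \<Rightarrow> 'n \<Rightarrow> real poly" where
  "mono_p i = (\<lambda>_. 1)(i := [:0, 1:])"

lemma mpoly_one [simp]: "mpoly (\<lambda>_. 1) z = 1"
  by (simp add: mpoly_def)

lemma herm_one: "herm i (\<lambda>_. 1) = mono_p i"
  by (simp add: herm_def mono_p_def)

lemma mpoly_mono_p [simp]: "mpoly (mono_p i) z = z $ i"
proof -
  have "mpoly (mono_p i) z = (\<Prod>j\<in>UNIV. if j = i then z $ j else 1)"
    unfolding mpoly_def mono_p_def by (intro prod.cong) auto
  then show ?thesis by simp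
qed

lemma mpoly_herm_mono_p: "mpoly (herm i (mono_p j)) z = z $ i * z $ j - (if i = j then 1 else 0)"
proof (cases "i = j")
  case True
  have "mpoly (herm i (mono_p i)) z = (\<Prod>k\<in>UNIV. if k = i then z $ k * z $ k - 1 else 1)"
    unfolding mpoly_def mono_p_def herm_def by (intro prod.cong) (auto simp: pderiv_pCons)
  then show ?thesis using True by simp
next
  case False
  have "mpoly (herm i (mono_p j)) z = (\<Prod>k\<in>UNIV. (if k = i then z $ k else 1) * (if k = j then z $ k else 1))"
    unfolding mpoly_def mono_p_def herm_def using False by (intro prod.cong) (auto simp: pderiv_pCons)
  then show ?thesis using False by (simp add: prod.distrib)
qed

text \<open>The kernel transform of a constant does not depend on the point, so its gradient vanishes.\<close>

lemma gauss_mpoly_herm: "(\<integral>z. mpoly (herm i p) z \<partial>gauss_measure) = 0"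
proof -
  have g: "gker (\<lambda>_. 1) 1 1 q x = (\<integral>z. mpoly q z \<partial>gauss_measure)" for q and x :: "real^'n"
    by (simp add: gker_def)
  have "grad_at (gker (\<lambda>_. 1) 1 1 p) (\<chi> i. 1 / 1 * gker (\<lambda>_. 1) 1 1 (herm i p) 0) 0"
    by (rule gker_grad[where K = 1]) auto
  moreover have "grad_at (gker (\<lambda>_. 1) 1 1 p) 0 0"
    unfolding g[abs_def] grad_at_def by (simp add: inner_zero_left[abs_def])
  ultimately have "(\<chi> i. 1 / 1 * gker (\<lambda>_. 1) 1 1 (herm i p) 0) = 0"
    by (rule grad_at_unique)
  then show ?thesis by (simp add: vec_eq_iff g)
qed

lemma gauss_integrable_nth: "integrable gauss_measure (\<lambda>z. z $ i)"
  using integrable_gauss_mpoly[of "mono_p i"] by (simp add: mpoly_mono_p[abs_def])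

lemma gauss_integrable_nth2: "integrable gauss_measure (\<lambda>z. z $ i * z $ j)"
proof -
  interpret prob_space "gauss_measure :: (real^'n) measure" by (rule prob_space_gauss)
  have "integrable gauss_measure (\<lambda>z. mpoly (herm i (mono_p j)) z + (if i = j then 1 else 0))"
    using integrable_gauss_mpoly by (intro Bochner_Integration.integrable_add) auto
  then show ?thesis by (simp add: mpoly_herm_mono_p)
qed

lemma gauss_mean: "(\<integral>z. z $ i \<partial>gauss_measure) = 0"
  using gauss_mpoly_herm[of i "\<lambda>_. 1"] by (simp add: herm_one)

lemma gauss_cov: "(\<integral>z. z $ i * z $ j \<partial>gauss_measure) = (if i = j then 1 else 0)"
proof -
  interpret prob_space "gauss_measure :: (real^'n) measure" by (rule prob_space_gauss)
  have "(\<integral>z. z $ i * z $ j - (if i = j then 1 else 0) \<partial>gauss_measure) = 0"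
    using gauss_mpoly_herm[of i "mono_p j"] by (simp add: mpoly_herm_mono_p)
  then show ?thesis using gauss_integrable_nth2[of i j] prob_space[unfolded space_gauss] by (simp split: if_splits)
qed

lemma gauss_integrable_norm: "integrable gauss_measure (\<lambda>z::real^'n. norm z)"
proof (rule Bochner_Integration.integrable_bound)
  show "integrable gauss_measure (\<lambda>z::real^'n. \<Sum>i\<in>UNIV. \<bar>z $ i\<bar>)"
    using gauss_integrable_nth by (intro Bochner_Integration.integrable_sum integrable_abs)
qed (auto intro!: AE_I2 order_trans[OF norm_le_l1_cart])

text \<open>Stein's lemma: both sides are the gradient at \<open>0\<close> of \<open>x \<mapsto> \<integral>h (x + z)\<close>, the left one by
  differentiating the kernel and the right one by differentiating \<open>h\<close>.\<close>

lemma gauss_stein: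
  fixes h :: "real^'n \<Rightarrow> real"
  assumes h: "\<And>x. grad_at h (dh x) x" and K: "\<And>x. \<bar>h x\<bar> \<le> K"
    and dm [measurable]: "dh \<in> borel_measurable borel" and L: "\<And>x. norm (dh x) \<le> L"
  shows "(\<integral>z. h z * z $ i \<partial>gauss_measure) = (\<integral>z. dh z $ i \<partial>gauss_measure)"
proof -
  interpret prob_space "gauss_measure :: (real^'n) measure" by (rule prob_space_gauss)
  have [measurable]: "h \<in> borel_measurable borel"
    using grad_at_continuous[OF h] by (rule borel_measurable_continuous_onI)
  have 1: "grad_at (gker h 1 1 (\<lambda>_. 1)) (\<chi> i. 1 / 1 * gker h 1 1 (herm i (\<lambda>_. 1)) 0) 0"
    using K by (intro gker_grad) auto
  have 2: "grad_at (\<lambda>x. \<integral>z. h (x + z) \<partial>gauss_measure) (\<integral>z. dh (0 + z) \<partial>gauss_measure) 0"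
  proof (rule grad_at_integral[where e = 1 and B = "\<lambda>_. L", THEN conjunct1])
    fix x z :: "real^'n"
    show "grad_at (\<lambda>x. h (x + z)) (dh (x + z)) x"
      unfolding grad_at_def
      by (rule has_derivative_compose[of "\<lambda>x. x + z" "\<lambda>k. k", OF _ h[of "x + z", unfolded grad_at_def]])
         (auto intro!: derivative_eq_intros)
    show "integrable gauss_measure (\<lambda>z. h (x + z))"
      using K by (intro integrable_gauss_bounded[where K = K]) auto
  qed (use L in auto)
  have "(\<chi> i. 1 / 1 * gker h 1 1 (herm i (\<lambda>_. 1)) 0) = (\<integral>z. dh (0 + z) \<partial>gauss_measure)"
    using 1 2 by (intro grad_at_unique[where f = "gker h 1 1 (\<lambda>_. 1)"]) (simp_all add: gker_def[abs_def])
  moreover have "integrable gauss_measure dh"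
    using L by (intro integrable_gauss_bounded) auto
  ultimately show ?thesis
    by (simp add: vec_eq_iff herm_one gker_def integral_vec_nth)
qed

text \<open>The constant \<open>1\<close> and the coordinates are orthonormal in L2 of the Gaussian
  measure, by \<open>gauss_mean\<close> and \<open>gauss_cov\<close>. The bound expresses that the
  squared distance of \<open>h\<close> to its projection \<open>m + S\<close> onto their span is
  nonnegative.\<close>

lemma gauss_bessel:
  fixes h :: "real^'n \<Rightarrow> real"
  assumes [measurable]: "h \<in> borel_measurable borel" and K: "\<And>x. \<bar>h x\<bar> \<le> K"
  shows "(\<Sum>i\<in>UNIV. (\<integral>z. h z * z $ i \<partial>gauss_measure)\<^sup>2) \<le> (\<integral>z. (h z)\<^sup>2 \<partial>gauss_measure) - (\<integral>z. h z \<partial>gauss_measure)\<^sup>2"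
proof -
  interpret prob_space "gauss_measure :: (real^'n) measure" by (rule prob_space_gauss)
  define m where "m = (\<integral>z. h z \<partial>gauss_measure)"
  define v where "v i = (\<integral>z. h z * z $ i \<partial>gauss_measure)" for i
  define S where "S = (\<lambda>z::real^'n. \<Sum>i\<in>UNIV. v i * z $ i)"
  have K0: "K \<ge> 0" using K[of 0] by linarith
  have ih: "integrable gauss_measure h" using K by (intro integrable_gauss_bounded) auto
  have ih2: "integrable gauss_measure (\<lambda>z. (h z)\<^sup>2)"
    using power_mono[OF K abs_ge_zero, of _ 2] by (intro integrable_gauss_bounded[where K = "K\<^sup>2"]) auto
  have ihz: "integrable gauss_measure (\<lambda>z. h z * z $ i)" for i
    using K gauss_integrable_nth by (intro integrable_gauss_bounded_mult) auto
  have iS: "integrable gauss_measure S" unfolding S_def by (intro Bochner_Integration.integrable_sum integrable_mult_right gauss_integrable_nth)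
  have S2: "(S z)\<^sup>2 = (\<Sum>i\<in>UNIV. \<Sum>j\<in>UNIV. v i * v j * (z $ i * z $ j))" for z
    unfolding S_def power2_eq_square sum_product by (simp add: mult_ac)
  have iS2: "integrable gauss_measure (\<lambda>z. (S z)\<^sup>2)"
    unfolding S2 by (intro Bochner_Integration.integrable_sum integrable_mult_right gauss_integrable_nth2)
  have ES2: "(\<integral>z. (S z)\<^sup>2 \<partial>gauss_measure) = (\<Sum>i\<in>UNIV. (v i)\<^sup>2)"
    unfolding S2 by (simp add: gauss_integrable_nth2 gauss_cov power2_eq_square if_distrib cong: if_cong)
  have ES: "(\<integral>z. S z \<partial>gauss_measure) = 0"
    unfolding S_def by (simp add: gauss_integrable_nth gauss_mean)
  have ihS: "integrable gauss_measure (\<lambda>z. h z * S z)"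
    using K iS by (intro integrable_gauss_bounded_mult) auto
  have EhS: "(\<integral>z. h z * S z \<partial>gauss_measure) = (\<Sum>i\<in>UNIV. (v i)\<^sup>2)"
  proof -
    have "(\<integral>z. h z * S z \<partial>gauss_measure) = (\<integral>z. (\<Sum>i\<in>UNIV. v i * (h z * z $ i)) \<partial>gauss_measure)"
      by (simp add: S_def sum_distrib_left mult_ac)
    also have "\<dots> = (\<Sum>i\<in>UNIV. v i * v i)" using ihz by (simp add: v_def)
    finally show ?thesis by (simp add: power2_eq_square)
  qed
  have "0 \<le> (\<integral>z. (h z - m - S z)\<^sup>2 \<partial>gauss_measure)" by simp
  also have "\<dots> = (\<integral>z. (h z)\<^sup>2 + m\<^sup>2 + (S z)\<^sup>2 - 2 * m * h z - 2 * (h z * S z) + 2 * m * S z \<partial>gauss_measure)"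
    by (simp add: power2_eq_square algebra_simps)
  also have "\<dots> = (\<integral>z. (h z)\<^sup>2 \<partial>gauss_measure) + m\<^sup>2 + (\<Sum>i\<in>UNIV. (v i)\<^sup>2) - 2 * m * m - 2 * (\<Sum>i\<in>UNIV. (v i)\<^sup>2)"
    using ih ih2 iS iS2 ihS by (simp add: ES ES2 EhS m_def prob_space[unfolded space_gauss])
  finally show ?thesis by (simp add: m_def v_def power2_eq_square)
qed

section \<open>Smooth functions and cutoffs\<close>

lemma C_diff_SucD: "C_diff (Suc k) g \<Longrightarrow> C_diff k g"
proof (induction k arbitrary: g)
  case 0
  then show ?case
    by (auto intro!: continuous_at_imp_continuous_on differentiable_imp_continuous_within)
next
  case (Suc k)
  then show ?case by (metis C_diff.simps(2))
qed

lemma partial_deriv_add: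
  assumes "f differentiable (at x)" "g differentiable (at x)"
  shows "partial_deriv i (\<lambda>x. f x + g x) x = partial_deriv i f x + partial_deriv i g x"
  using frechet_derivative_at[OF has_derivative_add[OF assms[unfolded frechet_derivative_works]]]
  unfolding partial_deriv_def by metis

lemma partial_deriv_mult:
  assumes "f differentiable (at x)" "g differentiable (at x)"
  shows "partial_deriv i (\<lambda>x. f x * g x) x = f x * partial_deriv i g x + partial_deriv i f x * g x"
  using frechet_derivative_at[OF has_derivative_mult[OF assms[unfolded frechet_derivative_works]]]
  unfolding partial_deriv_def by metis

lemma partial_deriv_const [simp]: "partial_deriv i (\<lambda>x. c) = (\<lambda>x. 0)"
  by (auto simp: partial_deriv_def fun_eq_iff)

lemma C_diff_const [simp]: "C_diff k (\<lambda>x. c)"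
  by (induction k arbitrary: c) auto

lemma C_diff_add: "C_diff k f \<Longrightarrow> C_diff k g \<Longrightarrow> C_diff k (\<lambda>x. f x + g x)"
proof (induction k arbitrary: f g)
  case 0
  then show ?case by (auto intro: continuous_intros)
next
  case (Suc k)
  then have "partial_deriv i (\<lambda>x. f x + g x) = (\<lambda>x. partial_deriv i f x + partial_deriv i g x)" for i
    by (auto simp: partial_deriv_add)
  with Suc show ?case by (auto intro: differentiable_add)
qed

lemma C_diff_mult: "C_diff k f \<Longrightarrow> C_diff k g \<Longrightarrow> C_diff k (\<lambda>x. f x * g x)"
proof (induction k arbitrary: f g)
  case 0
  then show ?case by (auto intro: continuous_intros)
next
  case (Suc k)
  then have pd: "partial_deriv i (\<lambda>x. f x * g x) = (\<lambda>x. f x * partial_deriv i g x + partial_deriv i f x * g x)" for i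
    by (auto simp: partial_deriv_mult)
  have "C_diff k f" "C_diff k g"
    using Suc.prems by (auto dest: C_diff_SucD simp del: C_diff.simps)
  with Suc show ?case by (auto simp: pd intro!: differentiable_mult C_diff_add)
qed

lemma C_diff_prod: "(\<And>j. j \<in> J \<Longrightarrow> C_diff k (f j)) \<Longrightarrow> C_diff k (\<lambda>x. \<Prod>j\<in>J. f j x)"
  by (induction J rule: infinite_finite_induct) (auto intro: C_diff_mult)

lemma smooth_const [simp]: "smooth (\<lambda>x. c)"
  by (simp add: smooth_def)

lemma smooth_add: "smooth f \<Longrightarrow> smooth g \<Longrightarrow> smooth (\<lambda>x. f x + g x)"
  by (simp add: smooth_def C_diff_add)

lemma smooth_mult: "smooth f \<Longrightarrow> smooth g \<Longrightarrow> smooth (\<lambda>x. f x * g x)"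
  by (simp add: smooth_def C_diff_mult)

lemma smooth_diff_const: "smooth f \<Longrightarrow> smooth (\<lambda>x. f x - c)"
  using smooth_add[of f "\<lambda>_. - c"] by simp

lemma smooth_continuous: "smooth f \<Longrightarrow> continuous_on UNIV f"
  unfolding smooth_def by (metis C_diff.simps(1))

lemma smooth_partial_deriv: "smooth f \<Longrightarrow> smooth (partial_deriv i f)"
  unfolding smooth_def by (metis C_diff.simps(2))

lemma smooth_grad_at: "smooth f \<Longrightarrow> grad_at f (grad f x) x"
proof -
  assume "smooth f"
  then have "f differentiable (at x)"
    unfolding smooth_def by (metis C_diff.simps(2))
  then have d: "(f has_derivative frechet_derivative f (at x)) (at x)"
    by (simp add: frechet_derivative_works)
  then interpret bounded_linear "frechet_derivative f (at x)" by (rule has_derivative_bounded_linear)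
  have "frechet_derivative f (at x) h = grad f x \<bullet> h" for h
  proof -
    have "h = (\<Sum>i\<in>UNIV. h $ i *\<^sub>R axis i 1)"
      by (auto simp: vec_eq_iff axis_def if_distrib cong: if_cong)
    then have "frechet_derivative f (at x) h = (\<Sum>i\<in>UNIV. h $ i *\<^sub>R frechet_derivative f (at x) (axis i 1))"
      by (metis (no_types, lifting) sum scaleR sum.cong)
    then show ?thesis
      by (simp add: inner_vec_def grad_def partial_deriv_def mult.commute)
  qed
  then have "frechet_derivative f (at x) = (\<lambda>h. grad f x \<bullet> h)" by (rule ext)
  with d show ?thesis by (simp add: grad_at_def)
qed

lemma gker_smooth:
  assumes "h \<in> borel_measurable borel" "\<And>x. \<bar>h x\<bar> \<le> K" "\<sigma> > 0"
  shows "smooth (gker h \<tau> \<sigma> p)"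
  using gker_C_diff[OF assms, of _ 1] by (simp add: smooth_def)

text \<open>The derivative is existentially quantified, so closure under products,
  \<open>inverse\<close> and affine substitution follows by exhibiting it. Smoothness of
  \<open>gdens\<close> and of the cutoffs on \<open>real^'n\<close> is then obtained through
  \<open>C_diff_nth\<close> and products over the coordinates.\<close>

primrec C_diff1 :: "nat \<Rightarrow> (real \<Rightarrow> real) \<Rightarrow> bool" where
  "C_diff1 0 f \<longleftrightarrow> continuous_on UNIV f"
| "C_diff1 (Suc k) f \<longleftrightarrow> (\<exists>f'. (\<forall>x. (f has_field_derivative f' x) (at x)) \<and> C_diff1 k f')"

lemma C_diff1_SucD: "C_diff1 (Suc k) g \<Longrightarrow> C_diff1 k g"
proof (induction k arbitrary: g)
  case 0
  then show ?case by (auto intro!: continuous_at_imp_continuous_on intro: DERIV_isCont)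
next
  case (Suc k)
  then show ?case by (metis C_diff1.simps(2))
qed

lemma C_diff1_SucI:
  "(\<And>x. (f has_field_derivative f' x) (at x)) \<Longrightarrow> C_diff1 k f' \<Longrightarrow> C_diff1 (Suc k) f"
  by auto

lemma C_diff1_const [simp]: "C_diff1 k (\<lambda>x. c)"
  by (induction k arbitrary: c) (auto intro!: exI[of _ "\<lambda>_. 0"])

lemma C_diff1_add: "C_diff1 k f \<Longrightarrow> C_diff1 k g \<Longrightarrow> C_diff1 k (\<lambda>x. f x + g x)"
proof (induction k arbitrary: f g)
  case 0
  then show ?case by (auto intro: continuous_intros)
next
  case (Suc k)
  from Suc.prems obtain f' g' where "\<forall>x. (f has_field_derivative f' x) (at x)" "C_diff1 k f'"
    "\<forall>x. (g has_field_derivative g' x) (at x)" "C_diff1 k g'" by auto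
  with Suc.IH[of f' g'] show ?case
    by (auto intro!: exI[of _ "\<lambda>x. f' x + g' x"] derivative_intros)
qed

lemma C_diff1_mult: "C_diff1 k f \<Longrightarrow> C_diff1 k g \<Longrightarrow> C_diff1 k (\<lambda>x. f x * g x)"
proof (induction k arbitrary: f g)
  case 0
  then show ?case by (auto intro: continuous_intros)
next
  case (Suc k)
  from Suc.prems obtain f' g' where d: "\<forall>x. (f has_field_derivative f' x) (at x)" "C_diff1 k f'"
    "\<forall>x. (g has_field_derivative g' x) (at x)" "C_diff1 k g'" by auto
  have "C_diff1 k f" "C_diff1 k g"
    using Suc.prems by (auto dest: C_diff1_SucD simp del: C_diff1.simps)
  then have "C_diff1 k (\<lambda>x. f' x * g x + g' x * f x)"
    using d Suc.IH by (intro C_diff1_add) auto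
  moreover have "\<forall>x. ((\<lambda>x. f x * g x) has_field_derivative f' x * g x + g' x * f x) (at x)"
    using d by (auto intro!: DERIV_mult)
  ultimately show ?case by auto
qed

lemma C_diff1_inverse: "C_diff1 k f \<Longrightarrow> (\<And>x. f x \<noteq> 0) \<Longrightarrow> C_diff1 k (\<lambda>x. inverse (f x))"
proof (induction k arbitrary: f)
  case 0
  then show ?case by (auto intro: continuous_intros)
next
  case (Suc k)
  from Suc.prems obtain f' where d: "\<forall>x. (f has_field_derivative f' x) (at x)" "C_diff1 k f'" by auto
  have "C_diff1 k (\<lambda>x. inverse (f x))"
    using Suc.prems C_diff1_SucD by (intro Suc.IH) auto
  then have "C_diff1 k (\<lambda>x. (-1) * (inverse (f x) * f' x * inverse (f x)))"
    using d by (intro C_diff1_mult C_diff1_const) auto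
  moreover have "\<forall>x. ((\<lambda>x. inverse (f x)) has_field_derivative (-1) * (inverse (f x) * f' x * inverse (f x))) (at x)"
    using d Suc.prems(2) DERIV_inverse' by fastforce
  ultimately show ?case by (intro C_diff1_SucI) auto
qed

lemma C_diff1_affine: "C_diff1 k f \<Longrightarrow> C_diff1 k (\<lambda>s. f (a * s + b))"
proof (induction k arbitrary: f)
  case 0
  then show ?case by (auto intro!: continuous_on_compose2[of UNIV f] continuous_intros)
next
  case (Suc k)
  from Suc.prems obtain f' where d: "\<forall>x. (f has_field_derivative f' x) (at x)" "C_diff1 k f'" by auto
  have "C_diff1 k (\<lambda>s. f' (a * s + b) * a)"
    using d Suc.IH by (intro C_diff1_mult) auto
  moreover have "\<forall>s. ((\<lambda>s. f (a * s + b)) has_field_derivative f' (a * s + b) * a) (at s)"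
    using d by (auto intro!: DERIV_chain2[of f] derivative_eq_intros)
  ultimately show ?case by auto
qed

lemma grad_at_nth:
  assumes "(f has_field_derivative f') (at (x $ i))"
  shows "grad_at (\<lambda>x. f (x $ i)) (axis i f') x"
proof -
  have "((\<lambda>x. f (x $ i)) has_derivative (\<lambda>h. f' * h $ i)) (at x)"
    using assms unfolding has_field_derivative_def
    by (rule has_derivative_compose[OF bounded_linear.has_derivative[OF bounded_linear_vec_nth has_derivative_ident]])
  then show ?thesis by (simp add: grad_at_def inner_axis')
qed

lemma C_diff_nth: "C_diff1 k f \<Longrightarrow> C_diff k (\<lambda>x::real^'n. f (x $ i))"
proof (induction k arbitrary: f)
  case 0
  then show ?case by (auto intro!: continuous_on_compose2[of UNIV f] continuous_intros)
next
  case (Suc k)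
  from Suc.prems obtain f' where d: "\<forall>x. (f has_field_derivative f' x) (at x)" "C_diff1 k f'" by auto
  then have g: "grad_at (\<lambda>x. f (x $ i)) (axis i (f' (x $ i))) x" for x :: "real^'n"
    by (intro grad_at_nth) auto
  have "partial_deriv j (\<lambda>x::real^'n. f (x $ i)) = (if j = i then (\<lambda>x. f' (x $ i)) else (\<lambda>x. 0))" for j
    using grad_at_partial_deriv[OF g] by (auto simp: fun_eq_iff axis_def)
  then show ?case using grad_at_differentiable[OF g] Suc.IH[OF d(2)] by auto
qed

lemma C_diff1_normal: "C_diff1 k (\<lambda>s. poly p s * std_normal_density s)"
proof (induction k arbitrary: p)
  case 0
  show ?case unfolding std_normal_density_def C_diff1.simps by (intro continuous_intros) auto
next
  case (Suc k)
  have "((\<lambda>s. poly p s * std_normal_density s) has_field_derivative poly (pderiv p - [:0, 1:] * p) s * std_normal_density s) (at s)" for s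
    unfolding std_normal_density_def
    by (rule derivative_eq_intros refl poly_DERIV | simp)+ (simp add: field_simps)
  then show ?case using Suc[of "pderiv p - [:0, 1:] * p"] by (rule C_diff1_SucI)
qed

lemma smooth_gdens: "smooth gdens"
  unfolding smooth_def gdens_prod[abs_def]
  using C_diff1_normal[of _ 1] by (auto intro!: C_diff_prod C_diff_nth)

section \<open>A smooth step and compactly supported cutoffs\<close>

lemma poly_mult_exp_tendsto_0: "((\<lambda>u::real. poly p u * exp (- u)) \<longlongrightarrow> 0) at_top"
proof -
  have "((\<lambda>u. \<Sum>i\<le>degree p. coeff p i * (u ^ i / exp u)) \<longlongrightarrow> (\<Sum>i\<le>degree p. coeff p i * 0)) at_top"
    by (intro tendsto_sum tendsto_mult tendsto_const tendsto_power_div_exp_0)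
  moreover have "(\<Sum>i\<le>degree p. coeff p i * (u ^ i / exp u)) = poly p u * exp (- u)" for u
    by (simp add: poly_altdef sum_distrib_right exp_minus divide_inverse mult.assoc)
  ultimately show ?thesis by simp
qed

text \<open>The standard smooth function \<open>exp (- 1 / s)\<close> extended by \<open>0\<close>,
  with a polynomial in \<open>1 / s\<close> in front so that the family is closed under
  differentiation.\<close>

definition flat :: "real poly \<Rightarrow> real \<Rightarrow> real" where
  "flat p s = (if s > 0 then poly p (inverse s) * exp (- inverse s) else 0)"

lemma flat_tendsto_0: "(flat p \<longlongrightarrow> 0) (at 0)"
proof -
  have "((\<lambda>s. poly p (inverse s) * exp (- inverse s)) \<longlongrightarrow> 0) (at_right 0)"
    by (rule filterlim_compose[OF poly_mult_exp_tendsto_0 filterlim_inverse_at_top_right])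
  then have "(flat p \<longlongrightarrow> 0) (at_right 0)"
    by (rule Lim_transform_eventually) (auto simp: flat_def eventually_at_filter)
  moreover have "(flat p \<longlongrightarrow> 0) (at_left 0)"
    by (rule tendsto_eventually) (auto simp: flat_def eventually_at_filter)
  ultimately show ?thesis by (simp add: filterlim_split_at)
qed

text \<open>With \<open>u = 1 / s\<close> one has \<open>du/ds = - u * u\<close>, which accounts for
  the factor \<open>[:0, 0, 1:]\<close>. Only the point \<open>0\<close> needs the decay of the
  exponential.\<close>

lemma flat_deriv: "(flat p has_field_derivative flat ([:0, 0, 1:] * (p - pderiv p)) s) (at s)"
proof (cases s "0::real" rule: linorder_cases)
  case greater
  have "((\<lambda>s. poly p (inverse s) * exp (- inverse s)) has_field_derivative flat ([:0, 0, 1:] * (p - pderiv p)) s) (at s)"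
    using greater
    by (auto intro!: derivative_eq_intros poly_DERIV[THEN DERIV_chain2] simp: flat_def algebra_simps power2_eq_square)
  moreover have "\<forall>\<^sub>F t in nhds s. t > 0"
    using greater by (metis order_tendstoD(1) tendsto_ident_at eventually_nhds_top eventually_nhds open_greaterThan greaterThan_iff)
  ultimately show ?thesis
    by (subst DERIV_cong_ev[OF refl _ refl]) (auto simp: flat_def elim: eventually_mono)
next
  case less
  have "\<forall>\<^sub>F t in nhds s. t < 0"
    using less by (metis eventually_nhds open_lessThan lessThan_iff)
  then have "(flat p has_field_derivative 0) (at s)"
    by (subst DERIV_cong_ev[OF refl _ refl, where g = "\<lambda>_. 0"]) (auto simp: flat_def elim: eventually_mono)
  with less show ?thesis by (simp add: flat_def)
next
  case equal
  \<comment> \<open>Dividing by \<open>h\<close> multiplies the polynomial in \<open>1 / h\<close>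
    by its variable, so the difference quotient at \<open>0\<close> is again a member of the family
    and tends to \<open>0\<close>.\<close>
  have "(\<lambda>h. (flat p (0 + h) - flat p 0) / h) = flat ([:0, 1:] * p)"
    by (auto simp: flat_def fun_eq_iff divide_inverse)
  then show ?thesis
    unfolding equal DERIV_def using flat_tendsto_0[of "[:0, 1:] * p"] by (simp add: flat_def)
qed

lemma C_diff1_flat: "C_diff1 k (flat p)"
proof (induction k arbitrary: p)
  case 0
  show ?case using flat_deriv[of p] by (auto intro!: continuous_at_imp_continuous_on intro: DERIV_isCont)
next
  case (Suc k)
  show ?case by (rule C_diff1_SucI[OF flat_deriv Suc])
qed

text \<open>The two summands of the denominator never vanish together. The factor
  \<open>inverse\<close> and the spelling \<open>(-1) * s + 1\<close> match the closure rules for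
  \<open>C_diff1\<close>.\<close>

definition step :: "real \<Rightarrow> real" where
  "step s = flat 1 s * inverse (flat 1 s + flat 1 ((-1) * s + 1))"

lemma flat_1_pos: "s > 0 \<Longrightarrow> flat 1 s > 0" and flat_1_nonneg: "flat 1 s \<ge> 0"
  and flat_1_0: "s \<le> 0 \<Longrightarrow> flat 1 s = 0"
  by (auto simp: flat_def)

lemma flat_sum_pos: "flat 1 s + flat 1 ((-1) * s + 1) > 0"
proof (cases "s > 0")
  case True
  then show ?thesis using flat_1_pos[of s] flat_1_nonneg[of "(-1) * s + 1"] by linarith
next
  case False
  then show ?thesis using flat_1_pos[of "(-1) * s + 1"] flat_1_nonneg[of s] by linarith
qed

lemma C_diff1_step: "C_diff1 k step"
  unfolding step_def
  by (intro C_diff1_mult C_diff1_inverse C_diff1_add C_diff1_affine C_diff1_flat less_imp_neq[OF flat_sum_pos, symmetric])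

lemma step_0: "s \<le> 0 \<Longrightarrow> step s = 0" by (simp add: step_def flat_1_0)

lemma step_1: "s \<ge> 1 \<Longrightarrow> step s = 1"
  using flat_1_pos[of s] by (simp add: step_def flat_1_0)

lemma step_bounds: "0 \<le> step s" "step s \<le> 1"
  using flat_sum_pos[of s] flat_1_nonneg[of s] flat_1_nonneg[of "(-1) * s + 1"]
  by (auto simp: step_def divide_inverse[symmetric] simp del: mult_minus1)

text \<open>A continuous derivative that vanishes outside the unit interval is bounded. Its
  vanishing beyond \<open>1\<close> is recorded because it makes the gradients of the cutoffs vanish
  eventually at each point.\<close>

lemma step_deriv_ex:
  "\<exists>step' L. (\<forall>s. (step has_field_derivative step' s) (at s)) \<and> (\<forall>s. \<bar>step' s\<bar> \<le> L) \<and> (\<forall>s>1. step' s = 0)"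
proof -
  obtain f' where f': "\<And>s. (step has_field_derivative f' s) (at s)" "C_diff1 0 f'"
    using C_diff1_step[of "Suc 0"] by auto
  have 1: "f' s = 0" if "s > 1" for s
  proof -
    have "\<forall>\<^sub>F t in nhds s. t > 1"
      using that by (metis eventually_nhds open_greaterThan greaterThan_iff)
    then have "(step has_field_derivative 0) (at s)"
      by (subst DERIV_cong_ev[OF refl _ refl, where g = "\<lambda>_. 1"]) (auto simp: step_1 elim: eventually_mono)
    with f'(1) show ?thesis by (rule DERIV_unique)
  qed
  have 0: "f' s = 0" if "s < 0" for s
  proof -
    have "\<forall>\<^sub>F t in nhds s. t < 0"
      using that by (metis eventually_nhds open_lessThan lessThan_iff)
    then have "(step has_field_derivative 0) (at s)"
      by (subst DERIV_cong_ev[OF refl _ refl, where g = "\<lambda>_. 0"]) (auto simp: step_0 elim: eventually_mono)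
    with f'(1) show ?thesis by (rule DERIV_unique)
  qed
  have "bounded (f' ` {0..1})"
    using f'(2) by (intro compact_imp_bounded compact_continuous_image) (auto intro: continuous_on_subset)
  then obtain L where "\<forall>y\<in>f' ` {0..1}. norm y \<le> L" unfolding bounded_iff by blast
  then have L: "\<And>s. s \<in> {0..1} \<Longrightarrow> \<bar>f' s\<bar> \<le> L" by auto
  have "\<bar>f' s\<bar> \<le> L" for s
    using L[of s] L[of 0] 0[of s] 1[of s] by (cases "s < 0"; cases "s > 1") auto
  with f'(1) 1 show ?thesis by blast
qed

lemma test_function_mult:
  assumes "test_function ct" "smooth \<psi>"
  shows "test_function (\<lambda>x. ct x * \<psi> x)"
proof -
  have "bounded {x. ct x \<noteq> 0}"
    using assms(1) by (simp add: test_function_def compact_closure)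
  then have "bounded {x. ct x * \<psi> x \<noteq> 0}"
    by (rule bounded_subset) auto
  with assms show ?thesis
    by (simp add: test_function_def compact_closure smooth_mult)
qed

text \<open>The plateau grows by translating its flanks, not by rescaling, so one gradient bound
  serves all \<open>n\<close>. The gradients do not become uniformly small, but they vanish
  eventually at each point, and this is what dominated convergence asks for.\<close>

lemma cutoff_ex:
  "\<exists>(ct :: nat \<Rightarrow> real^'n \<Rightarrow> real) L. (\<forall>n. test_function (ct n)) \<and> (\<forall>n x. 0 \<le> ct n x \<and> ct n x \<le> 1)
    \<and> (\<forall>x. \<forall>\<^sub>F n in sequentially. ct n x = 1) \<and> (\<forall>n i x. \<bar>partial_deriv i (ct n) x\<bar> \<le> L)
    \<and> (\<forall>x i. \<forall>\<^sub>F n in sequentially. partial_deriv i (ct n) x = 0)"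
proof -
  obtain step' L where s': "\<And>s. (step has_field_derivative step' s) (at s)" "\<And>s. \<bar>step' s\<bar> \<le> L"
    "\<And>s. s > 1 \<Longrightarrow> step' s = 0" using step_deriv_ex by blast
  define w where "w n s = step (1 * s + real n) * step ((-1) * s + real n)" for n s
  define w' where "w' n s = step' (1 * s + real n) * 1 * step ((-1) * s + real n) + step' ((-1) * s + real n) * (-1) * step (1 * s + real n)" for n s
  have dw: "(w n has_field_derivative w' n s) (at s)" for n s
    unfolding w_def w'_def
    by (intro DERIV_mult DERIV_chain2[OF s'(1)]) (auto intro!: derivative_eq_intros)
  have w01: "0 \<le> w n s" "w n s \<le> 1" for n s
    unfolding w_def using step_bounds by (auto intro!: mult_le_one)
  have w'L: "\<bar>w' n s\<bar> \<le> 2 * L" for n s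
  proof -
    have a: "\<bar>step' a * step b\<bar> \<le> L" for a b
      using mult_mono[OF s'(2)[of a] step_bounds(2)[of b]] step_bounds[of b] s'(2)[of a] by (simp add: abs_mult)
    show ?thesis unfolding w'_def
      using a[of "1 * s + real n" "(-1) * s + real n"] a[of "(-1) * s + real n" "1 * s + real n"] by simp
  qed
  define ct where "ct n x = (\<Prod>i\<in>UNIV. w n (x $ i))" for n and x :: "real^'n"
  have smooth: "smooth (ct n)" for n
    unfolding smooth_def ct_def w_def
    by (intro allI C_diff_prod C_diff_nth C_diff1_mult C_diff1_affine C_diff1_step)
  have supp: "{x. ct n x \<noteq> 0} \<subseteq> {x. \<forall>i. x $ i \<in> {- real n..real n}}" for n
  proof safe
    fix x i assume "ct n x \<noteq> 0"
    then have "w n (x $ i) \<noteq> 0" by (simp add: ct_def)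
    then show "x $ i \<in> {- real n..real n}"
      unfolding w_def using step_0[of "1 * x $ i + real n"] step_0[of "(-1) * x $ i + real n"] by force
  qed
  have bdd: "bounded {x. ct n x \<noteq> 0}" for n
  proof (rule bounded_subset[OF _ supp])
    show "bounded {x. \<forall>i. x $ i \<in> {- real n..real n}}"
      by (rule bounded_subset[OF bounded_cbox[of "\<chi> i. - real n" "\<chi> i. real n"]]) (auto simp: mem_box_cart)
  qed
  have g: "grad_at (ct n) (\<chi> i. w' n (x $ i) * (\<Prod>j\<in>UNIV - {i}. w n (x $ j))) x" for n x
  proof -
    have "((\<lambda>x. \<Prod>i\<in>UNIV. w n (x $ i)) has_derivative
      (\<lambda>h. \<Sum>i\<in>UNIV. (axis i (w' n (x $ i)) \<bullet> h) * (\<Prod>j\<in>UNIV - {i}. w n (x $ j)))) (at x)"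
      by (intro has_derivative_prod grad_at_nth[OF dw, unfolded grad_at_def])
    moreover have "(\<lambda>h. \<Sum>i\<in>UNIV. (axis i (w' n (x $ i)) \<bullet> h) * (\<Prod>j\<in>UNIV - {i}. w n (x $ j)))
        = (\<bullet>) (\<chi> i. w' n (x $ i) * (\<Prod>j\<in>UNIV - {i}. w n (x $ j)))"
      unfolding inner_axis' by (simp add: fun_eq_iff inner_vec_def mult_ac)
    ultimately show ?thesis
      unfolding grad_at_def ct_def by simp
  qed
  note pd = grad_at_partial_deriv[OF g]
  have ev: "\<forall>\<^sub>F n in sequentially. w n s = 1" "\<forall>\<^sub>F n in sequentially. w' n s = 0" for s
  proof -
    \<comment> \<open>The summand \<open>1\<close> makes both arguments exceed \<open>1\<close>,
      where \<open>step\<close> equals \<open>1\<close> and \<open>step'\<close> equals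
      \<open>0\<close>.\<close>
    have "\<forall>\<^sub>F n in sequentially. real n > \<bar>s\<bar> + 1"
      using filterlim_real_sequentially by (rule filterlim_at_top_dense[THEN iffD1, rule_format])
    then show "\<forall>\<^sub>F n in sequentially. w n s = 1" "\<forall>\<^sub>F n in sequentially. w' n s = 0"
      by (auto elim!: eventually_mono simp: w_def w'_def step_1 s'(3))
  qed
  show ?thesis
  proof (intro exI conjI allI)
    show "test_function (ct n)" for n using smooth bdd by (simp add: test_function_def compact_closure)
    show "0 \<le> ct n x" "ct n x \<le> 1" for n x
      unfolding ct_def using w01 by (auto intro!: prod_nonneg prod_le_1)
    show "\<forall>\<^sub>F n in sequentially. ct n x = 1" for x
    proof -
      have "\<forall>\<^sub>F n in sequentially. \<forall>i. w n (x $ i) = 1"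
        using ev(1) by (simp add: eventually_all_finite)
      then show ?thesis by eventually_elim (simp add: ct_def)
    qed
    show "\<bar>partial_deriv i (ct n) x\<bar> \<le> 2 * L" for n i x
    proof -
      have "\<bar>\<Prod>j\<in>UNIV - {i}. w n (x $ j)\<bar> \<le> 1" using w01 by (auto simp: abs_prod intro!: prod_le_1)
      with mult_mono[OF w'L[of n "x $ i"] this] w'L[of n "x $ i"] show ?thesis
        by (simp add: pd abs_mult)
    qed
    show "\<forall>\<^sub>F n in sequentially. partial_deriv i (ct n) x = 0" for i x
      using ev(2)[of "x $ i"] by eventually_elim (simp add: pd)
  qed
qed

section \<open>Weak derivatives on the zero set\<close>

lemma lborel_integral_translate:
  fixes f :: "'a::euclidean_space \<Rightarrow> 'b::{banach, second_countable_topology}"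
  assumes [measurable]: "f \<in> borel_measurable borel"
  shows "(\<integral>x. f (x + c) \<partial>lborel) = (\<integral>x. f x \<partial>lborel)"
    and "integrable lborel (\<lambda>x. f (x + c)) \<longleftrightarrow> integrable lborel f"
proof -
  have "(\<integral>x. f x \<partial>lborel) = (\<integral>x. f x \<partial>distr lborel borel ((+) c))" by (simp add: lborel_distr_plus)
  also have "\<dots> = (\<integral>x. f (x + c) \<partial>lborel)" by (subst integral_distr) (auto simp: add.commute)
  finally show "(\<integral>x. f (x + c) \<partial>lborel) = (\<integral>x. f x \<partial>lborel)" ..
  have "integrable lborel f \<longleftrightarrow> integrable (distr lborel borel ((+) c)) f" by (simp add: lborel_distr_plus)
  also have "\<dots> \<longleftrightarrow> integrable lborel (\<lambda>x. f (x + c))" by (subst integrable_distr_eq) (auto simp: add.commute)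
  finally show "integrable lborel (\<lambda>x. f (x + c)) \<longleftrightarrow> integrable lborel f" ..
qed

section \<open>Approximation by continuous functions and continuity of translations in L1\<close>

definition clip :: "real \<Rightarrow> real \<Rightarrow> real" where
  "clip N s = max (- N) (min N s)"

lemma clip_bound: "N \<ge> 0 \<Longrightarrow> \<bar>clip N s\<bar> \<le> N" by (auto simp: clip_def)
lemma clip_id: "\<bar>s\<bar> \<le> N \<Longrightarrow> clip N s = s" by (auto simp: clip_def)
lemma continuous_on_clip [continuous_intros]: "continuous_on S f \<Longrightarrow> continuous_on S (\<lambda>x. clip N (f x))"
  unfolding clip_def by (intro continuous_intros)
lemma tendsto_clip: "(f \<longlongrightarrow> l) F \<Longrightarrow> ((\<lambda>x. clip N (f x)) \<longlongrightarrow> clip N l) F"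
  unfolding clip_def by (intro tendsto_intros)

text \<open>A measurable function is a limit of continuous ones off a negligible set. Clipping them
  at \<open>N\<close> leaves the limit alone, since it already lies between \<open>- N\<close> and
  \<open>N\<close>, and gives the uniform bound that dominated convergence requires.\<close>

lemma borel_bounded_approx:
  fixes k :: "'a::euclidean_space \<Rightarrow> real"
  assumes "k \<in> borel_measurable borel" "\<And>x. \<bar>k x\<bar> \<le> N"
  shows "\<exists>g. (\<forall>n. continuous_on UNIV (g n)) \<and> (\<forall>n x. \<bar>g n x\<bar> \<le> N) \<and> (AE x in lborel. (\<lambda>n::nat. g n x) \<longlonglongrightarrow> k x)"
proof -
  have "k \<in> borel_measurable lebesgue"
    using assms(1) by (simp add: measurable_completion)
  then have "k measurable_on UNIV"
    using lebesgue_measurable_imp_measurable_on[of k UNIV] by simp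
  then obtain S g where S: "negligible S" "\<And>n. continuous_on UNIV (g n)"
    "\<And>x. x \<notin> S \<Longrightarrow> (\<lambda>n. g n x) \<longlonglongrightarrow> k x"
    unfolding measurable_on_def by auto
  have N: "N \<ge> 0" using assms(2)[of 0] by linarith
  have "AE x in lebesgue. (\<lambda>n. g n x) \<longlonglongrightarrow> k x"
    using S(1,3) by (intro AE_I'[of S]) (auto simp: negligible_iff_null_sets)
  \<comment> \<open>Measurability of the convergence set allows the statement to descend from
    \<open>lebesgue\<close>, the completion, to \<open>lborel\<close>.\<close>
  moreover have "(\<lambda>x. (\<lambda>n. g n x) \<longlonglongrightarrow> k x) \<in> measurable borel (count_space UNIV)"
    using assms(1) S(2)[THEN borel_measurable_continuous_onI] by measurable
  ultimately have "AE x in lborel. (\<lambda>n. g n x) \<longlonglongrightarrow> k x"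
    by (simp add: AE_completion_iff)
  then have "AE x in lborel. (\<lambda>n. clip N (g n x)) \<longlonglongrightarrow> k x"
    by eventually_elim (use assms(2) tendsto_clip clip_id in metis)
  then show ?thesis
    using S(2) N by (intro exI[of _ "\<lambda>n x. clip N (g n x)"]) (auto intro!: continuous_intros clip_bound)
qed

text \<open>Truncate \<open>H\<close> in value and in space, approximate the truncation by bounded
  continuous functions, and multiply by a cutoff \<open>c\<close> that equals \<open>1\<close>
  wherever the truncation is nonzero. One number \<open>R\<close> serves both as bound and as radius
  of the support.\<close>

lemma integrable_approx_continuous:
  fixes H :: "'a::euclidean_space \<Rightarrow> real"
  assumes H: "integrable lborel H" and e: "e > 0"
  shows "\<exists>G R. continuous_on UNIV G \<and> (\<forall>x. \<bar>G x\<bar> \<le> R) \<and> (\<forall>x. norm x > R \<longrightarrow> G x = 0)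
    \<and> integrable lborel G \<and> (\<integral>x. \<bar>H x - G x\<bar> \<partial>lborel) < e"
proof -
  have Hm [measurable]: "H \<in> borel_measurable borel" using borel_measurable_integrable[OF H] by simp
  define HN where "HN N x = (if \<bar>H x\<bar> \<le> real N \<and> norm x \<le> real N then H x else 0)" for N x
  have HNm [measurable]: "HN N \<in> borel_measurable borel" for N unfolding HN_def by measurable
  have "(\<lambda>N. \<integral>x. \<bar>H x - HN N x\<bar> \<partial>lborel) \<longlonglongrightarrow> (\<integral>x. 0 \<partial>(lborel :: 'a measure))"
  proof (rule integral_dominated_convergence[where w = "\<lambda>x. \<bar>H x\<bar>"])
    show "AE x in lborel. (\<lambda>N. \<bar>H x - HN N x\<bar>) \<longlonglongrightarrow> 0"
    proof (rule AE_I2)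
      fix x
      have "\<forall>\<^sub>F N in sequentially. real N \<ge> max \<bar>H x\<bar> (norm x)"
        using filterlim_real_sequentially by (rule filterlim_at_top[THEN iffD1, rule_format])
      then have "\<forall>\<^sub>F N in sequentially. \<bar>H x - HN N x\<bar> = 0"
        by eventually_elim (simp add: HN_def)
      then show "(\<lambda>N. \<bar>H x - HN N x\<bar>) \<longlonglongrightarrow> 0" by (rule tendsto_eventually)
    qed
  qed (use H in \<open>auto simp: HN_def\<close>)
  then have "\<forall>\<^sub>F N in sequentially. (\<integral>x. \<bar>H x - HN N x\<bar> \<partial>lborel) < e / 2"
    using e by (intro order_tendstoD(2)) auto
  then obtain N where N: "(\<integral>x. \<bar>H x - HN N x\<bar> \<partial>lborel) < e / 2"
    by (auto simp: eventually_sequentially)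
  have HNN: "\<bar>HN N x\<bar> \<le> real N" for x by (simp add: HN_def)
  obtain g where g: "\<And>n. continuous_on UNIV (g n)" "\<And>n x. \<bar>g n x\<bar> \<le> real N"
    "AE x in lborel. (\<lambda>n::nat. g n x) \<longlonglongrightarrow> HN N x"
    using borel_bounded_approx[OF HNm HNN] by blast
  have gm [measurable]: "g n \<in> borel_measurable borel" for n using g(1) by (rule borel_measurable_continuous_onI)
  define c where "c x = max 0 (min 1 (real N + 1 - norm x))" for x :: 'a
  have cc: "continuous_on UNIV c" unfolding c_def by (intro continuous_intros)
  have [measurable]: "c \<in> borel_measurable borel" using cc by (rule borel_measurable_continuous_onI)
  have c01: "0 \<le> c x" "c x \<le> 1" for x by (auto simp: c_def)
  have c0: "c x = 0" if "norm x > real N + 1" for x using that by (auto simp: c_def)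
  have HNc: "HN N x * c x = HN N x" for x by (auto simp: HN_def c_def)
  have gcb: "\<bar>g n x * c x\<bar> \<le> real N * indicator (cball 0 (real N + 1)) x" for n x
  proof (cases "norm x > real N + 1")
    case False
    have "\<bar>g n x\<bar> * \<bar>c x\<bar> \<le> real N * 1" using g(2) c01 by (intro mult_mono) auto
    then show ?thesis using False by (simp add: abs_mult)
  qed (simp add: c0)
  have icb: "integrable lborel (indicator (cball (0::'a) r) :: 'a \<Rightarrow> real)" for r
    by (intro integrable_real_indicator) (simp_all add: emeasure_bounded_finite[OF bounded_cball, unfolded infinity_ennreal_def])
  have igc: "integrable lborel (\<lambda>x. g n x * c x)" for n
    by (rule Bochner_Integration.integrable_bound[of _ "\<lambda>x. real N * indicator (cball 0 (real N + 1)) x"])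
       (use icb gcb order_trans[OF gcb abs_ge_self] in \<open>auto\<close>)
  have HNb: "\<bar>HN N x\<bar> \<le> real N * indicator (cball 0 (real N + 1)) x" for x
    by (auto simp: HN_def indicator_def)
  have "(\<lambda>n. \<integral>x. \<bar>HN N x - g n x * c x\<bar> \<partial>lborel) \<longlonglongrightarrow> (\<integral>x. 0 \<partial>(lborel :: 'a measure))"
  proof (rule integral_dominated_convergence[where w = "\<lambda>x. 2 * (real N * indicator (cball 0 (real N + 1)) x)"])
    show "AE x in lborel. (\<lambda>n. \<bar>HN N x - g n x * c x\<bar>) \<longlonglongrightarrow> 0"
      using g(3)
    proof eventually_elim
      case (elim x)
      have "(\<lambda>n. \<bar>HN N x - g n x * c x\<bar>) \<longlonglongrightarrow> \<bar>HN N x - HN N x * c x\<bar>"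
        by (intro tendsto_intros elim)
      then show ?case by (simp add: HNc)
    qed
    show "AE x in lborel. norm \<bar>HN N x - g n x * c x\<bar> \<le> 2 * (real N * indicator (cball 0 (real N + 1)) x)" for n
      using HNb gcb[of n] abs_triangle_ineq4 by (auto intro!: AE_I2) (smt (verit) HNb gcb)
  qed (use icb in auto)
  then have "\<forall>\<^sub>F n in sequentially. (\<integral>x. \<bar>HN N x - g n x * c x\<bar> \<partial>lborel) < e / 2"
    using e by (intro order_tendstoD(2)) auto
  then obtain n where n: "(\<integral>x. \<bar>HN N x - g n x * c x\<bar> \<partial>lborel) < e / 2"
    by (auto simp: eventually_sequentially)
  have iHN: "integrable lborel (HN N)"
    by (rule Bochner_Integration.integrable_bound[OF H]) (auto simp: HN_def)
  have "(\<integral>x. \<bar>H x - g n x * c x\<bar> \<partial>lborel) \<le> (\<integral>x. \<bar>H x - HN N x\<bar> + \<bar>HN N x - g n x * c x\<bar> \<partial>lborel)"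
    using H iHN igc by (intro integral_mono) auto
  also have "\<dots> < e" using H iHN igc[of n] N n by simp
  finally have "(\<integral>x. \<bar>H x - g n x * c x\<bar> \<partial>lborel) < e" .
  moreover have "\<bar>g n x * c x\<bar> \<le> real N + 1" for x
    using gcb[of n x] by (cases "norm x \<le> real N + 1") auto
  ultimately show ?thesis
    using igc cc g(1) c0 by (intro exI[of _ "\<lambda>x. g n x * c x"] exI[of _ "real N + 1"]) (auto intro!: continuous_intros)
qed

text \<open>For a continuous \<open>G\<close> with bounded support this is dominated convergence.
  The general case follows because translating both \<open>H\<close> and \<open>G\<close> does not
  change their L1 distance.\<close>

lemma translation_continuous_L1:
  fixes H :: "'a::euclidean_space \<Rightarrow> real"
  assumes H: "integrable lborel H" and e: "e > 0"
  shows "\<exists>d>0. \<forall>y. norm y < d \<longrightarrow> (\<integral>x. \<bar>H (x + y) - H x\<bar> \<partial>lborel) < e"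
proof -
  have Hm [measurable]: "H \<in> borel_measurable borel" using borel_measurable_integrable[OF H] by simp
  obtain G R where G: "continuous_on UNIV G" "\<And>x. \<bar>G x\<bar> \<le> R" "\<And>x. norm x > R \<Longrightarrow> G x = 0"
    "integrable lborel G" "(\<integral>x. \<bar>H x - G x\<bar> \<partial>lborel) < e / 3"
    using integrable_approx_continuous[OF H, of "e / 3"] e by auto
  have Gm [measurable]: "G \<in> borel_measurable borel" using G(1) by (rule borel_measurable_continuous_onI)
  have tr: "integrable lborel (\<lambda>x. H (x + y))" "integrable lborel (\<lambda>x. G (x + y))" for y
    using H G(4) by (simp_all add: lborel_integral_translate(2))
  have R0: "R \<ge> 0" using G(2)[of 0] by linarith
  have icb: "integrable lborel (indicator (cball (0::'a) r) :: 'a \<Rightarrow> real)" for r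
    by (intro integrable_real_indicator) (simp_all add: emeasure_bounded_finite[OF bounded_cball, unfolded infinity_ennreal_def])
  have "((\<lambda>y. \<integral>x. \<bar>G (x + y) - G x\<bar> \<partial>lborel) \<longlongrightarrow> 0) (at 0)"
    unfolding tendsto_at_iff_sequentially comp_def
  proof (intro allI impI)
    fix Y :: "nat \<Rightarrow> 'a" assume lim: "Y \<longlonglongrightarrow> 0"
    then have "\<forall>\<^sub>F n in sequentially. norm (Y n) < 1"
      using tendstoD[OF lim, of 1] by simp
    then obtain n0 where n0: "\<And>n. n \<ge> n0 \<Longrightarrow> norm (Y n) < 1" by (auto simp: eventually_sequentially)
    have "(\<lambda>n. \<integral>x. \<bar>G (x + Y (n + n0)) - G x\<bar> \<partial>lborel) \<longlonglongrightarrow> (\<integral>x. 0 \<partial>(lborel :: 'a measure))"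
    proof (rule integral_dominated_convergence[where w = "\<lambda>x. 2 * R * indicator (cball 0 (R + 1)) x"])
      show "AE x in lborel. (\<lambda>n. \<bar>G (x + Y (n + n0)) - G x\<bar>) \<longlonglongrightarrow> 0"
      proof (rule AE_I2)
        fix x
        have "isCont G (x + 0)" using G(1) by (simp add: continuous_on_eq_continuous_at)
        moreover have "(\<lambda>n. x + Y (n + n0)) \<longlonglongrightarrow> x + 0"
          by (intro tendsto_intros LIMSEQ_ignore_initial_segment lim)
        ultimately have "(\<lambda>n. G (x + Y (n + n0))) \<longlonglongrightarrow> G (x + 0)" by (rule isCont_tendsto_compose)
        then have "(\<lambda>n. \<bar>G (x + Y (n + n0)) - G x\<bar>) \<longlonglongrightarrow> \<bar>G (x + 0) - G x\<bar>" by (intro tendsto_intros)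
        then show "(\<lambda>n. \<bar>G (x + Y (n + n0)) - G x\<bar>) \<longlonglongrightarrow> 0" by simp
      qed
      show "AE x in lborel. norm \<bar>G (x + Y (n + n0)) - G x\<bar> \<le> 2 * R * indicator (cball 0 (R + 1)) x" for n
      proof (rule AE_I2)
        fix x
        show "norm \<bar>G (x + Y (n + n0)) - G x\<bar> \<le> 2 * R * indicator (cball 0 (R + 1)) x"
        proof (cases "norm x > R + 1")
          case True
          have "norm (Y (n + n0)) < 1" using n0 by simp
          moreover have "norm x \<le> norm (x + Y (n + n0)) + norm (Y (n + n0))"
            using norm_triangle_ineq4[of "x + Y (n + n0)" "Y (n + n0)"] by simp
          ultimately have "norm (x + Y (n + n0)) > R" "norm x > R" using True by linarith+
          then show ?thesis using True by (simp add: G(3))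
        next
          case False
          then show ?thesis using G(2)[of "x + Y (n + n0)"] G(2)[of x] by simp
        qed
      qed
    qed (use icb in auto)
    then have "(\<lambda>n. \<integral>x. \<bar>G (x + Y (n + n0)) - G x\<bar> \<partial>lborel) \<longlonglongrightarrow> 0" by simp
    then show "(\<lambda>n. \<integral>x. \<bar>G (x + Y n) - G x\<bar> \<partial>lborel) \<longlonglongrightarrow> 0" by (rule LIMSEQ_offset)
  qed
  then have "\<forall>\<^sub>F y in at 0. (\<integral>x. \<bar>G (x + y) - G x\<bar> \<partial>lborel) < e / 3"
    using e by (intro order_tendstoD(2)) auto
  then obtain d where d: "d > 0" "\<And>y. y \<noteq> 0 \<Longrightarrow> norm y < d \<Longrightarrow> (\<integral>x. \<bar>G (x + y) - G x\<bar> \<partial>lborel) < e / 3"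
    by (auto simp: eventually_at)
  have "(\<integral>x. \<bar>H (x + y) - H x\<bar> \<partial>lborel) < e" if y: "norm y < d" for y
  proof -
    have "(\<integral>x. \<bar>H (x + y) - H x\<bar> \<partial>lborel)
        \<le> (\<integral>x. \<bar>H (x + y) - G (x + y)\<bar> + \<bar>G (x + y) - G x\<bar> + \<bar>H x - G x\<bar> \<partial>lborel)"
      using H G(4) tr by (intro integral_mono) auto
    also have "\<dots> = (\<integral>x. \<bar>H (x + y) - G (x + y)\<bar> \<partial>lborel) + (\<integral>x. \<bar>G (x + y) - G x\<bar> \<partial>lborel) + (\<integral>x. \<bar>H x - G x\<bar> \<partial>lborel)"
      using H G(4) tr by simp
    also have "(\<integral>x. \<bar>H (x + y) - G (x + y)\<bar> \<partial>lborel) = (\<integral>x. \<bar>H x - G x\<bar> \<partial>lborel)"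
      by (rule lborel_integral_translate(1)) measurable
    also have "(\<integral>x. \<bar>H x - G x\<bar> \<partial>lborel) + (\<integral>x. \<bar>G (x + y) - G x\<bar> \<partial>lborel) + (\<integral>x. \<bar>H x - G x\<bar> \<partial>lborel) < e"
      using G(5) d(2)[of y] y e by (cases "y = 0") auto
    finally show ?thesis .
  qed
  with d(1) show ?thesis by blast
qed

section \<open>Duality with bounded functions and difference quotients of weak derivatives\<close>

lemma L1_dual_bound_limit:
  fixes W :: "'a::euclidean_space \<Rightarrow> real"
  assumes W: "integrable lborel W" and km: "\<And>n. k n \<in> borel_measurable borel" "k' \<in> borel_measurable borel"
    and k1: "\<And>n x. \<bar>k n x\<bar> \<le> 1" and lim: "AE x in lborel. (\<lambda>n::nat. k n x) \<longlonglongrightarrow> k' x"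
    and c: "\<And>n. \<bar>\<integral>x. W x * k n x \<partial>lborel\<bar> \<le> c"
  shows "\<bar>\<integral>x. W x * k' x \<partial>lborel\<bar> \<le> c"
proof -
  note [measurable] = km
  have [measurable]: "W \<in> borel_measurable borel" using borel_measurable_integrable[OF W] by simp
  have "(\<lambda>n. \<integral>x. W x * k n x \<partial>lborel) \<longlonglongrightarrow> (\<integral>x. W x * k' x \<partial>lborel)"
  proof (rule integral_dominated_convergence[where w = "\<lambda>x. \<bar>W x\<bar>"])
    show "AE x in lborel. (\<lambda>n. W x * k n x) \<longlonglongrightarrow> W x * k' x"
      using lim by eventually_elim (intro tendsto_intros)
    show "AE x in lborel. norm (W x * k n x) \<le> \<bar>W x\<bar>" for n
      using k1[of n] by (auto simp: abs_mult intro!: AE_I2 mult_left_le)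
  qed (use W in auto)
  then have "(\<lambda>n. \<bar>\<integral>x. W x * k n x \<partial>lborel\<bar>) \<longlonglongrightarrow> \<bar>\<integral>x. W x * k' x \<partial>lborel\<bar>" by (rule tendsto_rabs)
  then show ?thesis by (rule LIMSEQ_le_const2) (use c in auto)
qed

lemma gker_one_bound:
  fixes h :: "real^'n \<Rightarrow> real"
  assumes "h \<in> borel_measurable borel" "\<And>x. \<bar>h x\<bar> \<le> K"
  shows "\<bar>gker h \<tau> \<sigma> (\<lambda>_. 1) x\<bar> \<le> K"
proof -
  interpret prob_space "gauss_measure :: (real^'n) measure" by (rule prob_space_gauss)
  show ?thesis using gker_bound[OF assms, of \<tau> \<sigma> "\<lambda>_. 1" x] prob_space[unfolded space_gauss] by simp
qed

lemma gker_tendsto: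
  fixes h :: "real^'n \<Rightarrow> real"
  assumes "continuous_on UNIV h" "\<And>x. \<bar>h x\<bar> \<le> K"
  shows "(\<lambda>n. gker h 1 (1 / real (Suc n)) (\<lambda>_. 1) x) \<longlonglongrightarrow> h x"
proof -
  interpret prob_space "gauss_measure :: (real^'n) measure" by (rule prob_space_gauss)
  have [measurable]: "h \<in> borel_measurable borel" using assms(1) by (rule borel_measurable_continuous_onI)
  have "(\<lambda>n. \<integral>z. h (x + (1 / real (Suc n)) *\<^sub>R z) \<partial>gauss_measure) \<longlonglongrightarrow> (\<integral>z. h x \<partial>(gauss_measure :: (real^'n) measure))"
  proof (rule integral_dominated_convergence[where w = "\<lambda>_. K"])
    show "AE z in gauss_measure. (\<lambda>n. h (x + (1 / real (Suc n)) *\<^sub>R z)) \<longlonglongrightarrow> h x"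
    proof (rule AE_I2)
      fix z
      have "(\<lambda>n. x + (1 / real (Suc n)) *\<^sub>R z) \<longlonglongrightarrow> x + 0 *\<^sub>R z"
        by (intro tendsto_intros LIMSEQ_Suc[OF lim_1_over_n])
      moreover have "isCont h (x + 0 *\<^sub>R z)" using assms(1) by (simp add: continuous_on_eq_continuous_at)
      ultimately have "(\<lambda>n. h (x + (1 / real (Suc n)) *\<^sub>R z)) \<longlonglongrightarrow> h (x + 0 *\<^sub>R z)"
        by (rule isCont_tendsto_compose[rotated])
      then show "(\<lambda>n. h (x + (1 / real (Suc n)) *\<^sub>R z)) \<longlonglongrightarrow> h x" by simp
    qed
  qed (use assms in auto)
  then show ?thesis by (simp add: gker_def prob_space[unfolded space_gauss])
qed

text \<open>Smooth test functions suffice for an L1 bound by duality: a continuous \<open>k\<close>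
  is the limit of its mollifications at scale \<open>1 / real (Suc n)\<close>, and a measurable
  \<open>k\<close> is an almost everywhere limit of continuous ones.\<close>

lemma L1_dual_bound:
  fixes W :: "real^'n \<Rightarrow> real"
  assumes W: "integrable lborel W"
    and c: "\<And>k \<sigma>. continuous_on UNIV k \<Longrightarrow> (\<And>x. \<bar>k x\<bar> \<le> 1) \<Longrightarrow> \<sigma> > 0 \<Longrightarrow> \<bar>\<integral>x. W x * gker k 1 \<sigma> (\<lambda>_. 1) x \<partial>lborel\<bar> \<le> c"
    and k: "k \<in> borel_measurable borel" "\<And>x. \<bar>k x\<bar> \<le> 1"
  shows "\<bar>\<integral>x. W x * k x \<partial>lborel\<bar> \<le> c"
proof -
  have cont: "\<bar>\<integral>x. W x * k x \<partial>lborel\<bar> \<le> c" if k: "continuous_on UNIV k" "\<And>x. \<bar>k x\<bar> \<le> 1" for k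
  proof (rule L1_dual_bound_limit[OF W, where k = "\<lambda>n. gker k 1 (1 / real (Suc n)) (\<lambda>_. 1)"])
    show km: "k \<in> borel_measurable borel" using k(1) by (rule borel_measurable_continuous_onI)
    show "gker k 1 (1 / real (Suc n)) (\<lambda>_. 1) \<in> borel_measurable borel" for n
      using km k(2) by (rule gker_measurable) simp
    show "\<bar>gker k 1 (1 / real (Suc n)) (\<lambda>_. 1) x\<bar> \<le> 1" for n x
      using km k(2) by (rule gker_one_bound)
    show "AE x in lborel. (\<lambda>n. gker k 1 (1 / real (Suc n)) (\<lambda>_. 1) x) \<longlonglongrightarrow> k x"
      using gker_tendsto[OF k] by simp
  qed (use k c in auto)
  obtain g where g: "\<And>n. continuous_on UNIV (g n)" "\<And>n x. \<bar>g n x\<bar> \<le> 1"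
    "AE x in lborel. (\<lambda>n::nat. g n x) \<longlonglongrightarrow> k x"
    using borel_bounded_approx[OF k] by auto
  show ?thesis
    by (rule L1_dual_bound_limit[OF W _ k(1) g(2,3) cont[OF g(1,2)]])
       (rule borel_measurable_continuous_onI[OF g(1)])
qed

lemma gker_translate: "gker k 1 \<sigma> p (x - c) = gker (\<lambda>y. k (y - c)) 1 \<sigma> p x"
  by (simp add: gker_def algebra_simps)

text \<open>Uniformity in \<open>k\<close> makes this differentiability in \<open>L\<^sup>1\<close>, stated by duality.\<close>

lemma L1_difference_quotient:
  fixes F :: "real^'n \<Rightarrow> real"
  assumes F: "integrable lborel F" and H: "integrable lborel H"
    and wk: "\<And>\<psi>. smooth \<psi> \<Longrightarrow> (\<integral>x. F x * (grad \<psi> x \<bullet> e) \<partial>lborel) = - (\<integral>x. H x * \<psi> x \<partial>lborel)"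
    and e: "norm e = 1" and \<eta>: "\<eta> > 0"
  shows "\<exists>d>0. \<forall>h k. 0 < h \<longrightarrow> h < d \<longrightarrow> k \<in> borel_measurable borel \<longrightarrow> (\<forall>x. \<bar>k x\<bar> \<le> 1) \<longrightarrow>
    \<bar>\<integral>x. (F (x + h *\<^sub>R e) - F x - h * H x) * k x \<partial>lborel\<bar> \<le> h * \<eta>"
proof -
  have [measurable]: "F \<in> borel_measurable borel" "H \<in> borel_measurable borel"
    using borel_measurable_integrable[OF F] borel_measurable_integrable[OF H] by simp_all
  obtain d where d: "d > 0" "\<And>y. norm y < d \<Longrightarrow> (\<integral>x. \<bar>H (x + y) - H x\<bar> \<partial>lborel) < \<eta>"
    using translation_continuous_L1[OF H \<eta>] by blast
  have tr: "integrable lborel (\<lambda>x. H (x + y))" "integrable lborel (\<lambda>x. F (x + y))" for y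
    using H F by (simp_all add: lborel_integral_translate(2))
  show ?thesis
  proof (intro exI[of _ d] conjI d(1) allI impI)
    fix h :: real and k :: "real^'n \<Rightarrow> real"
    assume h: "0 < h" "h < d" and k: "k \<in> borel_measurable borel" "\<forall>x. \<bar>k x\<bar> \<le> 1"
    define W where "W x = F (x + h *\<^sub>R e) - F x - h * H x" for x
    have W: "integrable lborel W" unfolding W_def using F H tr by auto
    have "\<bar>\<integral>x. W x * gker k 1 \<sigma> (\<lambda>_. 1) x \<partial>lborel\<bar> \<le> h * \<eta>"
      if k: "continuous_on UNIV k" "\<And>x. \<bar>k x\<bar> \<le> 1" and \<sigma>: "\<sigma> > 0" for k and \<sigma> :: real
    proof -
      have km [measurable]: "k \<in> borel_measurable borel" using k(1) by (rule borel_measurable_continuous_onI)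
      define \<psi> where "\<psi> = gker k 1 \<sigma> (\<lambda>_. 1)"
      have sm: "smooth (\<lambda>x. \<psi> (x - c))" for c
        unfolding \<psi>_def gker_translate using k(2) \<sigma> by (intro gker_smooth) auto
      have g: "grad_at \<psi> (grad \<psi> x) x" for x using smooth_grad_at[OF sm[of 0]] by simp
      have gtr: "grad_at (\<lambda>x. \<psi> (x - c)) (grad \<psi> (x - c)) x" for x c
        unfolding grad_at_def
        by (rule has_derivative_compose[of "\<lambda>x. x - c" "\<lambda>k. k", OF _ g[of "x - c", unfolded grad_at_def]])
           (auto intro!: derivative_eq_intros)
      have \<psi>m [measurable]: "\<psi> \<in> borel_measurable borel"
        using smooth_continuous[OF sm[of 0]] by (intro borel_measurable_continuous_onI) simp
      have \<psi>1: "\<bar>\<psi> x\<bar> \<le> 1" for x unfolding \<psi>_def using k(2) by (intro gker_one_bound) auto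
      have gm [measurable]: "grad \<psi> \<in> borel_measurable borel"
      proof -
        have "partial_deriv i \<psi> \<in> borel_measurable borel" for i
          using smooth_continuous[OF smooth_partial_deriv, of \<psi> i] sm[of 0] by (intro borel_measurable_continuous_onI) simp
        then show ?thesis unfolding grad_def[abs_def] by measurable
      qed
      obtain L where L: "\<And>x. norm (grad \<psi> x) \<le> L"
      proof
        fix x
        have "grad \<psi> x = (\<chi> i. 1 / \<sigma> * gker k 1 \<sigma> (herm i (\<lambda>_. 1)) x)"
          by (rule grad_at_unique[OF g]) (use gker_grad[OF km k(2) \<sigma>, of 1 "\<lambda>_. 1" x] in \<open>simp add: \<psi>_def\<close>)
        then have "norm (grad \<psi> x) \<le> (\<Sum>i\<in>UNIV. \<bar>1 / \<sigma> * gker k 1 \<sigma> (herm i (\<lambda>_. 1)) x\<bar>)"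
          using norm_le_l1_cart[of "grad \<psi> x"] by simp
        also have "\<dots> \<le> (\<Sum>i\<in>(UNIV::'n set). 1 / \<sigma> * (1 * (\<integral>z. \<bar>mpoly (herm i (\<lambda>_. 1)) z\<bar> \<partial>gauss_measure)))"
          unfolding abs_mult using gker_bound[OF km k(2)] \<sigma> by (intro sum_mono mult_mono) auto
        finally show "norm (grad \<psi> x) \<le> (\<Sum>i\<in>(UNIV::'n set). 1 / \<sigma> * (1 * (\<integral>z. \<bar>mpoly (herm i (\<lambda>_. 1)) z\<bar> \<partial>gauss_measure)))" .
      qed
      \<comment> \<open>Putting the translation on \<psi> makes the pairing differentiable in
        \<open>s\<close>. The hypothesis \<open>wk\<close>, applied to the translated \<psi>,
        identifies the derivative as \<open>cc s\<close>.\<close>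
      define \<Phi> where "\<Phi> s = (\<integral>x. F x * \<psi> (x - s *\<^sub>R e) \<partial>lborel)" for s
      define cc where "cc s = (\<integral>x. H (x + s *\<^sub>R e) * \<psi> x \<partial>lborel)" for s
      have D: "(\<Phi> has_real_derivative cc s) (at s)" for s
      proof -
        have "grad_at \<Phi> (\<integral>x. - (F x * (grad \<psi> (x - s *\<^sub>R e) \<bullet> e)) \<partial>lborel) s"
          unfolding \<Phi>_def[abs_def]
        proof (rule grad_at_integral[where e = 1 and B = "\<lambda>x. \<bar>F x\<bar> * L", THEN conjunct1])
          fix s' x
          have "((\<lambda>s. \<psi> (x - s *\<^sub>R e)) has_derivative (\<lambda>t. grad \<psi> (x - s' *\<^sub>R e) \<bullet> (- (t *\<^sub>R e)))) (at s')"
            by (rule has_derivative_compose[of "\<lambda>s. x - s *\<^sub>R e" "\<lambda>t. - (t *\<^sub>R e)", OF _ g[unfolded grad_at_def]])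
               (auto intro!: derivative_eq_intros)
          from has_derivative_mult_right[OF this, of "F x"]
          have "((\<lambda>s. F x * \<psi> (x - s *\<^sub>R e)) has_derivative (\<lambda>t. F x * (grad \<psi> (x - s' *\<^sub>R e) \<bullet> (- (t *\<^sub>R e))))) (at s')" .
          moreover have "(\<lambda>t. F x * (grad \<psi> (x - s' *\<^sub>R e) \<bullet> (- (t *\<^sub>R e)))) = (\<bullet>) (- (F x * (grad \<psi> (x - s' *\<^sub>R e) \<bullet> e)))"
            by (simp add: fun_eq_iff)
          ultimately show "grad_at (\<lambda>s. F x * \<psi> (x - s *\<^sub>R e)) (- (F x * (grad \<psi> (x - s' *\<^sub>R e) \<bullet> e))) s'"
            unfolding grad_at_def by simp
          show "integrable lborel (\<lambda>x. F x * \<psi> (x - s' *\<^sub>R e))"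
            using \<psi>1 by (intro integrable_mult_bounded[where K = 1] F) auto
          have "\<bar>grad \<psi> (x - s' *\<^sub>R e) \<bullet> e\<bar> \<le> L"
            using Cauchy_Schwarz_ineq2[of "grad \<psi> (x - s' *\<^sub>R e)" e] L[of "x - s' *\<^sub>R e"] e by simp
          then show "norm (- (F x * (grad \<psi> (x - s' *\<^sub>R e) \<bullet> e))) \<le> \<bar>F x\<bar> * L"
            by (simp add: abs_mult mult_left_mono)
        qed (use F in auto)
        moreover have "(\<integral>x. - (F x * (grad \<psi> (x - s *\<^sub>R e) \<bullet> e)) \<partial>lborel) = cc s"
        proof -
          have "grad (\<lambda>x. \<psi> (x - s *\<^sub>R e)) x = grad \<psi> (x - s *\<^sub>R e)" for x
            using gtr by (rule grad_at_grad)
          with wk[OF sm, of "s *\<^sub>R e"] have "(\<integral>x. - (F x * (grad \<psi> (x - s *\<^sub>R e) \<bullet> e)) \<partial>lborel) = (\<integral>x. H x * \<psi> (x - s *\<^sub>R e) \<partial>lborel)"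
            by simp
          also have "\<dots> = cc s"
            unfolding cc_def using lborel_integral_translate(1)[of "\<lambda>x. H x * \<psi> (x - s *\<^sub>R e)" "s *\<^sub>R e"] by simp
          finally show ?thesis .
        qed
        ultimately have "grad_at \<Phi> (cc s) s" by (simp only:)
        moreover have "(\<bullet>) (cc s) = (*) (cc s)" by (simp add: fun_eq_iff)
        ultimately show ?thesis
          by (simp add: grad_at_def has_field_derivative_def)
      qed
      \<comment> \<open>Only the bound \<open>1\<close> on \<psi> enters here, which is why the
        window \<open>d\<close> depends neither on \<open>k\<close> nor on the mollification
        scale.\<close>
      have ccd: "\<bar>cc s - cc 0\<bar> \<le> \<eta>" if "0 < s" "s < h" for s
      proof -
        have i1: "integrable lborel (\<lambda>x. H (x + y) * \<psi> x)" for y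
          using \<psi>1 tr by (intro integrable_mult_bounded[where K = 1]) auto
        have "cc s - cc 0 = (\<integral>x. (H (x + s *\<^sub>R e) - H x) * \<psi> x \<partial>lborel)"
          unfolding cc_def using i1 i1[of 0] by (simp add: left_diff_distrib)
        also have "\<bar>\<dots>\<bar> \<le> (\<integral>x. \<bar>(H (x + s *\<^sub>R e) - H x) * \<psi> x\<bar> \<partial>lborel)"
          by (rule integral_abs_bound)
        also have "\<dots> \<le> (\<integral>x. \<bar>H (x + s *\<^sub>R e) - H x\<bar> \<partial>lborel)"
        proof (rule integral_mono)
          show "integrable lborel (\<lambda>x. \<bar>(H (x + s *\<^sub>R e) - H x) * \<psi> x\<bar>)"
            using i1 i1[of 0] by (intro integrable_abs) (simp add: left_diff_distrib)
          show "integrable lborel (\<lambda>x. \<bar>H (x + s *\<^sub>R e) - H x\<bar>)" using tr H by auto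
          show "\<bar>(H (x + s *\<^sub>R e) - H x) * \<psi> x\<bar> \<le> \<bar>H (x + s *\<^sub>R e) - H x\<bar>" for x
            using \<psi>1 by (simp add: abs_mult mult_left_le)
        qed
        also have "\<dots> \<le> \<eta>" using d(2)[of "s *\<^sub>R e"] that h e by simp
        finally show ?thesis .
      qed
      \<comment> \<open>At an intermediate point the error
        \<open>\<Phi> h - \<Phi> 0 - h * cc 0\<close> becomes \<open>h * (cc s - cc 0)\<close>,
        which small translations of \<open>H\<close> control.\<close>
      obtain s where s: "0 < s" "s < h" "\<Phi> h - \<Phi> 0 = (h - 0) * cc s"
        using MVT2[OF h(1) D] by blast
      have "(\<integral>x. W x * \<psi> x \<partial>lborel) = \<Phi> h - \<Phi> 0 - h * cc 0"
      proof -
        have "\<Phi> h = (\<integral>x. F (x + h *\<^sub>R e) * \<psi> x \<partial>lborel)"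
          unfolding \<Phi>_def using lborel_integral_translate(1)[of "\<lambda>x. F x * \<psi> (x - h *\<^sub>R e)" "h *\<^sub>R e"] by simp
        moreover have "integrable lborel (\<lambda>x. F (x + y) * \<psi> x)" "integrable lborel (\<lambda>x. H x * \<psi> x)" for y
          using \<psi>1 tr H by (auto intro!: integrable_mult_bounded[where K = 1])
        note this this(1)[of 0]
        ultimately show ?thesis
          unfolding W_def \<Phi>_def cc_def by (simp add: left_diff_distrib mult.assoc)
      qed
      also have "\<dots> = h * (cc s - cc 0)" by (simp add: s(3) algebra_simps)
      finally show ?thesis using ccd[OF s(1,2)] h(1) by (simp add: \<psi>_def abs_mult)
    qed
    then have "\<bar>\<integral>x. W x * k x \<partial>lborel\<bar> \<le> h * \<eta>"
      by (rule L1_dual_bound[OF W]) (use k in auto)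
    then show "\<bar>\<integral>x. (F (x + h *\<^sub>R e) - F x - h * H x) * k x \<partial>lborel\<bar> \<le> h * \<eta>"
      by (simp add: W_def)
  qed
qed

text \<open>On \<open>{F = 0}\<close> the difference quotients of \<open>F \<ge> 0\<close> are nonnegative in both directions
  \<open>axis i 1\<close> and \<open>- axis i 1\<close>, so \<open>H\<close> and \<open>- H\<close> are.\<close>

lemma weak_derivative_zero_set:
  fixes F :: "real^'n \<Rightarrow> real"
  assumes F: "integrable lborel F" and H: "integrable lborel H" and F0: "\<And>x. F x \<ge> 0"
    and wk: "\<And>\<psi>. smooth \<psi> \<Longrightarrow> (\<integral>x. F x * partial_deriv i \<psi> x \<partial>lborel) = - (\<integral>x. H x * \<psi> x \<partial>lborel)"
  shows "AE x in lborel. F x = 0 \<longrightarrow> H x = 0"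
proof -
  have [measurable]: "F \<in> borel_measurable borel" "H \<in> borel_measurable borel"
    using borel_measurable_integrable[OF F] borel_measurable_integrable[OF H] by simp_all
  have ge0: "(\<integral>x. s * H x * k x \<partial>lborel) \<ge> 0"
    if s: "s = 1 \<or> s = -1" and k: "k \<in> borel_measurable borel" "\<And>x. 0 \<le> k x" "\<And>x. k x \<le> 1" "\<And>x. F x \<noteq> 0 \<Longrightarrow> k x = 0" for k s
  proof (rule ccontr)
    note [measurable] = k(1)
    define a where "a = - (\<integral>x. s * H x * k x \<partial>lborel)"
    assume "\<not> ?thesis"
    then have a: "a > 0" by (simp add: a_def)
    have wk': "(\<integral>x. F x * (grad \<psi> x \<bullet> (s *\<^sub>R axis i 1)) \<partial>lborel) = - (\<integral>x. s * H x * \<psi> x \<partial>lborel)" if "smooth \<psi>" for \<psi>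
      using wk[OF that] s by (auto simp: grad_def inner_axis)
    have iH: "integrable lborel (\<lambda>x. s * H x)" using H by simp
    have nm: "norm (s *\<^sub>R axis i 1 :: real^'n) = 1" using s by auto
    have a2: "a / 2 > 0" using a by simp
    have "\<exists>d>0. \<forall>h k. 0 < h \<longrightarrow> h < d \<longrightarrow> k \<in> borel_measurable borel \<longrightarrow> (\<forall>x. \<bar>k x\<bar> \<le> 1) \<longrightarrow>
      \<bar>\<integral>x. (F (x + h *\<^sub>R (s *\<^sub>R axis i 1)) - F x - h * (s * H x)) * k x \<partial>lborel\<bar> \<le> h * (a / 2)"
      by (rule L1_difference_quotient[OF F iH wk' nm a2])
    then obtain d where d: "d > 0" "\<forall>h k. 0 < h \<longrightarrow> h < d \<longrightarrow> k \<in> borel_measurable borel \<longrightarrow> (\<forall>x. \<bar>k x\<bar> \<le> 1) \<longrightarrow>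
      \<bar>\<integral>x. (F (x + h *\<^sub>R (s *\<^sub>R axis i 1)) - F x - h * (s * H x)) * k x \<partial>lborel\<bar> \<le> h * (a / 2)"
      by (elim exE conjE)
    define h where "h = d / 2"
    have h: "0 < h" "h < d" using d(1) by (auto simp: h_def)
    let ?e = "h *\<^sub>R (s *\<^sub>R axis i (1::real)) :: real^'n"
    have b: "\<bar>\<integral>x. (F (x + ?e) - F x - h * (s * H x)) * k x \<partial>lborel\<bar> \<le> h * (a / 2)"
      using k by (intro d(2)[rule_format] h) auto
    \<comment> \<open>\<open>k\<close> lives on \<open>{F = 0}\<close>, so \<open>F x\<close> drops
      out. What remains integrates to a nonnegative number plus \<open>h * a\<close>, which is more
      than the allowed error \<open>h * (a / 2)\<close>.\<close>
    have "(F (x + ?e) - F x - h * (s * H x)) * k x = F (x + ?e) * k x - h * (s * H x * k x)" for x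
      using k(4)[of x] by (cases "F x = 0") (auto simp: algebra_simps)
    moreover have i1: "integrable lborel (\<lambda>x. F (x + ?e) * k x)"
      by (rule Bochner_Integration.integrable_bound[of _ "\<lambda>x. F (x + ?e)"])
         (use F F0 k in \<open>auto simp: lborel_integral_translate(2) abs_mult intro!: mult_left_le\<close>)
    moreover have "integrable lborel (\<lambda>x. H x * k x)"
      by (rule Bochner_Integration.integrable_bound[OF H])
         (use k in \<open>auto simp: abs_mult intro!: mult_left_le\<close>)
    ultimately have "(\<integral>x. (F (x + ?e) - F x - h * (s * H x)) * k x \<partial>lborel) = (\<integral>x. F (x + ?e) * k x \<partial>lborel) + h * a"
      by (simp add: a_def mult.assoc)
    moreover have "(\<integral>x. F (x + ?e) * k x \<partial>lborel) \<ge> 0" using F0 k by simp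
    ultimately have "h * a \<le> h * (a / 2)" using b by linarith
    with h a show False by simp
  qed
  have eq0: "(\<integral>x. H x * k x \<partial>lborel) = 0"
    if k: "k \<in> borel_measurable borel" "\<And>x. 0 \<le> k x" "\<And>x. k x \<le> 1" "\<And>x. F x \<noteq> 0 \<Longrightarrow> k x = 0" for k
    using ge0[of 1 k, OF _ k] ge0[of "-1" k, OF _ k] by simp
  have ik: "integrable lborel (\<lambda>x. H x * indicator A x)" if "A \<in> sets borel" for A
    using that H by (intro integrable_mult_indicator[of A lborel H, simplified mult.commute[of _ "H _"] real_scaleR_def]) auto
  have A: "{x. F x = 0 \<and> H x > 0} \<in> sets borel" "{x. F x = 0 \<and> H x < 0} \<in> sets borel" by measurable
  have "(\<integral>x. H x * indicator {x. F x = 0 \<and> H x > 0} x \<partial>lborel) = 0"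
    using A by (intro eq0) (auto simp: indicator_def)
  moreover have "AE x in lborel. 0 \<le> H x * indicator {x. F x = 0 \<and> H x > 0} x"
    by (auto simp: indicator_def)
  ultimately have 1: "AE x in lborel. H x * indicator {x. F x = 0 \<and> H x > 0} x = 0"
    using integral_nonneg_eq_0_iff_AE[OF ik[OF A(1)]] by simp
  have "(\<integral>x. - (H x * indicator {x. F x = 0 \<and> H x < 0} x) \<partial>lborel) = 0"
    using A eq0[of "indicator {x. F x = 0 \<and> H x < 0}"] by (simp add: indicator_def)
  moreover have "AE x in lborel. 0 \<le> - (H x * indicator {x. F x = 0 \<and> H x < 0} x)"
    by (auto simp: indicator_def)
  ultimately have 2: "AE x in lborel. - (H x * indicator {x. F x = 0 \<and> H x < 0} x) = 0"
    using integral_nonneg_eq_0_iff_AE[OF integrable_minus[OF ik[OF A(2)]]] by simp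
  from 1 2 show ?thesis
    by eventually_elim (auto simp: indicator_def split: if_splits)
qed

section \<open>Passage to locally integrable functions\<close>

lemma locally_integrable_measurable:
  fixes g :: "real^'n \<Rightarrow> 'b::{banach, second_countable_topology}"
  assumes "locally_integrable g"
  shows "g \<in> borel_measurable borel"
proof (rule borel_measurable_LIMSEQ_metric)
  show "(\<lambda>x. indicator (cball 0 (real n)) x *\<^sub>R g x) \<in> borel_measurable borel" for n
  proof -
    have "integrable lborel (\<lambda>x. indicator (cball 0 (real n)) x *\<^sub>R g x)"
      using assms compact_cball unfolding locally_integrable_def set_integrable_def by blast
    from borel_measurable_integrable[OF this] show ?thesis by simp
  qed
  fix x :: "real^'n"
  have "\<forall>\<^sub>F n in sequentially. real n \<ge> norm x"
    using filterlim_real_sequentially by (rule filterlim_at_top[THEN iffD1, rule_format])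
  then have "\<forall>\<^sub>F n in sequentially. indicator (cball 0 (real n)) x *\<^sub>R g x = g x"
    by eventually_elim simp
  then show "(\<lambda>n. indicator (cball 0 (real n)) x *\<^sub>R g x) \<longlonglongrightarrow> g x"
    by (rule tendsto_eventually)
qed

lemma locally_integrable_mult:
  fixes g \<phi> :: "real^'n \<Rightarrow> real"
  assumes g: "locally_integrable g" and \<phi>: "continuous_on UNIV \<phi>" and K: "compact K" "\<And>x. x \<notin> K \<Longrightarrow> \<phi> x = 0"
  shows "integrable lborel (\<lambda>x. g x * \<phi> x)"
proof -
  have [measurable]: "g \<in> borel_measurable borel" "\<phi> \<in> borel_measurable borel"
    using locally_integrable_measurable[OF g] borel_measurable_continuous_onI[OF \<phi>] by auto
  have "bounded (\<phi> ` K)"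
    using K \<phi> by (intro compact_imp_bounded compact_continuous_image) (auto intro: continuous_on_subset)
  then obtain C where "\<forall>y\<in>\<phi> ` K. norm y \<le> C" unfolding bounded_iff by blast
  then have C: "\<And>x. x \<in> K \<Longrightarrow> \<bar>\<phi> x\<bar> \<le> C" by auto
  show ?thesis
  proof (rule Bochner_Integration.integrable_bound)
    show "integrable lborel (\<lambda>x. C * (indicator K x *\<^sub>R g x))"
      using g K(1) unfolding locally_integrable_def set_integrable_def by simp
    have "\<bar>g x * \<phi> x\<bar> \<le> \<bar>C * (indicator K x *\<^sub>R g x)\<bar>" for x
    proof (cases "x \<in> K")
      case True
      have "\<bar>\<phi> x\<bar> * \<bar>g x\<bar> \<le> \<bar>C\<bar> * \<bar>g x\<bar>"
        using C[OF True] by (intro mult_right_mono) auto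
      then show ?thesis using True by (simp add: abs_mult mult.commute)
    qed (simp add: K(2))
    then show "AE x in lborel. norm (g x * \<phi> x) \<le> norm (C * (indicator K x *\<^sub>R g x))" by simp
  qed measurable
qed

lemma test_function_support:
  assumes "test_function \<phi>"
  shows "compact (closure {x. \<phi> x \<noteq> 0})" "x \<notin> closure {x. \<phi> x \<noteq> 0} \<Longrightarrow> \<phi> x = 0"
    "x \<notin> closure {x. \<phi> x \<noteq> 0} \<Longrightarrow> partial_deriv i \<phi> x = 0"
proof -
  show "compact (closure {x. \<phi> x \<noteq> 0})" using assms by (simp add: test_function_def)
  show "x \<notin> closure {x. \<phi> x \<noteq> 0} \<Longrightarrow> \<phi> x = 0" using closure_subset[of "{x. \<phi> x \<noteq> 0}"] by blast
  assume x: "x \<notin> closure {x. \<phi> x \<noteq> 0}"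
  have "grad_at \<phi> 0 x"
    unfolding grad_at_def
  proof (rule has_derivative_transform_within_open[of "\<lambda>_. 0" _ _ _ "- closure {x. \<phi> x \<noteq> 0}"])
    show "((\<lambda>_. 0) has_derivative (\<bullet>) 0) (at x)" by (simp add: inner_zero_left[abs_def])
    show "0 = \<phi> y" if "y \<in> - closure {x. \<phi> x \<noteq> 0}" for y
      using that closure_subset[of "{x. \<phi> x \<noteq> 0}"] by auto
  qed (use x in auto)
  then show "partial_deriv i \<phi> x = 0" by (simp add: grad_at_partial_deriv)
qed

lemma locally_integrable_nth:
  fixes G :: "real^'n \<Rightarrow> real^'n"
  shows "locally_integrable G \<Longrightarrow> locally_integrable (\<lambda>x. G x $ i)"
  unfolding locally_integrable_def set_integrable_def
  using integrable_bounded_linear[OF bounded_linear_vec_nth] by fastforce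

text \<open>The Fisher information sees only \<open>{f > 0}\<close>, and this fact lets it control
  the weak gradient everywhere. The integrable case is applied to \<open>f * ct n\<close>, whose
  weak derivative is given by the product rule; at a zero of \<open>f\<close>, an index with
  \<open>ct n x = 1\<close> leaves just \<open>G x\<close>.\<close>

lemma weak_gradient_zero_set:
  fixes f :: "real^'n \<Rightarrow> real"
  assumes f: "locally_integrable f" and G: "locally_integrable G" and wg: "has_weak_gradient f G"
    and f0: "\<And>x. f x \<ge> 0"
  shows "AE x in lborel. f x = 0 \<longrightarrow> G x = 0"
proof -
  obtain ct :: "nat \<Rightarrow> real^'n \<Rightarrow> real" where ct: "\<And>n. test_function (ct n)" "\<And>n x. 0 \<le> ct n x"
    "\<And>x. \<forall>\<^sub>F n in sequentially. ct n x = 1"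
    "\<And>x i. \<forall>\<^sub>F n in sequentially. partial_deriv i (ct n) x = 0"
    using cutoff_ex by metis
  have "AE x in lborel. f x * ct n x = 0 \<longrightarrow> G x $ i * ct n x + f x * partial_deriv i (ct n) x = 0" for n i
  proof (rule weak_derivative_zero_set)
    have sm: "smooth (ct n)" using ct(1) by (simp add: test_function_def)
    note supp = test_function_support[OF ct(1)[of n]]
    have dif: "ct n differentiable (at x)" for x using smooth_grad_at[OF sm] grad_at_differentiable by blast
    have i1: "integrable lborel (\<lambda>x. G x $ i * (ct n x * \<psi> x))" "integrable lborel (\<lambda>x. f x * (partial_deriv i (ct n) x * \<psi> x))"
      "integrable lborel (\<lambda>x. f x * (ct n x * \<psi> x))" if "continuous_on UNIV \<psi>" for \<psi>
    proof -
      have c: "continuous_on UNIV (\<lambda>x. ct n x * \<psi> x)" "continuous_on UNIV (\<lambda>x. partial_deriv i (ct n) x * \<psi> x)"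
        by (intro continuous_on_mult that smooth_continuous sm smooth_partial_deriv)+
      have z: "ct n x * \<psi> x = 0" "partial_deriv i (ct n) x * \<psi> x = 0" if "x \<notin> closure {x. ct n x \<noteq> 0}" for x
        using supp(2,3)[OF that] by simp_all
      show "integrable lborel (\<lambda>x. G x $ i * (ct n x * \<psi> x))"
        by (rule locally_integrable_mult[OF locally_integrable_nth[OF G] c(1) supp(1) z(1)])
      show "integrable lborel (\<lambda>x. f x * (partial_deriv i (ct n) x * \<psi> x))"
        by (rule locally_integrable_mult[OF f c(2) supp(1) z(2)])
      show "integrable lborel (\<lambda>x. f x * (ct n x * \<psi> x))"
        by (rule locally_integrable_mult[OF f c(1) supp(1) z(1)])
    qed
    show "integrable lborel (\<lambda>x. f x * ct n x)" "integrable lborel (\<lambda>x. G x $ i * ct n x + f x * partial_deriv i (ct n) x)"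
      using i1[of "\<lambda>_. 1"] by auto
    show "f x * ct n x \<ge> 0" for x using f0 ct(2) by simp
    fix \<psi> :: "real^'n \<Rightarrow> real" assume \<psi>: "smooth \<psi>"
    have dif': "\<psi> differentiable (at x)" for x using smooth_grad_at[OF \<psi>] grad_at_differentiable by blast
    have "(\<integral>x. f x * partial_deriv i (\<lambda>x. ct n x * \<psi> x) x \<partial>lborel) = - (\<integral>x. G x $ i * (ct n x * \<psi> x) \<partial>lborel)"
      using wg test_function_mult[OF ct(1) \<psi>] unfolding has_weak_gradient_def by blast
    moreover have "f x * partial_deriv i (\<lambda>x. ct n x * \<psi> x) x = f x * (ct n x * partial_deriv i \<psi> x) + f x * (partial_deriv i (ct n) x * \<psi> x)" for x
      using dif dif' by (simp add: partial_deriv_mult algebra_simps)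
    ultimately have "(\<integral>x. f x * (ct n x * partial_deriv i \<psi> x) \<partial>lborel) = - (\<integral>x. G x $ i * (ct n x * \<psi> x) \<partial>lborel) - (\<integral>x. f x * (partial_deriv i (ct n) x * \<psi> x) \<partial>lborel)"
      using i1(2)[OF smooth_continuous[OF \<psi>]] i1(3)[OF smooth_continuous[OF smooth_partial_deriv[OF \<psi>]]] by simp
    then show "(\<integral>x. f x * ct n x * partial_deriv i \<psi> x \<partial>lborel) = - (\<integral>x. (G x $ i * ct n x + f x * partial_deriv i (ct n) x) * \<psi> x \<partial>lborel)"
      using i1(1,2)[OF smooth_continuous[OF \<psi>]] by (simp add: distrib_right mult.assoc)
  qed
  then have "AE x in lborel. \<forall>n i. f x * ct n x = 0 \<longrightarrow> G x $ i * ct n x + f x * partial_deriv i (ct n) x = 0"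
    by (simp add: AE_all_countable)
  then show ?thesis
  proof eventually_elim
    case (elim x)
    show ?case
    proof
      assume fx: "f x = 0"
      from ct(3)[of x] obtain n where "ct n x = 1" by (auto simp: eventually_sequentially)
      with elim fx show "G x = 0" by (auto simp: vec_eq_iff)
    qed
  qed
qed

section \<open>Weak gradients against a Gaussian weight\<close>

lemma grad_at_mult:
  "grad_at f d x \<Longrightarrow> grad_at g e x \<Longrightarrow> grad_at (\<lambda>x. f x * g x) (f x *\<^sub>R e + g x *\<^sub>R d) x"
  unfolding grad_at_def
  by (rule has_derivative_eq_rhs[OF has_derivative_mult]) (auto simp: fun_eq_iff inner_add_left mult.commute)

lemma grad_at_gdens: "grad_at gdens (- (gdens x *\<^sub>R x)) x"
proof -
  have "(\<chi> i. - (gdens x * mpoly (herm i (\<lambda>_. 1)) x)) = - (gdens x *\<^sub>R x)"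
    by (simp add: herm_one vec_eq_iff)
  then show ?thesis using grad_at_mpoly_gdens[of "\<lambda>_. 1" x] by simp
qed

lemma borel_measurable_vec_nth [measurable (raw)]:
  fixes g :: "'a \<Rightarrow> real^'n"
  assumes "g \<in> borel_measurable M"
  shows "(\<lambda>x. g x $ i) \<in> borel_measurable M"
  using assms by (rule measurable_compose) (intro borel_measurable_continuous_onI continuous_intros)

text \<open>\<open>G\<close> is an arbitrary weak gradient with finite Fisher information, so the
  arguments below rest only on its defining identity and its integrability. The theorem inserts
  \<open>weak_grad f\<close>.\<close>

locale regular_density =
  fixes f :: "real^'n \<Rightarrow> real" and G :: "real^'n \<Rightarrow> real^'n" and lam :: real
  assumes f_meas [measurable]: "f \<in> borel_measurable borel" and f_nonneg: "f x \<ge> 0"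
    and prob: "prob_space (density gauss_measure (\<lambda>x. ennreal (f x)))"
    and f_loc: "locally_integrable f" and G_loc: "locally_integrable G" and wg: "has_weak_gradient f G"
    and fisher: "set_integrable gauss_measure {x. f x > 0} (\<lambda>x. (norm (G x))\<^sup>2 / f x)"
    and cent: "centered (density gauss_measure (\<lambda>x. ennreal (f x)))"
    and lam: "lam > 0" and poinc: "density gauss_measure (\<lambda>x. ennreal (f x)) \<in> poincare_class lam"
begin

definition "nu = density gauss_measure (\<lambda>x. ennreal (f x))"
definition "Fish = (LINT x:{x. f x > 0}|gauss_measure. (norm (G x))\<^sup>2 / f x)"

lemma G_meas [measurable]: "G \<in> borel_measurable borel"
  using G_loc by (rule locally_integrable_measurable)

lemma integral_nu:
  "h \<in> borel_measurable borel \<Longrightarrow> (\<integral>x. h x \<partial>nu) = (\<integral>x. f x * h x \<partial>gauss_measure)" for h :: "real^'n \<Rightarrow> real"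
  unfolding nu_def using f_nonneg by (subst integral_density) auto

lemma integrable_nu:
  "h \<in> borel_measurable borel \<Longrightarrow> integrable nu h \<longleftrightarrow> integrable gauss_measure (\<lambda>x. f x * h x)" for h :: "real^'n \<Rightarrow> real"
  unfolding nu_def using f_nonneg by (subst integrable_density) auto

lemma sets_nu [simp, measurable_cong]: "sets nu = sets borel" and space_nu [simp]: "space nu = UNIV"
  by (simp_all add: nu_def)

lemma f_int: "integrable gauss_measure f" and f_prob: "(\<integral>x. f x \<partial>gauss_measure) = 1"
proof -
  interpret prob_space nu using prob by (simp add: nu_def)
  show "integrable gauss_measure f" using integrable_nu[of "\<lambda>_. 1"] by simp
  show "(\<integral>x. f x \<partial>gauss_measure) = 1" using integral_nu[of "\<lambda>_. 1"] prob_space by simp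
qed

lemma f_int_bounded:
  assumes "h \<in> borel_measurable borel" "\<And>x. \<bar>h x\<bar> \<le> K"
  shows "integrable gauss_measure (\<lambda>x. f x * h x)"
  using assms by (intro integrable_mult_bounded[OF f_int]) auto

lemma f_int_norm: "integrable gauss_measure (\<lambda>x. f x * norm x)"
  using integrable_nu[of norm] cent unfolding centered_def nu_def[symmetric] by (auto dest: integrable_norm)

lemma f_int_nth: "integrable gauss_measure (\<lambda>x. f x * x $ i)" and f_mean: "(\<integral>x. f x * x $ i \<partial>gauss_measure) = 0"
proof -
  have c: "integrable nu (\<lambda>x. x)" "(\<integral>x. x \<partial>nu) = 0" using cent by (auto simp: centered_def nu_def)
  have "integrable nu (\<lambda>x. x $ i)" by (rule integrable_bounded_linear[OF bounded_linear_vec_nth c(1)])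
  then show "integrable gauss_measure (\<lambda>x. f x * x $ i)" by (simp add: integrable_nu)
  show "(\<integral>x. f x * x $ i \<partial>gauss_measure) = 0"
    using integral_vec_nth[OF c(1), of i] c(2) by (simp add: integral_nu)
qed

lemma G_zero: "AE x in gauss_measure. f x = 0 \<longrightarrow> G x = 0"
  unfolding AE_gauss_iff using f_loc G_loc wg f_nonneg by (rule weak_gradient_zero_set)

definition "dens x = indicator {x. f x > 0} x * ((norm (G x))\<^sup>2 / f x)"

lemma dens_int: "integrable gauss_measure dens" and dens_Fish: "(\<integral>x. dens x \<partial>gauss_measure) = Fish"
  using fisher by (simp_all add: dens_def[abs_def] set_integrable_def Fish_def set_lebesgue_integral_def)

text \<open>Young's inequality in each coordinate, weighted by \<open>f x\<close>. The quantifier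
  over \<open>v\<close> stands inside the almost everywhere statement so that \<open>v\<close> may
  depend on \<open>x\<close>; on \<open>{f = 0}\<close> both sides vanish, the left one by
  \<open>G_zero\<close>.\<close>

lemma dens_young:
  assumes "c > 0"
  shows "AE x in gauss_measure. \<forall>v. (\<Sum>i\<in>UNIV. G x $ i * v i) \<le> c / 2 * dens x + 1 / (2 * c) * (\<Sum>i\<in>UNIV. f x * (v i)\<^sup>2)"
  using G_zero
proof eventually_elim
  case (elim x)
  show ?case
  proof
    fix v :: "'n \<Rightarrow> real"
    show "(\<Sum>i\<in>UNIV. G x $ i * v i) \<le> c / 2 * dens x + 1 / (2 * c) * (\<Sum>i\<in>UNIV. f x * (v i)\<^sup>2)"
    proof (cases "f x = 0")
      case True
      with elim show ?thesis by (simp add: dens_def)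
    next
      case False
      then have fx: "f x > 0" using f_nonneg[of x] by simp
      have "(\<Sum>i\<in>UNIV. G x $ i * v i) \<le> (\<Sum>i\<in>UNIV. c / 2 * ((G x $ i)\<^sup>2 / f x) + 1 / (2 * c) * (f x * (v i)\<^sup>2))"
      proof (rule sum_mono)
        fix i
        have "0 \<le> (c * G x $ i - f x * v i)\<^sup>2 / (2 * c * f x)"
          using fx assms by simp
        also have "\<dots> = c / 2 * ((G x $ i)\<^sup>2 / f x) + 1 / (2 * c) * (f x * (v i)\<^sup>2) - G x $ i * v i"
          using fx assms by (simp add: power2_eq_square field_simps)
        finally show "G x $ i * v i \<le> c / 2 * ((G x $ i)\<^sup>2 / f x) + 1 / (2 * c) * (f x * (v i)\<^sup>2)" by simp
      qed
      moreover have "dens x = (\<Sum>i\<in>UNIV. (G x $ i)\<^sup>2 / f x)"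
        using fx by (simp add: dens_def norm_vec_square sum_divide_distrib)
      ultimately show ?thesis
        by (simp only: sum.distrib sum_distrib_left)
    qed
  qed
qed

lemma G_int: "integrable gauss_measure (\<lambda>x. G x $ i)"
proof (rule Bochner_Integration.integrable_bound)
  show "integrable gauss_measure (\<lambda>x. 1 / 2 * dens x + 1 / 2 * f x)"
    using dens_int f_int by auto
  have "AE x in gauss_measure. \<bar>G x $ i\<bar> \<le> 1 / 2 * dens x + 1 / 2 * f x"
    using dens_young[OF zero_less_one]
  proof eventually_elim
    case (elim x)
    \<comment> \<open>Testing with plus and minus a unit coordinate vector isolates
      \<open>\<bar>G x $ i\<bar>\<close>.\<close>
    have *: "(\<Sum>j\<in>UNIV. G x $ j * (if j = i then s else 0)) = G x $ i * s"
      "(\<Sum>j\<in>UNIV. f x * (if j = i then s else 0)\<^sup>2) = f x * s\<^sup>2" for s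
      by (simp_all add: if_distrib[of "(*) _"] if_distrib[of "\<lambda>x. x\<^sup>2"] cong: if_cong)
    show ?case
      using elim[rule_format, of "\<lambda>j. if j = i then 1 else 0"] elim[rule_format, of "\<lambda>j. if j = i then -1 else 0"]
      unfolding * by auto
  qed
  then show "AE x in gauss_measure. norm (G x $ i) \<le> norm (1 / 2 * dens x + 1 / 2 * f x)"
    by eventually_elim simp
qed measurable

text \<open>The weak gradient is defined by Lebesgue integrals against compactly supported
  functions. Testing with \<open>ct n x * (u x * gdens x)\<close> brings in the Gaussian weight,
  whose derivative yields the term \<open>x $ i * u x\<close>. The cutoffs are then removed by
  dominated convergence, using the first moment of \<open>nu\<close>.\<close>

lemma weak_ibp:
  fixes u :: "real^'n \<Rightarrow> real"
  assumes u: "smooth u" and K: "\<And>x. \<bar>u x\<bar> \<le> K" and L: "\<And>x. \<bar>partial_deriv i u x\<bar> \<le> L"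
  shows "(\<integral>x. f x * (x $ i * u x - partial_deriv i u x) \<partial>gauss_measure) = (\<integral>x. G x $ i * u x \<partial>gauss_measure)"
proof -
  have [measurable]: "u \<in> borel_measurable borel" "partial_deriv i u \<in> borel_measurable borel"
    using smooth_continuous[OF u] smooth_continuous[OF smooth_partial_deriv[OF u]] by (auto intro: borel_measurable_continuous_onI)
  have K0: "K \<ge> 0" using K[of 0] by linarith
  obtain ct :: "nat \<Rightarrow> real^'n \<Rightarrow> real" and C where ct: "\<And>n. test_function (ct n)" "\<And>n x. 0 \<le> ct n x" "\<And>n x. ct n x \<le> 1"
    "\<And>x. \<forall>\<^sub>F n in sequentially. ct n x = 1" "\<And>n i x. \<bar>partial_deriv i (ct n) x\<bar> \<le> C"
    "\<And>x i. \<forall>\<^sub>F n in sequentially. partial_deriv i (ct n) x = 0"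
    using cutoff_ex by metis
  have sm: "smooth (ct n)" for n using ct(1) by (simp add: test_function_def)
  have C0: "C \<ge> 0" using ct(5)[of i 0 0] by linarith
  have [measurable]: "ct n \<in> borel_measurable borel" "partial_deriv i (ct n) \<in> borel_measurable borel" for n
    using smooth_continuous[OF sm] smooth_continuous[OF smooth_partial_deriv[OF sm]] by (auto intro: borel_measurable_continuous_onI)
  let ?a = "\<lambda>n x. f x * (partial_deriv i (ct n) x * u x + ct n x * partial_deriv i u x - ct n x * (x $ i * u x))"
  have eq: "(\<integral>x. ?a n x \<partial>gauss_measure) = - (\<integral>x. G x $ i * (ct n x * u x) \<partial>gauss_measure)" for n
  proof -
    have g: "grad_at (\<lambda>x. ct n x * (u x * gdens x)) (ct n x *\<^sub>R (u x *\<^sub>R (- (gdens x *\<^sub>R x)) + gdens x *\<^sub>R grad u x) + (u x * gdens x) *\<^sub>R grad (ct n) x) x" for x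
      by (intro grad_at_mult smooth_grad_at sm u grad_at_gdens)
    have "partial_deriv i (\<lambda>x. ct n x * (u x * gdens x)) x = gdens x * (partial_deriv i (ct n) x * u x + ct n x * partial_deriv i u x - ct n x * (x $ i * u x))" for x
      unfolding grad_at_partial_deriv[OF g] by (simp add: grad_def algebra_simps)
    moreover have "test_function (\<lambda>x. ct n x * (u x * gdens x))"
      by (intro test_function_mult ct smooth_mult u smooth_gdens)
    ultimately have "(\<integral>x. f x * (gdens x * (partial_deriv i (ct n) x * u x + ct n x * partial_deriv i u x - ct n x * (x $ i * u x))) \<partial>lborel)
        = - (\<integral>x. G x $ i * (ct n x * (u x * gdens x)) \<partial>lborel)"
      using wg unfolding has_weak_gradient_def by (metis (no_types, lifting) Bochner_Integration.integral_cong)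
    moreover have "(\<lambda>x. ?a n x) \<in> borel_measurable borel" "(\<lambda>x. G x $ i * (ct n x * u x)) \<in> borel_measurable borel"
      by measurable
    note integral_gauss[OF this(1)] integral_gauss[OF this(2)]
    ultimately show ?thesis by (simp add: mult_ac)
  qed
  have "(\<lambda>n. \<integral>x. ?a n x \<partial>gauss_measure) \<longlonglongrightarrow> (\<integral>x. f x * (partial_deriv i u x - x $ i * u x) \<partial>gauss_measure)"
  proof (rule integral_dominated_convergence[where w = "\<lambda>x. (C * K + L) * f x + K * (f x * norm x)"])
    show "AE x in gauss_measure. (\<lambda>n. ?a n x) \<longlonglongrightarrow> f x * (partial_deriv i u x - x $ i * u x)"
    proof (rule AE_I2)
      fix x
      have "\<forall>\<^sub>F n in sequentially. ?a n x = f x * (partial_deriv i u x - x $ i * u x)"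
        using ct(4)[of x] ct(6)[of i x] by eventually_elim simp
      then show "(\<lambda>n. ?a n x) \<longlonglongrightarrow> f x * (partial_deriv i u x - x $ i * u x)" by (rule tendsto_eventually)
    qed
    show "AE x in gauss_measure. norm (?a n x) \<le> (C * K + L) * f x + K * (f x * norm x)" for n
    proof (rule AE_I2)
      fix x
      have 1: "\<bar>partial_deriv i (ct n) x * u x\<bar> \<le> C * K"
        unfolding abs_mult using ct(5) K C0 by (intro mult_mono) auto
      have 2: "\<bar>ct n x * partial_deriv i u x\<bar> \<le> 1 * L"
        unfolding abs_mult using ct(2,3) L by (intro mult_mono) auto
      have 3: "\<bar>ct n x * (x $ i * u x)\<bar> \<le> 1 * (norm x * K)"
        unfolding abs_mult using ct(2,3) K component_le_norm_cart[of x i] by (intro mult_mono) auto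
      have "\<bar>partial_deriv i (ct n) x * u x + ct n x * partial_deriv i u x - ct n x * (x $ i * u x)\<bar> \<le> C * K + L + norm x * K"
        using 1 2 3 by linarith
      then have "f x * \<bar>partial_deriv i (ct n) x * u x + ct n x * partial_deriv i u x - ct n x * (x $ i * u x)\<bar> \<le> f x * (C * K + L + norm x * K)"
        using f_nonneg by (rule mult_left_mono)
      also have "f x * (C * K + L + norm x * K) = (C * K + L) * f x + K * (f x * norm x)"
        by (simp add: algebra_simps)
      finally show "norm (?a n x) \<le> (C * K + L) * f x + K * (f x * norm x)"
        unfolding real_norm_def abs_mult using f_nonneg[of x] by simp
    qed
    show "integrable gauss_measure (\<lambda>x. (C * K + L) * f x + K * (f x * norm x))"
      using f_int f_int_norm by auto
  qed measurable
  moreover have "(\<lambda>n. - (\<integral>x. G x $ i * (ct n x * u x) \<partial>gauss_measure)) \<longlonglongrightarrow> - (\<integral>x. G x $ i * u x \<partial>gauss_measure)"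
  proof (intro tendsto_minus integral_dominated_convergence[where w = "\<lambda>x. K * \<bar>G x $ i\<bar>"])
    show "AE x in gauss_measure. (\<lambda>n. G x $ i * (ct n x * u x)) \<longlonglongrightarrow> G x $ i * u x"
    proof (rule AE_I2)
      fix x
      have "\<forall>\<^sub>F n in sequentially. G x $ i * (ct n x * u x) = G x $ i * u x"
        using ct(4)[of x] by eventually_elim simp
      then show "(\<lambda>n. G x $ i * (ct n x * u x)) \<longlonglongrightarrow> G x $ i * u x" by (rule tendsto_eventually)
    qed
    show "AE x in gauss_measure. norm (G x $ i * (ct n x * u x)) \<le> K * \<bar>G x $ i\<bar>" for n
    proof (rule AE_I2)
      fix x
      have "\<bar>ct n x\<bar> * \<bar>u x\<bar> \<le> 1 * K" using ct(2,3) K by (intro mult_mono) auto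
      then have "\<bar>ct n x\<bar> * \<bar>u x\<bar> * \<bar>G x $ i\<bar> \<le> 1 * K * \<bar>G x $ i\<bar>" by (rule mult_right_mono) simp
      then show "norm (G x $ i * (ct n x * u x)) \<le> K * \<bar>G x $ i\<bar>" by (simp add: abs_mult mult_ac)
    qed
    show "integrable gauss_measure (\<lambda>x. K * \<bar>G x $ i\<bar>)" using G_int by auto
  qed measurable
  ultimately have "(\<integral>x. f x * (partial_deriv i u x - x $ i * u x) \<partial>gauss_measure) = - (\<integral>x. G x $ i * u x \<partial>gauss_measure)"
    unfolding eq by (rule LIMSEQ_unique)
  moreover have "(\<integral>x. f x * (x $ i * u x - partial_deriv i u x) \<partial>gauss_measure) = - (\<integral>x. f x * (partial_deriv i u x - x $ i * u x) \<partial>gauss_measure)"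
    unfolding Bochner_Integration.integral_minus[symmetric] by (simp add: algebra_simps)
  ultimately show ?thesis by simp
qed

text \<open>For \<open>u = 1\<close> the integration by parts turns the mean of \<open>G\<close>
  into the barycentre of \<open>nu\<close>, so this is centering restated. It allows constants to be
  subtracted from \<open>U\<close> at no cost.\<close>

lemma G_mean: "(\<integral>x. G x $ i \<partial>gauss_measure) = 0"
  using weak_ibp[of "\<lambda>_. 1" 1 i 0] f_mean[of i] by simp

text \<open>The Poincare class is phrased with integrals that may be infinite. The bounds on
  \<open>u\<close> and on its gradient make both sides finite, so the inequality passes to real
  integrals.\<close>

lemma poincare_real:
  assumes u: "smooth u" and K: "\<And>x. \<bar>u x\<bar> \<le> K" and L: "\<And>x. (norm (grad u x))\<^sup>2 \<le> L"
    and m: "(\<integral>x. f x * u x \<partial>gauss_measure) = 0"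
  shows "lam * (\<integral>x. f x * (u x)\<^sup>2 \<partial>gauss_measure) \<le> (\<integral>x. f x * (norm (grad u x))\<^sup>2 \<partial>gauss_measure)"
proof -
  have um [measurable]: "u \<in> borel_measurable borel"
    using smooth_continuous[OF u] by (auto intro: borel_measurable_continuous_onI)
  have [measurable]: "grad u \<in> borel_measurable borel"
  proof -
    have "partial_deriv i u \<in> borel_measurable borel" for i
      using smooth_continuous[OF smooth_partial_deriv[OF u]] by (rule borel_measurable_continuous_onI)
    then show ?thesis unfolding grad_def[abs_def] by measurable
  qed
  have "integrable gauss_measure (\<lambda>x. f x * u x)" by (rule f_int_bounded[OF um K])
  then have "integrable nu u" "(\<integral>x. u x \<partial>nu) = 0" using m by (simp_all add: integrable_nu integral_nu)
  with u poinc have P: "ennreal lam * (\<integral>\<^sup>+x. ennreal ((u x)\<^sup>2) \<partial>nu) \<le> (\<integral>\<^sup>+x. ennreal ((norm (grad u x))\<^sup>2) \<partial>nu)"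
    unfolding poincare_class_def nu_def by blast
  have i1: "integrable nu (\<lambda>x. (u x)\<^sup>2)"
    unfolding integrable_nu[of "\<lambda>x. (u x)\<^sup>2", simplified]
    using power_mono[OF K abs_ge_zero, of _ 2] by (intro f_int_bounded[where K = "K\<^sup>2"]) auto
  have i2: "integrable nu (\<lambda>x. (norm (grad u x))\<^sup>2)"
    unfolding integrable_nu[of "\<lambda>x. (norm (grad u x))\<^sup>2", simplified]
    using L by (intro f_int_bounded[where K = L]) auto
  have "lam * (\<integral>x. (u x)\<^sup>2 \<partial>nu) \<le> (\<integral>x. (norm (grad u x))\<^sup>2 \<partial>nu)"
    using P lam by (simp add: nn_integral_eq_integral[OF i1] nn_integral_eq_integral[OF i2] ennreal_mult[symmetric])
  then show ?thesis by (simp add: integral_nu)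
qed

text \<open>Poincare's inequality for \<open>U\<close>, combined with the reverse inequality
  \<open>\<bar>\<nabla>U\<bar>\<^sup>2 \<le> t / (1 - t) * (T - U\<^sup>2)\<close> that follows from Bessel's inequality.\<close>

lemma variance_bound:
  fixes S :: "real^'n \<Rightarrow> real"
  assumes t: "0 < t" "t < 1" and Sm [measurable]: "S \<in> borel_measurable borel" and K: "\<And>x. \<bar>S x\<bar> \<le> K"
  defines "\<tau> \<equiv> sqrt (t * (1 - t))"
  defines "U \<equiv> gker S t \<tau> (\<lambda>_. 1)"
  defines "m \<equiv> (\<integral>x. f x * U x \<partial>gauss_measure)"
  shows "(\<integral>x. f x * (U x - m)\<^sup>2 \<partial>gauss_measure) \<le> t / (lam * (1 - t) + t) * (\<integral>x. f x * gker (\<lambda>y. (S y)\<^sup>2) t \<tau> (\<lambda>_. 1) x \<partial>gauss_measure)"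
proof -
  have \<tau>: "\<tau> > 0" using t by (simp add: \<tau>_def)
  have K0: "K \<ge> 0" using K[of 0] by linarith
  have Um [measurable]: "U \<in> borel_measurable borel" unfolding U_def by (rule gker_measurable[OF Sm K \<tau>])
  have UK: "\<bar>U x\<bar> \<le> K" for x unfolding U_def by (rule gker_one_bound[OF Sm K])
  have S2: "(\<lambda>y. (S y)\<^sup>2) \<in> borel_measurable borel" "\<And>y. \<bar>(S y)\<^sup>2\<bar> \<le> K\<^sup>2"
    using power_mono[OF K abs_ge_zero, of _ 2] by auto
  define T where "T = gker (\<lambda>y. (S y)\<^sup>2) t \<tau> (\<lambda>_. 1)"
  have Tm [measurable]: "T \<in> borel_measurable borel" unfolding T_def by (rule gker_measurable[OF S2 \<tau>])
  have TK: "\<bar>T x\<bar> \<le> K\<^sup>2" for x unfolding T_def by (rule gker_one_bound[OF S2])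
  have sm: "smooth (\<lambda>x. U x - m)"
    unfolding U_def by (intro smooth_diff_const gker_smooth[OF Sm K \<tau>])
  \<comment> \<open>This is the square of the factor \<open>t / \<tau>\<close> that
    \<open>gker_grad\<close> puts in front of each derivative of \<open>U\<close>.\<close>
  define r2 where "r2 = t / (1 - t)"
  have r2: "r2 > 0" using t by (simp add: r2_def)
  have tt: "(t / \<tau>)\<^sup>2 = r2"
    using t by (simp add: \<tau>_def r2_def power_divide power2_eq_square)
  have gr: "(norm (grad (\<lambda>x. U x - m) x))\<^sup>2 \<le> r2 * (T x - (U x)\<^sup>2)" for x
  proof -
    have "grad_at U (\<chi> j. t / \<tau> * gker S t \<tau> (herm j (\<lambda>_. 1)) x) x"
      unfolding U_def by (rule gker_grad[OF Sm K \<tau>])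
    then have "grad_at (\<lambda>x. U x - m) (\<chi> j. t / \<tau> * gker S t \<tau> (herm j (\<lambda>_. 1)) x) x"
      unfolding grad_at_def by (auto intro!: derivative_eq_intros)
    then have "grad (\<lambda>x. U x - m) x = (\<chi> j. t / \<tau> * gker S t \<tau> (herm j (\<lambda>_. 1)) x)"
      by (rule grad_at_grad)
    then have "(norm (grad (\<lambda>x. U x - m) x))\<^sup>2 = (\<Sum>j\<in>UNIV. (t / \<tau>)\<^sup>2 * (gker S t \<tau> (mono_p j) x)\<^sup>2)"
      by (simp add: norm_vec_square herm_one power_mult_distrib power_divide)
    also have "\<dots> = r2 * (\<Sum>j\<in>UNIV. (\<integral>z. S (t *\<^sub>R x + \<tau> *\<^sub>R z) * z $ j \<partial>gauss_measure)\<^sup>2)"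
      by (simp add: tt sum_distrib_left gker_def)
    also have "\<dots> \<le> r2 * ((\<integral>z. (S (t *\<^sub>R x + \<tau> *\<^sub>R z))\<^sup>2 \<partial>gauss_measure) - (\<integral>z. S (t *\<^sub>R x + \<tau> *\<^sub>R z) \<partial>gauss_measure)\<^sup>2)"
      using r2 K by (intro mult_left_mono gauss_bessel) auto
    finally show ?thesis by (simp add: T_def U_def gker_def)
  qed
  have grL: "(norm (grad (\<lambda>x. U x - m) x))\<^sup>2 \<le> r2 * K\<^sup>2" for x
  proof -
    have "T x - (U x)\<^sup>2 \<le> K\<^sup>2" using TK[of x] by (smt (verit) zero_le_power2)
    then show ?thesis using gr[of x] r2 by (smt (verit) mult_left_mono)
  qed
  have iU: "integrable gauss_measure (\<lambda>x. f x * U x)" by (rule f_int_bounded[OF Um UK])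
  have iU2: "integrable gauss_measure (\<lambda>x. f x * (U x)\<^sup>2)"
    using power_mono[OF UK abs_ge_zero, of _ 2] by (intro f_int_bounded[where K = "K\<^sup>2"]) auto
  have iT: "integrable gauss_measure (\<lambda>x. f x * T x)" by (rule f_int_bounded[OF Tm TK])
  have "(\<integral>x. f x * (U x - m) \<partial>gauss_measure) = 0"
    using iU f_int f_prob by (simp add: right_diff_distrib m_def mult.commute)
  moreover have "\<bar>U x - m\<bar> \<le> K + \<bar>m\<bar>" for x using UK[of x] by linarith
  ultimately have "lam * (\<integral>x. f x * (U x - m)\<^sup>2 \<partial>gauss_measure) \<le> (\<integral>x. f x * (norm (grad (\<lambda>x. U x - m) x))\<^sup>2 \<partial>gauss_measure)"
    by (intro poincare_real[where L = "r2 * K\<^sup>2"] sm grL)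
  also have "\<dots> \<le> (\<integral>x. r2 * (f x * T x) - r2 * (f x * (U x)\<^sup>2) \<partial>gauss_measure)"
  proof (rule integral_mono')
    show "integrable gauss_measure (\<lambda>x. r2 * (f x * T x) - r2 * (f x * (U x)\<^sup>2))" using iT iU2 by auto
    have *: "r2 * (f x * T x) - r2 * (f x * (U x)\<^sup>2) = f x * (r2 * (T x - (U x)\<^sup>2))" for x by (simp add: algebra_simps)
    show "f x * (norm (grad (\<lambda>x. U x - m) x))\<^sup>2 \<le> r2 * (f x * T x) - r2 * (f x * (U x)\<^sup>2)" for x
      unfolding * by (intro mult_left_mono gr f_nonneg)
    show "0 \<le> r2 * (f x * T x) - r2 * (f x * (U x)\<^sup>2)" for x
      unfolding * by (intro mult_nonneg_nonneg f_nonneg order_trans[OF zero_le_power2 gr])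
  qed
  also have "\<dots> = r2 * (\<integral>x. f x * T x \<partial>gauss_measure) - r2 * (\<integral>x. f x * (U x)\<^sup>2 \<partial>gauss_measure)"
    using iT iU2 by simp
  \<comment> \<open>Splitting the second moment into variance and squared mean lets the variance
    move to the left side, where the coefficient \<open>lam\<close> grows to
    \<open>lam + r2\<close>. The squared mean has the favourable sign and is dropped
    afterwards.\<close>
  also have "(\<integral>x. f x * (U x)\<^sup>2 \<partial>gauss_measure) = (\<integral>x. f x * (U x - m)\<^sup>2 \<partial>gauss_measure) + m\<^sup>2"
  proof -
    have "(\<integral>x. f x * (U x - m)\<^sup>2 \<partial>gauss_measure) = (\<integral>x. f x * (U x)\<^sup>2 - 2 * m * (f x * U x) + m\<^sup>2 * f x \<partial>gauss_measure)"
      by (simp add: power2_eq_square algebra_simps)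
    also have "\<dots> = (\<integral>x. f x * (U x)\<^sup>2 \<partial>gauss_measure) - 2 * m * m + m\<^sup>2"
      using iU iU2 f_int f_prob by (simp add: m_def)
    finally show ?thesis by (simp add: power2_eq_square)
  qed
  finally have "lam * (\<integral>x. f x * (U x - m)\<^sup>2 \<partial>gauss_measure)
      \<le> r2 * (\<integral>x. f x * T x \<partial>gauss_measure) - r2 * ((\<integral>x. f x * (U x - m)\<^sup>2 \<partial>gauss_measure) + m\<^sup>2)" .
  moreover have "r2 * m\<^sup>2 \<ge> 0" using r2 by simp
  ultimately have "(lam + r2) * (\<integral>x. f x * (U x - m)\<^sup>2 \<partial>gauss_measure) \<le> r2 * (\<integral>x. f x * T x \<partial>gauss_measure)"
    by (simp add: algebra_simps)
  then have "(\<integral>x. f x * (U x - m)\<^sup>2 \<partial>gauss_measure) \<le> r2 / (lam + r2) * (\<integral>x. f x * T x \<partial>gauss_measure)"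
    using lam r2 by (simp add: field_simps)
  moreover have "r2 / (lam + r2) = t / (lam * (1 - t) + t)"
  proof -
    have "lam * (1 - t) + t > 0" using lam t by (simp add: add_pos_pos)
    moreover have "lam + r2 = (lam * (1 - t) + t) / (1 - t)"
      using t by (simp add: r2_def add_divide_distrib)
    ultimately show ?thesis using t by (simp add: r2_def)
  qed
  ultimately show ?thesis by (simp add: T_def)
qed

text \<open>Integration by parts turns the first terms into integrals of
  \<open>G x $ i * U i x\<close>, from which \<open>m i\<close> may be subtracted. Young's
  inequality with weight \<rho> leaves the variances with coefficient
  \<open>1 / (2 * \<rho>)\<close>; by \<open>variance_bound\<close> they amount to at most half the
  sum of the \<open>B i\<close>, which the negative terms cancel.\<close>

lemma flow_derivative_bound:
  fixes S :: "'n \<Rightarrow> real^'n \<Rightarrow> real"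
  assumes t: "0 < t" "t < 1" and Sm: "\<And>i. S i \<in> borel_measurable borel" and K: "\<And>i x. \<bar>S i x\<bar> \<le> K"
  defines "\<tau> \<equiv> sqrt (t * (1 - t))"
  shows "(\<Sum>i\<in>UNIV. (\<integral>x. f x * (x $ i * gker (S i) t \<tau> (\<lambda>_. 1) x - t / \<tau> * gker (S i) t \<tau> (mono_p i) x) \<partial>gauss_measure)
      - 1 / 2 * (\<integral>x. f x * gker (\<lambda>y. (S i y)\<^sup>2) t \<tau> (\<lambda>_. 1) x \<partial>gauss_measure))
    \<le> t / (2 * (lam * (1 - t) + t)) * Fish"
proof -
  have \<tau>: "\<tau> > 0" using t by (simp add: \<tau>_def)
  define \<rho> where "\<rho> = t / (lam * (1 - t) + t)"
  have "lam * (1 - t) + t > 0" using lam t by (simp add: add_pos_pos)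
  then have \<rho>: "\<rho> > 0" using t by (simp add: \<rho>_def)
  define U where "U i = gker (S i) t \<tau> (\<lambda>_. 1)" for i
  define m where "m i = (\<integral>x. f x * U i x \<partial>gauss_measure)" for i
  define A where "A i = (\<integral>x. f x * (U i x - m i)\<^sup>2 \<partial>gauss_measure)" for i
  define B where "B i = (\<integral>x. f x * gker (\<lambda>y. (S i y)\<^sup>2) t \<tau> (\<lambda>_. 1) x \<partial>gauss_measure)" for i
  have Um [measurable]: "U i \<in> borel_measurable borel" for i unfolding U_def by (rule gker_measurable[OF Sm K \<tau>])
  have UK: "\<bar>U i x\<bar> \<le> K" for i x unfolding U_def by (rule gker_one_bound[OF Sm K])
  have AB: "A i \<le> \<rho> * B i" for i
    using variance_bound[OF t Sm K] by (simp add: A_def B_def \<rho>_def m_def U_def \<tau>_def)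
  have Geq: "(\<integral>x. f x * (x $ i * gker (S i) t \<tau> (\<lambda>_. 1) x - t / \<tau> * gker (S i) t \<tau> (mono_p i) x) \<partial>gauss_measure)
      = (\<integral>x. G x $ i * (U i x - m i) \<partial>gauss_measure)" for i
  proof -
    have sm: "smooth (U i)" unfolding U_def by (rule gker_smooth[OF Sm K \<tau>])
    have pd: "partial_deriv i (U i) x = t / \<tau> * gker (S i) t \<tau> (mono_p i) x" for x
      using grad_at_partial_deriv[OF gker_grad[OF Sm K \<tau>], of i i t "\<lambda>_. 1" x] by (simp add: U_def herm_one)
    have "\<bar>partial_deriv i (U i) x\<bar> \<le> t / \<tau> * (K * (\<integral>z. \<bar>mpoly (mono_p i) z\<bar> \<partial>(gauss_measure :: (real^'n) measure)))" for x
      unfolding pd abs_mult using gker_bound[OF Sm K, of i t \<tau> "mono_p i" x] t \<tau>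
      by (simp add: mult_left_mono divide_right_mono)
    from weak_ibp[OF sm UK this] have "(\<integral>x. f x * (x $ i * U i x - t / \<tau> * gker (S i) t \<tau> (mono_p i) x) \<partial>gauss_measure) = (\<integral>x. G x $ i * U i x \<partial>gauss_measure)"
      by (simp add: pd)
    moreover have "integrable gauss_measure (\<lambda>x. G x $ i * U i x)"
      using G_int UK by (intro integrable_mult_bounded[where K = K]) auto
    ultimately show ?thesis
      using G_int[of i] G_mean[of i] by (simp add: right_diff_distrib U_def)
  qed
  have "(\<Sum>i\<in>UNIV. \<integral>x. G x $ i * (U i x - m i) \<partial>gauss_measure) \<le> \<rho> / 2 * Fish + 1 / (2 * \<rho>) * (\<Sum>i\<in>UNIV. A i)"
  proof -
    have UK': "\<bar>U i x - m i\<bar> \<le> K + \<bar>m i\<bar>" for i x using UK[of i x] by linarith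
    have i1: "integrable gauss_measure (\<lambda>x. G x $ i * (U i x - m i))" for i
      using G_int by (rule integrable_mult_bounded[OF _ _ UK']) auto
    have i2: "integrable gauss_measure (\<lambda>x. f x * (U i x - m i)\<^sup>2)" for i
      using power_mono[OF UK' abs_ge_zero, of i _ 2] by (intro f_int_bounded[where K = "(K + \<bar>m i\<bar>)\<^sup>2"]) auto
    have "(\<Sum>i\<in>UNIV. \<integral>x. G x $ i * (U i x - m i) \<partial>gauss_measure) = (\<integral>x. (\<Sum>i\<in>UNIV. G x $ i * (U i x - m i)) \<partial>gauss_measure)"
      using i1 by simp
    also have "\<dots> \<le> (\<integral>x. \<rho> / 2 * dens x + 1 / (2 * \<rho>) * (\<Sum>i\<in>UNIV. f x * (U i x - m i)\<^sup>2) \<partial>gauss_measure)"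
    proof (rule integral_mono_AE)
      show "integrable gauss_measure (\<lambda>x. \<Sum>i\<in>UNIV. G x $ i * (U i x - m i))" using i1 by auto
      show "integrable gauss_measure (\<lambda>x. \<rho> / 2 * dens x + 1 / (2 * \<rho>) * (\<Sum>i\<in>UNIV. f x * (U i x - m i)\<^sup>2))"
        using i2 dens_int by (intro Bochner_Integration.integrable_add integrable_mult_right Bochner_Integration.integrable_sum) auto
      show "AE x in gauss_measure. (\<Sum>i\<in>UNIV. G x $ i * (U i x - m i)) \<le> \<rho> / 2 * dens x + 1 / (2 * \<rho>) * (\<Sum>i\<in>UNIV. f x * (U i x - m i)\<^sup>2)"
        using dens_young[OF \<rho>]
      proof eventually_elim
        case (elim x)
        show ?case by (rule elim[rule_format, of "\<lambda>i. U i x - m i"])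
      qed
    qed
    also have "\<dots> = \<rho> / 2 * Fish + 1 / (2 * \<rho>) * (\<Sum>i\<in>UNIV. A i)"
      using i2 dens_int
      by (subst Bochner_Integration.integral_add) (auto simp: A_def dens_Fish intro!: integrable_divide)
    finally show ?thesis .
  qed
  moreover have "1 / (2 * \<rho>) * (\<Sum>i\<in>UNIV. A i) \<le> 1 / 2 * (\<Sum>i\<in>UNIV. B i)"
  proof -
    have "(\<Sum>i\<in>UNIV. A i) \<le> \<rho> * (\<Sum>i\<in>UNIV. B i)"
      unfolding sum_distrib_left by (rule sum_mono) (rule AB)
    then show ?thesis using \<rho> by (simp add: field_simps)
  qed
  moreover have "(\<Sum>i\<in>UNIV. 1 / 2 * B i) = 1 / 2 * (\<Sum>i\<in>UNIV. B i)"
    by (simp only: sum_distrib_left)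
  moreover have "t / (2 * (lam * (1 - t) + t)) * Fish = \<rho> / 2 * Fish" by (simp add: \<rho>_def)
  ultimately show ?thesis
    unfolding B_def[symmetric] sum_subtractf Geq by linarith
qed

end

section \<open>The heat flow of a test weight\<close>

lemma grad_at_real: "grad_at h d t \<longleftrightarrow> (h has_real_derivative d) (at t)"
proof -
  have "(\<bullet>) d = (*) d" by (simp add: fun_eq_iff)
  then show ?thesis by (simp add: grad_at_def has_field_derivative_def)
qed

lemma grad_at_divide:
  assumes "grad_at h d x" "grad_at k e x" "k x \<noteq> 0"
  shows "grad_at (\<lambda>x. h x / k x) ((1 / k x) *\<^sub>R d - (h x / (k x)\<^sup>2) *\<^sub>R e) x"
  unfolding grad_at_def
  by (rule has_derivative_eq_rhs[OF has_derivative_divide'[OF assms[unfolded grad_at_def]]])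
     (use assms(3) in \<open>auto simp: fun_eq_iff inner_diff_left power2_eq_square divide_simps\<close>)

lemma grad_at_affine:
  assumes "grad_at h d (y + s *\<^sub>R z)"
  shows "grad_at (\<lambda>y. h (y + s *\<^sub>R z)) d y" "grad_at (\<lambda>z. h (y + s *\<^sub>R z)) (s *\<^sub>R d) z"
proof -
  show "grad_at (\<lambda>y. h (y + s *\<^sub>R z)) d y"
    unfolding grad_at_def
    by (rule has_derivative_compose[of "\<lambda>y. y + s *\<^sub>R z" "\<lambda>k. k", OF _ assms[unfolded grad_at_def]])
       (auto intro!: derivative_eq_intros)
  have "((\<lambda>z. h (y + s *\<^sub>R z)) has_derivative (\<lambda>k. d \<bullet> (s *\<^sub>R k))) (at z)"
    by (rule has_derivative_compose[of "\<lambda>z. y + s *\<^sub>R z" "\<lambda>k. s *\<^sub>R k", OF _ assms[unfolded grad_at_def]])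
       (auto intro!: derivative_eq_intros)
  moreover have "(\<lambda>k. d \<bullet> (s *\<^sub>R k)) = (\<bullet>) (s *\<^sub>R d)" by (simp add: fun_eq_iff)
  ultimately show "grad_at (\<lambda>z. h (y + s *\<^sub>R z)) (s *\<^sub>R d) z" by (simp add: grad_at_def)
qed

text \<open>The bounds on \<open>g\<close> and on two orders of derivatives keep \<open>ln v\<close>
  bounded and make the integrands of the flow grow at most linearly, so every limit below is
  dominated. \<open>ddg i\<close> is the \<open>i\<close>-th row of the Hessian.\<close>

locale smooth_weight =
  fixes g :: "real^'n \<Rightarrow> real" and dg :: "real^'n \<Rightarrow> real^'n" and ddg :: "'n \<Rightarrow> real^'n \<Rightarrow> real^'n"
    and m M K :: real
  assumes m: "m > 0" and g_ge: "m \<le> g x" and g_le: "g x \<le> M"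
    and g_grad: "grad_at g (dg x) x" and dg_grad: "grad_at (\<lambda>x. dg x $ i) (ddg i x) x"
    and dg_bound: "norm (dg x) \<le> K" and ddg_bound: "norm (ddg i x) \<le> K"
    and ddg_meas [measurable]: "ddg i \<in> borel_measurable borel"
begin

lemma g_cont: "continuous_on UNIV g" using g_grad by (rule grad_at_continuous)
lemma g_meas [measurable]: "g \<in> borel_measurable borel"
  using g_cont by (rule borel_measurable_continuous_onI)
lemma dg_meas [measurable]: "dg \<in> borel_measurable borel"
proof -
  have "(\<lambda>x. dg x $ i) \<in> borel_measurable borel" for i
    using grad_at_continuous[OF dg_grad] by (rule borel_measurable_continuous_onI)
  then have "(\<lambda>x. \<chi> i. dg x $ i) \<in> borel_measurable borel" by (rule borel_measurable_vec_lambda)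
  then show ?thesis by simp
qed

lemma g_abs: "\<bar>g x\<bar> \<le> M" using m g_ge[of x] g_le[of x] by linarith
lemma K_nonneg: "K \<ge> 0" using dg_bound[of 0] norm_ge_zero order_trans by blast

text \<open>The heat semigroup, indexed by the standard deviation \<open>s\<close> of the noise
  instead of time. \<open>J\<close> is its gradient and \<open>Q\<close> its Hessian, with all
  derivatives falling on \<open>g\<close>.\<close>

definition "v s y = (\<integral>z. g (y + s *\<^sub>R z) \<partial>gauss_measure)"
definition "J s y = (\<integral>z. dg (y + s *\<^sub>R z) \<partial>gauss_measure)"
definition "Q s y i = (\<integral>z. ddg i (y + s *\<^sub>R z) \<partial>gauss_measure)"

lemma g_int: "integrable gauss_measure (\<lambda>z. g (y + s *\<^sub>R z))"
  using g_abs by (intro integrable_gauss_bounded[where K = M]) auto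

lemma dg_int: "integrable gauss_measure (\<lambda>z. dg (y + s *\<^sub>R z))"
  using dg_bound by (intro integrable_gauss_bounded[where K = K]) auto

lemma v_bounds: "m \<le> v s y" "v s y \<le> M"
proof -
  interpret prob_space "gauss_measure :: (real^'n) measure" by (rule prob_space_gauss)
  show "m \<le> v s y" unfolding v_def using g_int g_ge by (intro integral_ge_const) auto
  show "v s y \<le> M" unfolding v_def using g_int g_le by (intro integral_le_const) auto
qed

lemma v_pos: "v s y > 0" using v_bounds[of s y] m by linarith

lemma v_grad: "grad_at (v s) (J s y) y"
proof -
  interpret prob_space "gauss_measure :: (real^'n) measure" by (rule prob_space_gauss)
  show ?thesis
    unfolding v_def[abs_def] J_def
    by (rule grad_at_integral[where e = 1 and B = "\<lambda>_. K", THEN conjunct1])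
       (auto intro!: grad_at_affine g_grad g_int dg_bound)
qed

lemma J_grad: "grad_at (\<lambda>y. J s y $ i) (Q s y i) y"
proof -
  interpret prob_space "gauss_measure :: (real^'n) measure" by (rule prob_space_gauss)
  have "J s y $ i = (\<integral>z. dg (y + s *\<^sub>R z) $ i \<partial>gauss_measure)" for y
    unfolding J_def by (rule integral_vec_nth[OF dg_int])
  moreover have "integrable gauss_measure (\<lambda>z. dg (y + s *\<^sub>R z) $ i)" for y
    by (rule integrable_bounded_linear[OF bounded_linear_vec_nth dg_int])
  ultimately show ?thesis
    unfolding Q_def
    by (auto intro!: grad_at_integral[where e = 1 and B = "\<lambda>_. K", THEN conjunct1]
        grad_at_affine[where h = "\<lambda>x. dg x $ i"] dg_grad ddg_bound)
qed

lemma J_bound: "norm (J s y) \<le> K"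
proof -
  interpret prob_space "gauss_measure :: (real^'n) measure" by (rule prob_space_gauss)
  have "norm (J s y) \<le> (\<integral>z. norm (dg (y + s *\<^sub>R z)) \<partial>gauss_measure)"
    unfolding J_def by (rule integral_norm_bound)
  also have "\<dots> \<le> K" using dg_int dg_bound by (intro integral_le_const) auto
  finally show ?thesis .
qed

lemma Q_int: "integrable gauss_measure (\<lambda>z. ddg i (y + s *\<^sub>R z))"
  using ddg_bound by (intro integrable_gauss_bounded[where K = K]) auto

lemma Q_bound: "norm (Q s y i) \<le> K"
proof -
  interpret prob_space "gauss_measure :: (real^'n) measure" by (rule prob_space_gauss)
  have "norm (Q s y i) \<le> (\<integral>z. norm (ddg i (y + s *\<^sub>R z)) \<partial>gauss_measure)"
    unfolding Q_def by (rule integral_norm_bound)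
  also have "\<dots> \<le> K" using Q_int ddg_bound by (intro integral_le_const) auto
  finally show ?thesis .
qed

lemma v_meas [measurable]: "v s \<in> borel_measurable borel"
  using grad_at_continuous[OF v_grad] by (rule borel_measurable_continuous_onI)

lemma J_nth_meas [measurable]: "(\<lambda>y. J s y $ i) \<in> borel_measurable borel"
  using grad_at_continuous[OF J_grad] by (rule borel_measurable_continuous_onI)

lemma J_meas [measurable]: "J s \<in> borel_measurable borel"
proof -
  have "(\<lambda>x. \<chi> i. J s x $ i) \<in> borel_measurable borel" by (rule borel_measurable_vec_lambda) measurable
  then show ?thesis by simp
qed

lemma Q_meas [measurable]: "(\<lambda>y. Q s y i) \<in> borel_measurable borel"
proof -
  interpret prob_space "gauss_measure :: (real^'n) measure" by (rule prob_space_gauss)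
  have "(\<lambda>p. ddg i (fst p + s *\<^sub>R snd p)) \<in> borel_measurable (borel \<Otimes>\<^sub>M gauss_measure)"
    by measurable
  then show ?thesis unfolding Q_def by (intro borel_measurable_lebesgue_integral) (simp add: case_prod_beta')
qed

lemma nth_bound: "\<bar>J s y $ i\<bar> \<le> K" "\<bar>Q s y i $ j\<bar> \<le> K"
  using component_le_norm_cart[of "J s y" i] J_bound[of s y] component_le_norm_cart[of "Q s y i" j] Q_bound[of s y i]
  by linarith+

text \<open>Stein's lemma trades the noise coordinate \<open>z $ i\<close> for a second derivative;
  the factor \<open>s\<close> comes from the chain rule.\<close>

lemma dg_stein: "(\<integral>z. dg (y + s *\<^sub>R z) $ i * z $ i \<partial>gauss_measure) = s * Q s y i $ i"
proof -
  have "(\<integral>z. dg (y + s *\<^sub>R z) $ i * z $ i \<partial>gauss_measure) = (\<integral>z. (s *\<^sub>R ddg i (y + s *\<^sub>R z)) $ i \<partial>gauss_measure)"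
  proof (rule gauss_stein)
    show "grad_at (\<lambda>z. dg (y + s *\<^sub>R z) $ i) (s *\<^sub>R ddg i (y + s *\<^sub>R z)) z" for z
      by (rule grad_at_affine(2)[where h = "\<lambda>x. dg x $ i"]) (rule dg_grad)
    show "\<bar>dg (y + s *\<^sub>R z) $ i\<bar> \<le> K" for z
      using component_le_norm_cart order_trans dg_bound by blast
    show "norm (s *\<^sub>R ddg i (y + s *\<^sub>R z)) \<le> \<bar>s\<bar> * K" for z
      using ddg_bound by (simp add: mult_left_mono)
  qed measurable
  then show ?thesis
    using integral_vec_nth[OF Q_int, of i y s i] by (simp add: Q_def)
qed

definition "Lap s y = (\<Sum>i\<in>UNIV. Q s y i $ i)"

text \<open>The Laplacian term comes from Stein's lemma applied to the time derivative of \<open>sqrt (1 - t)\<close>.\<close>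

lemma v_curve_deriv:
  fixes Y Y' :: "real \<Rightarrow> real^'n"
  assumes \<delta>: "\<delta> > 0" and Y: "\<And>t. \<bar>t - t0\<bar> < \<delta> \<Longrightarrow> (Y has_vector_derivative Y' t) (at t)"
    and t1: "\<And>t. \<bar>t - t0\<bar> < \<delta> \<Longrightarrow> t < 1"
    and Cy: "\<And>t. \<bar>t - t0\<bar> < \<delta> \<Longrightarrow> norm (Y' t) \<le> C"
    and Cs: "\<And>t. \<bar>t - t0\<bar> < \<delta> \<Longrightarrow> 1 / (2 * sqrt (1 - t)) \<le> C"
  shows "((\<lambda>t. v (sqrt (1 - t)) (Y t)) has_real_derivative
    J (sqrt (1 - t0)) (Y t0) \<bullet> Y' t0 - Lap (sqrt (1 - t0)) (Y t0) / 2) (at t0)"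
proof -
  interpret prob_space "gauss_measure :: (real^'n) measure" by (rule prob_space_gauss)
  define d where "d t z = dg (Y t + sqrt (1 - t) *\<^sub>R z) \<bullet> (Y' t - (1 / (2 * sqrt (1 - t))) *\<^sub>R z)" for t z
  have "grad_at (\<lambda>t. v (sqrt (1 - t)) (Y t)) (\<integral>z. d t0 z \<partial>gauss_measure) t0"
    unfolding v_def
  proof (rule grad_at_integral[where e = \<delta> and B = "\<lambda>z. K * (C + C * norm z)", THEN conjunct1])
    fix t and z :: "real^'n" assume "dist t t0 < \<delta>"
    then have t: "\<bar>t - t0\<bar> < \<delta>" by (simp add: dist_real_def)
    have s: "sqrt (1 - t) > 0" using t1[OF t] by simp
    have "((\<lambda>t. sqrt (1 - t)) has_real_derivative - (1 / (2 * sqrt (1 - t)))) (at t)"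
      using t1[OF t] by (auto intro!: derivative_eq_intros simp: field_simps)
    then have "((\<lambda>t. sqrt (1 - t) *\<^sub>R z) has_vector_derivative (- (1 / (2 * sqrt (1 - t)))) *\<^sub>R z) (at t)"
      unfolding has_real_derivative_iff_has_vector_derivative
      by (rule bounded_linear.has_vector_derivative[OF bounded_linear_scaleR_left])
    from has_vector_derivative_add[OF Y[OF t] this]
    have "((\<lambda>t. Y t + sqrt (1 - t) *\<^sub>R z) has_vector_derivative Y' t - (1 / (2 * sqrt (1 - t))) *\<^sub>R z) (at t)"
      by simp
    then have "((\<lambda>t. g (Y t + sqrt (1 - t) *\<^sub>R z)) has_derivative (\<lambda>h. dg (Y t + sqrt (1 - t) *\<^sub>R z) \<bullet> (h *\<^sub>R (Y' t - (1 / (2 * sqrt (1 - t))) *\<^sub>R z)))) (at t)"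
      unfolding has_vector_derivative_def
      by (rule has_derivative_compose[OF _ g_grad[unfolded grad_at_def]])
    moreover have "(\<lambda>h. dg (Y t + sqrt (1 - t) *\<^sub>R z) \<bullet> (h *\<^sub>R (Y' t - (1 / (2 * sqrt (1 - t))) *\<^sub>R z))) = (\<bullet>) (d t z)"
      by (simp add: fun_eq_iff d_def mult.commute)
    ultimately show "grad_at (\<lambda>t. g (Y t + sqrt (1 - t) *\<^sub>R z)) (d t z) t"
      by (simp add: grad_at_def)
    have "norm (Y' t - (1 / (2 * sqrt (1 - t))) *\<^sub>R z) \<le> norm (Y' t) + 1 / (2 * sqrt (1 - t)) * norm z"
      using norm_triangle_ineq4[of "Y' t" "(1 / (2 * sqrt (1 - t))) *\<^sub>R z"] s by simp
    also have "\<dots> \<le> C + C * norm z"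
      using Cy[OF t] Cs[OF t] by (intro add_mono mult_right_mono) auto
    finally have "norm (dg (Y t + sqrt (1 - t) *\<^sub>R z)) * norm (Y' t - (1 / (2 * sqrt (1 - t))) *\<^sub>R z) \<le> K * (C + C * norm z)"
      using dg_bound K_nonneg by (intro mult_mono) auto
    then show "norm (d t z) \<le> K * (C + C * norm z)"
      unfolding d_def real_norm_def by (rule order_trans[OF Cauchy_Schwarz_ineq2])
  next
    show "integrable gauss_measure (\<lambda>z::real^'n. K * (C + C * norm z))"
      using gauss_integrable_norm by auto
    show "d t0 \<in> borel_measurable gauss_measure" unfolding d_def by measurable
  qed (use \<delta> g_int in auto)
  moreover have "(\<integral>z. d t0 z \<partial>gauss_measure) = J (sqrt (1 - t0)) (Y t0) \<bullet> Y' t0 - Lap (sqrt (1 - t0)) (Y t0) / 2"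
  proof -
    define s where "s = sqrt (1 - t0)"
    have s: "s > 0" using t1[of t0] \<delta> by (simp add: s_def)
    have i1: "integrable gauss_measure (\<lambda>z. dg (Y t0 + s *\<^sub>R z) \<bullet> Y' t0)"
      using dg_int by (rule integrable_inner_left[rotated])
    have "\<bar>dg (Y t0 + s *\<^sub>R z) $ i\<bar> \<le> K" for z i
      using component_le_norm_cart order_trans dg_bound by blast
    then have i2: "integrable gauss_measure (\<lambda>z. dg (Y t0 + s *\<^sub>R z) $ i * z $ i)" for i
      using gauss_integrable_nth by (intro integrable_gauss_bounded_mult[where K = K]) auto
    have "(\<integral>z. d t0 z \<partial>gauss_measure) = (\<integral>z. dg (Y t0 + s *\<^sub>R z) \<bullet> Y' t0 - 1 / (2 * s) * (\<Sum>i\<in>UNIV. dg (Y t0 + s *\<^sub>R z) $ i * z $ i) \<partial>gauss_measure)"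
    proof (rule Bochner_Integration.integral_cong[OF refl])
      fix z
      have "dg (Y t0 + s *\<^sub>R z) \<bullet> z = (\<Sum>i\<in>UNIV. dg (Y t0 + s *\<^sub>R z) $ i * z $ i)"
        by (simp add: inner_vec_def)
      then show "d t0 z = dg (Y t0 + s *\<^sub>R z) \<bullet> Y' t0 - 1 / (2 * s) * (\<Sum>i\<in>UNIV. dg (Y t0 + s *\<^sub>R z) $ i * z $ i)"
        by (simp add: d_def s_def inner_diff_right)
    qed
    \<comment> \<open>Stein's lemma returns a factor \<open>s\<close>, which cancels the singular
      \<open>1 / (2 * s)\<close> and leaves half of the Laplacian.\<close>
    also have "\<dots> = J s (Y t0) \<bullet> Y' t0 - 1 / (2 * s) * (\<Sum>i\<in>UNIV. s * Q s (Y t0) i $ i)"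
      using i1 i2 dg_int by (simp add: J_def dg_stein)
    also have "\<dots> = J s (Y t0) \<bullet> Y' t0 - Lap s (Y t0) / 2"
      using s by (simp add: Lap_def sum_distrib_left[symmetric])
    finally show ?thesis by (simp add: s_def)
  qed
  ultimately show ?thesis by (simp add: grad_at_real)
qed

text \<open>This includes noise level \<open>s0 = 0\<close>, and so covers the end of the flow,
  where \<open>sqrt (1 - t)\<close> has no derivative.\<close>

lemma v_curve_cont:
  fixes Y :: "nat \<Rightarrow> real^'n"
  assumes "Y \<longlonglongrightarrow> y" "s \<longlonglongrightarrow> s0"
  shows "(\<lambda>n. v (s n) (Y n)) \<longlonglongrightarrow> v s0 y"
proof -
  interpret prob_space "gauss_measure :: (real^'n) measure" by (rule prob_space_gauss)
  show ?thesis
    unfolding v_def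
  proof (rule integral_dominated_convergence[where w = "\<lambda>_. M"])
    show "AE z in gauss_measure. (\<lambda>n. g (Y n + s n *\<^sub>R z)) \<longlonglongrightarrow> g (y + s0 *\<^sub>R z)"
    proof (rule AE_I2)
      fix z
      have "isCont g (y + s0 *\<^sub>R z)" using g_cont by (simp add: continuous_on_eq_continuous_at)
      moreover have "(\<lambda>n. Y n + s n *\<^sub>R z) \<longlonglongrightarrow> y + s0 *\<^sub>R z" by (intro tendsto_intros assms)
      ultimately show "(\<lambda>n. g (Y n + s n *\<^sub>R z)) \<longlonglongrightarrow> g (y + s0 *\<^sub>R z)" by (rule isCont_tendsto_compose)
    qed
  qed (use g_abs in auto)
qed

text \<open>\<open>S s\<close> is the gradient of \<open>ln (v s)\<close>.\<close>

definition "S s i y = J s y $ i / v s y"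

lemma S_meas [measurable]: "S s i \<in> borel_measurable borel"
  unfolding S_def by measurable

lemma S_bound: "\<bar>S s i y\<bar> \<le> K / m"
  unfolding S_def abs_divide using nth_bound(1)[of s y i] v_bounds[of s y] m K_nonneg
  by (intro frac_le) auto

text \<open>As \<open>S s i\<close> is a logarithmic derivative, its own \<open>i\<close>-th partial
  derivative is \<open>Q / v\<close> minus the square of \<open>S\<close>, and Stein's lemma
  integrates this. In the flow the identity expresses the Laplacian term through \<open>S\<close>
  alone.\<close>

lemma S_stein:
  "(\<integral>z. S s i (x + \<tau> *\<^sub>R z) * z $ i \<partial>gauss_measure)
    = \<tau> * ((\<integral>z. Q s (x + \<tau> *\<^sub>R z) i $ i / v s (x + \<tau> *\<^sub>R z) \<partial>gauss_measure) - (\<integral>z. (S s i (x + \<tau> *\<^sub>R z))\<^sup>2 \<partial>gauss_measure))"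
proof -
  define dS where "dS y = (1 / v s y) *\<^sub>R Q s y i - (J s y $ i / (v s y)\<^sup>2) *\<^sub>R J s y" for y
  have dSm [measurable]: "dS \<in> borel_measurable borel" unfolding dS_def by measurable
  have g: "grad_at (S s i) (dS y) y" for y
    unfolding S_def[abs_def] dS_def using v_pos[of s y] by (intro grad_at_divide J_grad v_grad) auto
  have dSb: "norm (dS y) \<le> K / m + (K / m) * (K / m)" for y
  proof -
    have 1: "norm ((1 / v s y) *\<^sub>R Q s y i) \<le> K / m"
      using frac_le[OF _ Q_bound[of s y i] m v_bounds(1)[of s y]] v_pos[of s y] K_nonneg by simp
    have "norm ((J s y $ i / (v s y)\<^sup>2) *\<^sub>R J s y) = \<bar>S s i y\<bar> * (norm (J s y) / v s y)"
      using v_pos[of s y] by (simp add: S_def power2_eq_square abs_mult)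
    also have "\<dots> \<le> (K / m) * (K / m)"
      using frac_le[OF _ J_bound[of s y] m v_bounds(1)[of s y]] v_pos[of s y] K_nonneg S_bound m
      by (intro mult_mono) auto
    finally show ?thesis
      using 1 norm_triangle_ineq4[of "(1 / v s y) *\<^sub>R Q s y i" "(J s y $ i / (v s y)\<^sup>2) *\<^sub>R J s y"]
      unfolding dS_def by linarith
  qed
  have "(\<integral>z. S s i (x + \<tau> *\<^sub>R z) * z $ i \<partial>gauss_measure) = (\<integral>z. (\<tau> *\<^sub>R dS (x + \<tau> *\<^sub>R z)) $ i \<partial>gauss_measure)"
  proof (rule gauss_stein)
    show "grad_at (\<lambda>z. S s i (x + \<tau> *\<^sub>R z)) (\<tau> *\<^sub>R dS (x + \<tau> *\<^sub>R z)) z" for z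
      by (rule grad_at_affine(2)) (rule g)
    show "\<bar>S s i (x + \<tau> *\<^sub>R z)\<bar> \<le> K / m" for z by (rule S_bound)
    show "norm (\<tau> *\<^sub>R dS (x + \<tau> *\<^sub>R z)) \<le> \<bar>\<tau>\<bar> * (K / m + (K / m) * (K / m))" for z
      using mult_left_mono[OF dSb abs_ge_zero] by simp
  qed measurable
  also have "\<dots> = (\<integral>z. \<tau> * (Q s (x + \<tau> *\<^sub>R z) i $ i / v s (x + \<tau> *\<^sub>R z) - (S s i (x + \<tau> *\<^sub>R z))\<^sup>2) \<partial>gauss_measure)"
    by (simp add: dS_def S_def power2_eq_square)
  also have "\<dots> = \<tau> * ((\<integral>z. Q s (x + \<tau> *\<^sub>R z) i $ i / v s (x + \<tau> *\<^sub>R z) \<partial>gauss_measure) - (\<integral>z. (S s i (x + \<tau> *\<^sub>R z))\<^sup>2 \<partial>gauss_measure))"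
  proof -
    have "integrable gauss_measure (\<lambda>z. Q s (x + \<tau> *\<^sub>R z) i $ i / v s (x + \<tau> *\<^sub>R z))"
    proof (rule integrable_gauss_bounded[where K = "K / m"])
      show "norm (Q s (x + \<tau> *\<^sub>R z) i $ i / v s (x + \<tau> *\<^sub>R z)) \<le> K / m" for z
        unfolding real_norm_def abs_divide using nth_bound(2) v_bounds(1) v_pos K_nonneg m
        by (intro frac_le) (auto intro: order_trans[OF v_bounds(1) abs_ge_self])
    qed measurable
    moreover have "integrable gauss_measure (\<lambda>z. (S s i (x + \<tau> *\<^sub>R z))\<^sup>2)"
      using power_mono[OF S_bound abs_ge_zero, of _ _ _ 2] by (intro integrable_gauss_bounded[where K = "(K / m)\<^sup>2"]) auto
    ultimately show ?thesis by simp
  qed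
  finally show ?thesis .
qed

end

context regular_density
begin

section \<open>The flow functional on the product space\<close>

lemma prob_nu: "prob_space nu" using prob by (simp add: nu_def)

lemma pair_nu_gauss: "pair_prob_space nu (gauss_measure :: (real^'n) measure)"
  unfolding pair_prob_space_def pair_sigma_finite_def
  using prob_nu prob_space_gauss by (auto intro: prob_space_imp_sigma_finite)

lemma sets_pair [measurable_cong]: "sets (nu \<Otimes>\<^sub>M (gauss_measure :: (real^'n) measure)) = sets (borel \<Otimes>\<^sub>M borel)"
  by (intro sets_pair_measure_cong) simp_all

lemma integrable_pair_fst:
  "h \<in> borel_measurable borel \<Longrightarrow> integrable nu h \<Longrightarrow> integrable (nu \<Otimes>\<^sub>M (gauss_measure :: (real^'n) measure)) (\<lambda>p. h (fst p))" for h :: "real^'n \<Rightarrow> real"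
proof -
  assume h: "h \<in> borel_measurable borel" "integrable nu h"
  interpret pair_prob_space nu "gauss_measure :: (real^'n) measure" by (rule pair_nu_gauss)
  have "distr (nu \<Otimes>\<^sub>M (gauss_measure :: (real^'n) measure)) nu fst = nu"
    using prob_space_gauss by (rule prob_space.distr_pair_fst)
  with h have "integrable (distr (nu \<Otimes>\<^sub>M (gauss_measure :: (real^'n) measure)) nu fst) h" by simp
  from integrable_distr[OF measurable_fst this] show ?thesis .
qed

lemma integrable_pair_snd:
  "h \<in> borel_measurable borel \<Longrightarrow> integrable gauss_measure h \<Longrightarrow> integrable (nu \<Otimes>\<^sub>M (gauss_measure :: (real^'n) measure)) (\<lambda>p. h (snd p))" for h :: "real^'n \<Rightarrow> real"
proof -
  assume h: "h \<in> borel_measurable borel" "integrable gauss_measure h"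
  interpret pair_prob_space nu "gauss_measure :: (real^'n) measure" by (rule pair_nu_gauss)
  interpret sw: pair_prob_space "gauss_measure :: (real^'n) measure" nu
    unfolding pair_prob_space_def pair_sigma_finite_def
    using prob_nu prob_space_gauss by (auto intro: prob_space_imp_sigma_finite)
  have "distr (gauss_measure \<Otimes>\<^sub>M nu) (gauss_measure :: (real^'n) measure) fst = gauss_measure"
    using prob_nu by (rule prob_space.distr_pair_fst)
  with h have "integrable (distr (gauss_measure \<Otimes>\<^sub>M nu) (gauss_measure :: (real^'n) measure) fst) h" by simp
  from integrable_distr[OF measurable_fst this] have "integrable (gauss_measure \<Otimes>\<^sub>M nu) (\<lambda>p. h (fst p))" .
  from sw.integrable_product_swap[OF this] show ?thesis
    by (simp add: case_prod_beta')
qed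

lemma pair_measurable:
  fixes h :: "real^'n \<Rightarrow> 'c::{second_countable_topology, topological_space}"
  assumes "h \<in> borel_measurable borel"
  shows "(\<lambda>p. h (a *\<^sub>R fst p + b *\<^sub>R snd p)) \<in> borel_measurable (nu \<Otimes>\<^sub>M (gauss_measure :: (real^'n) measure))"
proof (rule measurable_compose[OF _ assms])
  show "(\<lambda>p. a *\<^sub>R fst p + b *\<^sub>R snd p) \<in> borel_measurable (nu \<Otimes>\<^sub>M (gauss_measure :: (real^'n) measure))"
    by measurable
qed

text \<open>\<open>\<Lambda> - Fish * R\<close> is nonincreasing, where \<open>R\<close> is a
  primitive of the bound on the derivative of \<Lambda>. Differentiation is confined to the open
  interval because \<open>sqrt (t * (1 - t))\<close> has infinite slope at both ends; the end points
  are reached by continuity.\<close>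

lemma flow_bound:
  assumes sw: "smooth_weight g dg ddg m M K"
  shows "(\<integral>x. f x * ln (g x) \<partial>gauss_measure) - ln (\<integral>x. g x \<partial>gauss_measure) \<le> Fish * (c_const lam / 2)"
proof -
  interpret smooth_weight g dg ddg m M K by (rule sw)
  interpret pair_prob_space nu "gauss_measure :: (real^'n) measure" by (rule pair_nu_gauss)
  let ?P = "nu \<Otimes>\<^sub>M (gauss_measure :: (real^'n) measure)"
  define \<tau> where "\<tau> t = sqrt (t * (1 - t))" for t :: real
  \<comment> \<open>\<kappa> is the derivative of \<tau>, so that \<open>Y'\<close> is the velocity
    of the curve \<open>Y\<close>.\<close>
  define \<kappa> where "\<kappa> t = (1 - 2 * t) / (2 * \<tau> t)" for t :: real
  define \<sigma> where "\<sigma> t = sqrt (1 - t)" for t :: real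
  define Y where "Y p t = t *\<^sub>R fst p + \<tau> t *\<^sub>R snd p" for p :: "(real^'n) \<times> (real^'n)" and t
  define Y' where "Y' p t = fst p + \<kappa> t *\<^sub>R snd p" for p :: "(real^'n) \<times> (real^'n)" and t
  define \<Lambda> where "\<Lambda> t = (\<integral>p. ln (v (\<sigma> t) (Y p t)) \<partial>?P)" for t
  define D where "D t p = (J (\<sigma> t) (Y p t) \<bullet> Y' p t - Lap (\<sigma> t) (Y p t) / 2) / v (\<sigma> t) (Y p t)" for t p
  have M: "M > 0" using m g_ge[of 0] g_le[of 0] by linarith
  define KL where "KL = \<bar>ln m\<bar> + \<bar>ln M\<bar>"
  have lnb: "\<bar>ln (v s y)\<bar> \<le> KL" for s y
  proof -
    have "ln m \<le> ln (v s y)" "ln (v s y) \<le> ln M"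
      using v_bounds[of s y] m v_pos[of s y] M by simp_all
    then show ?thesis unfolding KL_def by linarith
  qed
  have Lap_bound: "\<bar>Lap s y\<bar> \<le> real CARD('n) * K" for s y
  proof -
    have "\<bar>Lap s y\<bar> \<le> (\<Sum>i\<in>(UNIV::'n set). K)"
      unfolding Lap_def using nth_bound(2) by (intro order_trans[OF sum_abs] sum_mono)
    then show ?thesis by simp
  qed
  have Lap_meas [measurable]: "Lap s \<in> borel_measurable borel" for s
    unfolding Lap_def by measurable
  have lnm: "(\<lambda>p. ln (v s (Y p t))) \<in> borel_measurable ?P" for s t
    unfolding Y_def by (rule pair_measurable[of "\<lambda>y. ln (v s y)"]) measurable
  have ln_int: "integrable ?P (\<lambda>p. ln (v s (Y p t)))" for s t
    using lnm lnb by (intro integrable_const_bound[where B = KL]) auto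
  have Dm: "D t \<in> borel_measurable ?P" for t
  proof -
    have [measurable]: "(\<lambda>p. J (\<sigma> t) (Y p t)) \<in> borel_measurable ?P" "(\<lambda>p. Lap (\<sigma> t) (Y p t)) \<in> borel_measurable ?P"
      "(\<lambda>p. v (\<sigma> t) (Y p t)) \<in> borel_measurable ?P"
      unfolding Y_def by (rule pair_measurable; measurable)+
    show ?thesis unfolding D_def Y'_def by measurable
  qed
  have deriv: "(\<Lambda> has_real_derivative (\<integral>p. D t0 p \<partial>?P)) (at t0) \<and> integrable ?P (D t0)" if t0: "0 < t0" "t0 < 1" for t0
  proof -
    \<comment> \<open>Half the distance to the end points: on the whole window \<open>t\<close> and
      \<open>1 - t\<close> stay above \<delta>, hence so does \<tau>, and \<kappa> is bounded by
      \<open>1 / (2 * \<delta>)\<close>.\<close>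
    define \<delta> where "\<delta> = min t0 (1 - t0) / 2"
    have \<delta>: "\<delta> > 0" using t0 by (simp add: \<delta>_def)
    have near: "\<delta> < t" "\<delta> < 1 - t" if "\<bar>t - t0\<bar> < \<delta>" for t
    proof -
      have "\<delta> \<le> t0 / 2" "\<delta> \<le> (1 - t0) / 2" by (auto simp: \<delta>_def field_simps)
      moreover have "t - t0 < \<delta>" "t0 - t < \<delta>" using that by auto
      ultimately have "\<delta> < t \<and> \<delta> < 1 - t" by argo
      then show "\<delta> < t" "\<delta> < 1 - t" by auto
    qed
    have \<tau>\<delta>: "\<tau> t \<ge> \<delta>" if "\<bar>t - t0\<bar> < \<delta>" for t
    proof -
      have "\<delta> * \<delta> \<le> t * (1 - t)" using near[OF that] \<delta> by (intro mult_mono) auto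
      then show ?thesis unfolding \<tau>_def using \<delta> by (simp add: real_le_rsqrt power2_eq_square)
    qed
    have \<kappa>\<delta>: "\<bar>\<kappa> t\<bar> \<le> 1 / (2 * \<delta>)" if "\<bar>t - t0\<bar> < \<delta>" for t
      unfolding \<kappa>_def abs_divide using near[OF that] \<tau>\<delta>[OF that] \<delta> by (intro frac_le) auto
    have s\<delta>: "1 / (2 * sqrt (1 - t)) \<le> 1 / (2 * \<delta>)" if "\<bar>t - t0\<bar> < \<delta>" for t
    proof -
      have "\<delta> \<le> sqrt (1 - t)"
      proof (rule real_le_rsqrt)
        have "\<delta>\<^sup>2 \<le> \<delta> * 1" unfolding power2_eq_square using \<delta> t0 by (intro mult_left_mono) (auto simp: \<delta>_def)
        then show "\<delta>\<^sup>2 \<le> 1 - t" using near[OF that] by simp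
      qed
      then show ?thesis using \<delta> by (intro frac_le) auto
    qed
    have Yd: "(Y p has_vector_derivative Y' p t) (at t)" if "\<bar>t - t0\<bar> < \<delta>" for p t
    proof -
      have "t * (1 - t) > 0" using near[OF that] \<delta> by simp
      then have "(\<tau> has_real_derivative \<kappa> t) (at t)"
        unfolding \<tau>_def[abs_def] \<kappa>_def by (auto intro!: derivative_eq_intros simp: field_simps)
      then have "((\<lambda>t. \<tau> t *\<^sub>R snd p) has_vector_derivative \<kappa> t *\<^sub>R snd p) (at t)"
        unfolding has_real_derivative_iff_has_vector_derivative
        by (rule bounded_linear.has_vector_derivative[OF bounded_linear_scaleR_left])
      moreover have "((\<lambda>t. t *\<^sub>R fst p) has_vector_derivative 1 *\<^sub>R fst p) (at t)"
        by (rule bounded_linear.has_vector_derivative[OF bounded_linear_scaleR_left has_vector_derivative_id])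
      ultimately show ?thesis
        unfolding Y_def[abs_def] Y'_def using has_vector_derivative_add by fastforce
    qed
    have Y'b: "norm (Y' p t) \<le> norm (fst p) + 1 / (2 * \<delta>) * norm (snd p)" if "\<bar>t - t0\<bar> < \<delta>" for p t
      unfolding Y'_def using norm_triangle_ineq[of "fst p" "\<kappa> t *\<^sub>R snd p"] mult_right_mono[OF \<kappa>\<delta>[OF that] norm_ge_zero[of "snd p"]]
      by simp
    \<comment> \<open>The differentiation rule wants a window around \<open>t\<close> itself;
      \<open>\<delta> - \<bar>t - t0\<bar>\<close> is what remains of the window around
      \<open>t0\<close>.\<close>
    have vd: "((\<lambda>t. v (\<sigma> t) (Y p t)) has_real_derivative
        J (\<sigma> t) (Y p t) \<bullet> Y' p t - Lap (\<sigma> t) (Y p t) / 2) (at t)" if t: "\<bar>t - t0\<bar> < \<delta>" for p t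
      unfolding \<sigma>_def
    proof (rule v_curve_deriv[where \<delta> = "\<delta> - \<bar>t - t0\<bar>" and C = "norm (fst p) + 1 / (2 * \<delta>) * norm (snd p) + 1 / (2 * \<delta>)"])
      fix t' assume "\<bar>t' - t\<bar> < \<delta> - \<bar>t - t0\<bar>"
      then have t': "\<bar>t' - t0\<bar> < \<delta>" by linarith
      show "(Y p has_vector_derivative Y' p t') (at t')" by (rule Yd[OF t'])
      show "t' < 1" using near[OF t'] \<delta> by linarith
      show "norm (Y' p t') \<le> norm (fst p) + 1 / (2 * \<delta>) * norm (snd p) + 1 / (2 * \<delta>)"
        using Y'b[OF t', of p] \<delta> by (smt (verit) divide_nonneg_nonneg)
      show "1 / (2 * sqrt (1 - t')) \<le> norm (fst p) + 1 / (2 * \<delta>) * norm (snd p) + 1 / (2 * \<delta>)"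
        using s\<delta>[OF t'] \<delta> by (smt (verit) divide_nonneg_nonneg mult_nonneg_nonneg norm_ge_zero)
    qed (use t in simp)
    define C where "C = 1 / (2 * \<delta>)"
    have C: "C > 0" using \<delta> by (simp add: C_def)
    \<comment> \<open>The dominating function is linear in the norms of both components, and
      \<open>nu\<close> and the Gaussian measure have finite first moments.\<close>
    have "grad_at \<Lambda> (\<integral>p. D t0 p \<partial>?P) t0 \<and> integrable ?P (D t0)"
      unfolding \<Lambda>_def[abs_def]
    proof (rule grad_at_integral[where e = \<delta> and B = "\<lambda>p. (K * (norm (fst p) + C * norm (snd p)) + real CARD('n) * K / 2) / m"])
      fix t p assume "dist t t0 < \<delta>"
      then have t: "\<bar>t - t0\<bar> < \<delta>" by (simp add: dist_real_def)
      show "grad_at (\<lambda>t. ln (v (\<sigma> t) (Y p t))) (D t p) t"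
        unfolding grad_at_real D_def divide_inverse
        using DERIV_chain2[OF DERIV_ln[OF v_pos] vd[OF t, of p]] by (simp add: mult.commute)
      have "\<bar>J (\<sigma> t) (Y p t) \<bullet> Y' p t\<bar> \<le> norm (J (\<sigma> t) (Y p t)) * norm (Y' p t)" by (rule Cauchy_Schwarz_ineq2)
      also have "\<dots> \<le> K * (norm (fst p) + C * norm (snd p))"
        using Y'b[OF t, of p] J_bound K_nonneg unfolding C_def by (intro mult_mono) auto
      finally have num: "\<bar>J (\<sigma> t) (Y p t) \<bullet> Y' p t - Lap (\<sigma> t) (Y p t) / 2\<bar> \<le> K * (norm (fst p) + C * norm (snd p)) + real CARD('n) * K / 2"
        using Lap_bound[of "\<sigma> t" "Y p t"] by linarith
      show "norm (D t p) \<le> (K * (norm (fst p) + C * norm (snd p)) + real CARD('n) * K / 2) / m"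
        unfolding D_def real_norm_def abs_divide
        by (rule frac_le[OF order_trans[OF abs_ge_zero num] num m order_trans[OF v_bounds(1) abs_ge_self]])
    next
      have i1: "integrable ?P (\<lambda>p. norm (fst p))"
        using f_int_norm by (intro integrable_pair_fst) (auto simp: integrable_nu)
      have i2: "integrable ?P (\<lambda>p. norm (snd p))"
        using gauss_integrable_norm by (intro integrable_pair_snd) auto
      show "integrable ?P (\<lambda>p. (K * (norm (fst p) + C * norm (snd p)) + real CARD('n) * K / 2) / m)"
        using i1 i2 by (intro integrable_divide Bochner_Integration.integrable_add integrable_mult_right integrable_const)
    qed (use \<delta> ln_int Dm in auto)
    then show ?thesis by (simp add: grad_at_real)
  qed
  have Dbound: "(\<integral>p. D t p \<partial>?P) \<le> t / (2 * (lam * (1 - t) + t)) * Fish" if t: "0 < t" "t < 1" for t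
  proof -
    have \<tau>t: "\<tau> t > 0" using t by (simp add: \<tau>_def)
    define s where "s = \<sigma> t"
    have Sm: "S s i \<in> borel_measurable borel" for i by (rule S_meas)
    have S2: "(\<lambda>y. (S s i y)\<^sup>2) \<in> borel_measurable borel" "\<And>y. \<bar>(S s i y)\<^sup>2\<bar> \<le> (K / m)\<^sup>2" for i
      using power_mono[OF S_bound abs_ge_zero, of s i _ 2] by auto
    define U where "U i = gker (S s i) t (\<tau> t) (\<lambda>_. 1)" for i
    define V where "V i = gker (S s i) t (\<tau> t) (mono_p i)" for i
    define T where "T i = gker (\<lambda>y. (S s i y)\<^sup>2) t (\<tau> t) (\<lambda>_. 1)" for i
    \<comment> \<open>Integrating over the noise first turns everything into kernel transforms. As
      \<open>t / \<tau> t * V i\<close> is the \<open>i\<close>-th partial derivative of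
      \<open>U i\<close>, the right side is of the form that integration by parts handles.\<close>
    have inner: "(\<integral>z. D t (x, z) \<partial>gauss_measure) = (\<Sum>i\<in>UNIV. x $ i * U i x - t / \<tau> t * V i x - 1 / 2 * T i x)" for x
    proof -
      let ?y = "\<lambda>z. t *\<^sub>R x + \<tau> t *\<^sub>R z"
      define q where "q i z = Q s (?y z) i $ i / v s (?y z)" for i z
      have D: "D t (x, z) = (\<Sum>i\<in>UNIV. x $ i * S s i (?y z) + \<kappa> t * (S s i (?y z) * z $ i) - 1 / 2 * q i z)" for z
        unfolding q_def D_def Y_def Y'_def s_def[symmetric] Lap_def S_def
        by (simp add: inner_vec_def sum_divide_distrib sum.distrib sum_subtractf diff_divide_distrib add_divide_distrib algebra_simps)
      have iS: "integrable gauss_measure (\<lambda>z. S s i (?y z))" for i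
        using S_bound by (intro integrable_gauss_bounded[where K = "K / m"]) auto
      have iSz: "integrable gauss_measure (\<lambda>z. S s i (?y z) * z $ i)" for i
        using S_bound gauss_integrable_nth by (intro integrable_gauss_bounded_mult[where K = "K / m"]) auto
      have iQ: "integrable gauss_measure (q i)" for i
        unfolding q_def[abs_def]
      proof (rule integrable_gauss_bounded[where K = "K / m"])
        show "norm (Q s (?y z) i $ i / v s (?y z)) \<le> K / m" for z
          unfolding real_norm_def abs_divide
          by (rule frac_le[OF K_nonneg nth_bound(2) m order_trans[OF v_bounds(1) abs_ge_self]])
      qed measurable
      have V: "V i x = \<tau> t * ((\<integral>z. q i z \<partial>gauss_measure) - T i x)" for i
        using S_stein[of s i "t *\<^sub>R x" "\<tau> t"] by (simp add: V_def T_def gker_def q_def)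
      have "(\<integral>z. D t (x, z) \<partial>gauss_measure) = (\<Sum>i\<in>UNIV. x $ i * U i x + \<kappa> t * V i x - 1 / 2 * (\<integral>z. q i z \<partial>gauss_measure))"
        unfolding D using iS iSz iQ by (simp add: U_def V_def gker_def)
      also have "\<dots> = (\<Sum>i\<in>UNIV. x $ i * U i x - t / \<tau> t * V i x - 1 / 2 * T i x)"
      proof (rule sum.cong[OF refl])
        fix i
        have gen: "u + a - 1 / 2 * (b + w) = u - c - 1 / 2 * w" if "a - 1 / 2 * b = - c" for u a b c w :: real
          using that by (simp add: algebra_simps)
        have e1: "(\<integral>z. q i z \<partial>gauss_measure) = V i x / \<tau> t + T i x"
          using V[of i] \<tau>t by simp
        \<comment> \<open>The moving noise and the Laplacian combine: \<open>(1 - 2 * t) / (2 *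
          \<tau> t) - 1 / (2 * \<tau> t) = - t / \<tau> t\<close>.\<close>
        have e2: "\<kappa> t * V i x - 1 / 2 * (V i x / \<tau> t) = - (t / \<tau> t * V i x)"
          using \<tau>t by (simp add: \<kappa>_def field_simps)
        show "x $ i * U i x + \<kappa> t * V i x - 1 / 2 * (\<integral>z. q i z \<partial>gauss_measure)
            = x $ i * U i x - t / \<tau> t * V i x - 1 / 2 * T i x"
          unfolding e1 by (rule gen[OF e2])
      qed
      finally show ?thesis .
    qed
    have mU [measurable]: "U i \<in> borel_measurable borel" "V i \<in> borel_measurable borel" "T i \<in> borel_measurable borel" for i
      unfolding U_def V_def T_def by (rule gker_measurable[OF Sm S_bound \<tau>t] gker_measurable[OF S2 \<tau>t])+
    have bU: "\<bar>U i x\<bar> \<le> K / m" and bT: "\<bar>T i x\<bar> \<le> (K / m)\<^sup>2" for i x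
      unfolding U_def T_def by (rule gker_one_bound[OF Sm S_bound] gker_one_bound[OF S2])+
    have iU: "integrable gauss_measure (\<lambda>x. f x * (x $ i * U i x))" for i
      using integrable_mult_bounded[OF f_int_nth[of i] _ bU[of i]] by (simp add: mult.assoc)
    have iV: "integrable gauss_measure (\<lambda>x. f x * V i x)" for i
      by (rule f_int_bounded[OF mU(2)]) (unfold V_def, rule gker_bound[OF Sm S_bound])
    have iT: "integrable gauss_measure (\<lambda>x. f x * T i x)" for i
      by (rule f_int_bounded[OF _ bT]) measurable
    have "(\<integral>p. D t p \<partial>?P) = (\<integral>x. \<integral>z. D t (x, z) \<partial>gauss_measure \<partial>nu)"
      using integral_fst'[of "D t"] deriv[OF t] by simp
    also have "\<dots> = (\<integral>x. f x * (\<Sum>i\<in>UNIV. x $ i * U i x - t / \<tau> t * V i x - 1 / 2 * T i x) \<partial>gauss_measure)"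
      unfolding inner by (rule integral_nu) measurable
    also have "\<dots> = (\<integral>x. (\<Sum>i\<in>UNIV. (f x * (x $ i * U i x) - t / \<tau> t * (f x * V i x)) - 1 / 2 * (f x * T i x)) \<partial>gauss_measure)"
      by (simp add: sum_distrib_left algebra_simps)
    also have "\<dots> = (\<Sum>i\<in>UNIV. (\<integral>x. f x * (x $ i * U i x) - t / \<tau> t * (f x * V i x) \<partial>gauss_measure) - 1 / 2 * (\<integral>x. f x * T i x \<partial>gauss_measure))"
      using iU iV iT by simp
    also have "\<dots> = (\<Sum>i\<in>UNIV. (\<integral>x. f x * (x $ i * U i x - t / \<tau> t * V i x) \<partial>gauss_measure) - 1 / 2 * (\<integral>x. f x * T i x \<partial>gauss_measure))"
      by (simp add: right_diff_distrib mult.left_commute)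
    also have "\<dots> \<le> t / (2 * (lam * (1 - t) + t)) * Fish"
      using flow_derivative_bound[of t "S s", OF t Sm S_bound] by (simp add: U_def V_def T_def \<tau>_def)
    finally show ?thesis .
  qed
  have cont: "continuous_on {0..1} \<Lambda>"
  proof (rule continuous_on_sequentiallyI)
    fix u a assume u: "\<forall>n. u n \<in> {0..1::real}" "a \<in> {0..1}" "u \<longlonglongrightarrow> a"
    show "(\<lambda>n. \<Lambda> (u n)) \<longlonglongrightarrow> \<Lambda> a"
      unfolding \<Lambda>_def
    proof (rule integral_dominated_convergence[where w = "\<lambda>_. KL"])
      show "AE p in ?P. (\<lambda>n. ln (v (\<sigma> (u n)) (Y p (u n)))) \<longlonglongrightarrow> ln (v (\<sigma> a) (Y p a))"
      proof (rule AE_I2)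
        fix p
        have "(\<lambda>n. v (\<sigma> (u n)) (Y p (u n))) \<longlonglongrightarrow> v (\<sigma> a) (Y p a)"
          unfolding \<sigma>_def Y_def \<tau>_def by (intro v_curve_cont tendsto_intros u)
        then show "(\<lambda>n. ln (v (\<sigma> (u n)) (Y p (u n)))) \<longlonglongrightarrow> ln (v (\<sigma> a) (Y p a))"
          using v_pos[of "\<sigma> a" "Y p a"] by (intro tendsto_ln) auto
      qed
    qed (use lnm lnb in auto)
  qed
  have \<Lambda>1: "\<Lambda> 1 = (\<integral>x. f x * ln (g x) \<partial>gauss_measure)"
  proof -
    have v0: "v 0 y = g y" for y
      using prob_space.prob_space[OF prob_space_gauss[where 'n = 'n]] by (simp add: v_def)
    have "\<Lambda> 1 = (\<integral>p. ln (g (fst p)) \<partial>?P)" by (simp add: \<Lambda>_def Y_def \<sigma>_def \<tau>_def v0)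
    also have "\<dots> = (\<integral>x. \<integral>z. ln (g x) \<partial>(gauss_measure :: (real^'n) measure) \<partial>nu)"
      using integral_fst'[of "\<lambda>p. ln (g (fst p))"] ln_int[of 0 1] by (simp add: Y_def \<tau>_def v0)
    also have "\<dots> = (\<integral>x. ln (g x) \<partial>nu)"
      using prob_space.prob_space[OF prob_space_gauss[where 'n = 'n]] by simp
    also have "\<dots> = (\<integral>x. f x * ln (g x) \<partial>gauss_measure)"
      by (rule integral_nu) measurable
    finally show ?thesis .
  qed
  \<comment> \<open>At time \<open>0\<close> the curve sits at the origin for every pair, and the
    noise has full variance, so the integrand is constant.\<close>
  have \<Lambda>0: "\<Lambda> 0 = ln (\<integral>x. g x \<partial>gauss_measure)"
    using prob_space by (simp add: \<Lambda>_def Y_def \<sigma>_def \<tau>_def v_def)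
  \<comment> \<open>A primitive of \<open>t / (2 * (lam * (1 - t) + t))\<close>. The logarithmic
    form divides by \<open>1 - lam\<close>, hence the same case distinction as in
    \<open>c_const\<close>.\<close>
  define R where "R t = (if lam = 1 then t\<^sup>2 / 4 else (t / (1 - lam) - lam / (1 - lam)\<^sup>2 * ln (lam * (1 - t) + t)) / 2)" for t
  have pos: "lam * (1 - t) + t > 0" if "0 \<le> t" "t \<le> 1" for t
  proof (cases "t = 0")
    case False
    then show ?thesis using lam that by (intro add_nonneg_pos) auto
  qed (use lam in simp)
  have Rd: "(R has_real_derivative t / (2 * (lam * (1 - t) + t))) (at t)" if t: "0 \<le> t" "t \<le> 1" for t
  proof (cases "lam = 1")
    case True
    then show ?thesis unfolding R_def[abs_def] by (auto intro!: derivative_eq_intros)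
  next
    case False
    have "((\<lambda>t. (t / (1 - lam) - lam / (1 - lam)\<^sup>2 * ln (lam * (1 - t) + t)) / 2) has_real_derivative
        (1 / (1 - lam) - lam / (1 - lam)\<^sup>2 * ((1 - lam) / (lam * (1 - t) + t))) / 2) (at t)"
    proof -
      have "((\<lambda>t. lam * (1 - t) + t) has_real_derivative 1 - lam) (at t)"
        by (auto intro!: derivative_eq_intros)
      from DERIV_chain2[OF DERIV_ln[OF pos[OF t]] this]
      have "((\<lambda>t. ln (lam * (1 - t) + t)) has_real_derivative (1 - lam) / (lam * (1 - t) + t)) (at t)"
        by (simp add: divide_inverse mult.commute)
      then show ?thesis by (intro DERIV_cdivide DERIV_diff DERIV_cmult DERIV_ident)
    qed
    moreover have "(1 / (1 - lam) - lam / (1 - lam)\<^sup>2 * ((1 - lam) / (lam * (1 - t) + t))) / 2 = t / (2 * (lam * (1 - t) + t))"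
    proof -
      define X where "X = lam * (1 - t) + t"
      have X: "X > 0" "X - lam = (1 - lam) * t" using pos[OF t] by (auto simp: X_def algebra_simps)
      have "1 / (1 - lam) - lam / (1 - lam)\<^sup>2 * ((1 - lam) / X) = (X - lam) / ((1 - lam) * X)"
        using False X(1) by (simp add: power2_eq_square divide_simps)
      also have "\<dots> = t / X" using False X by simp
      finally show ?thesis by (simp add: X_def)
    qed
    ultimately have "((\<lambda>t. (t / (1 - lam) - lam / (1 - lam)\<^sup>2 * ln (lam * (1 - t) + t)) / 2) has_real_derivative
        t / (2 * (lam * (1 - t) + t))) (at t)" by (simp only:)
    moreover have "R = (\<lambda>t. (t / (1 - lam) - lam / (1 - lam)\<^sup>2 * ln (lam * (1 - t) + t)) / 2)"
      using False by (simp add: R_def fun_eq_iff)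
    ultimately show ?thesis by (simp only:)
  qed
  have Rdiff: "R 1 - R 0 = c_const lam / 2"
  proof (cases "lam = 1")
    case False
    then show ?thesis
      by (simp add: R_def c_const_def power2_eq_square divide_simps) (simp add: algebra_simps)
  qed (simp add: R_def c_const_def)
  have "\<Lambda> 1 - Fish * R 1 \<le> \<Lambda> 0 - Fish * R 0"
  proof (rule DERIV_nonpos_imp_decreasing_open[where f = "\<lambda>t. \<Lambda> t - Fish * R t"])
    fix t :: real assume t: "0 < t" "t < 1"
    have "((\<lambda>t. \<Lambda> t - Fish * R t) has_real_derivative (\<integral>p. D t p \<partial>?P) - Fish * (t / (2 * (lam * (1 - t) + t)))) (at t)"
      using deriv[OF t] Rd[of t] t by (intro DERIV_diff DERIV_cmult) auto
    moreover have "(\<integral>p. D t p \<partial>?P) - Fish * (t / (2 * (lam * (1 - t) + t))) \<le> 0"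
      using Dbound[OF t] by (simp add: mult.commute)
    ultimately show "\<exists>y. ((\<lambda>t. \<Lambda> t - Fish * R t) has_real_derivative y) (at t) \<and> y \<le> 0" by blast
  next
    have "continuous_on {0..1} R"
      using Rd by (intro continuous_at_imp_continuous_on ballI) (auto intro: DERIV_isCont)
    then show "continuous_on {0..1} (\<lambda>t. \<Lambda> t - Fish * R t)"
      by (intro continuous_intros cont)
  qed simp
  then have "\<Lambda> 1 - \<Lambda> 0 \<le> Fish * (R 1 - R 0)" by (simp add: algebra_simps)
  then show ?thesis by (simp add: \<Lambda>1 \<Lambda>0 Rdiff)
qed

end

section \<open>Entropy, Fisher information and total variation\<close>

text \<open>Averaging preserves the bounds \<open>m\<close> and \<open>M\<close>, and the
  derivatives fall on the kernel. The single constant \<open>K\<close> is the sum of the bounds for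
  all first and second derivatives.\<close>

lemma gker_smooth_weight:
  fixes h :: "real^'n \<Rightarrow> real"
  assumes h [measurable]: "h \<in> borel_measurable borel" and m: "m > 0" "\<And>x. m \<le> h x" "\<And>x. h x \<le> M" and \<epsilon>: "\<epsilon> > 0"
  shows "\<exists>dg ddg K. smooth_weight (gker h 1 \<epsilon> (\<lambda>_. 1)) dg ddg m M K"
proof -
  interpret prob_space "gauss_measure :: (real^'n) measure" by (rule prob_space_gauss)
  have hM: "\<bar>h x\<bar> \<le> M" for x using m(1) m(2,3)[of x] by linarith
  have M0: "M \<ge> 0" using hM[of 0] by linarith
  define dg where "dg x = (\<chi> i. 1 / \<epsilon> * gker h 1 \<epsilon> (herm i (\<lambda>_. 1)) x)" for x
  define ddg where "ddg i x = (1 / \<epsilon>) *\<^sub>R (\<chi> j. 1 / \<epsilon> * gker h 1 \<epsilon> (herm j (herm i (\<lambda>_. 1))) x)" for i x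
  define A where "A p = M * (\<integral>z. \<bar>mpoly p z\<bar> \<partial>(gauss_measure :: (real^'n) measure))" for p
  have A: "\<bar>gker h 1 \<epsilon> p x\<bar> \<le> A p" for p x unfolding A_def by (rule gker_bound[OF h hM])
  have A0: "A p \<ge> 0" for p using M0 by (simp add: A_def)
  define K1 where "K1 = (\<Sum>i\<in>(UNIV::'n set). 1 / \<epsilon> * A (herm i (\<lambda>_. 1)))"
  define K2 where "K2 i = 1 / \<epsilon> * (\<Sum>j\<in>(UNIV::'n set). 1 / \<epsilon> * A (herm j (herm i (\<lambda>_. 1))))" for i :: 'n
  have K0: "K1 \<ge> 0" "K2 i \<ge> 0" for i using A0 \<epsilon> by (simp_all add: K1_def K2_def sum_nonneg)
  have int: "integrable gauss_measure (\<lambda>z. h (1 *\<^sub>R x + \<epsilon> *\<^sub>R z) * mpoly (\<lambda>_. 1) z)" for x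
    by (rule gker_integrable[OF h hM])
  have "smooth_weight (gker h 1 \<epsilon> (\<lambda>_. 1)) dg ddg m M (K1 + (\<Sum>i\<in>UNIV. K2 i))"
  proof
    show "m > 0" by (rule m(1))
    show "m \<le> gker h 1 \<epsilon> (\<lambda>_. 1) x" "gker h 1 \<epsilon> (\<lambda>_. 1) x \<le> M" for x
      unfolding gker_def using int[of x] m by (auto intro!: integral_ge_const integral_le_const)
    show "grad_at (gker h 1 \<epsilon> (\<lambda>_. 1)) (dg x) x" for x
      unfolding dg_def by (rule gker_grad[OF h hM \<epsilon>])
    show "grad_at (\<lambda>x. dg x $ i) (ddg i x) x" for i x
      unfolding dg_def ddg_def vec_lambda_beta by (intro grad_at_cmult gker_grad[OF h hM \<epsilon>])
    show "norm (dg x) \<le> K1 + (\<Sum>i\<in>UNIV. K2 i)" for x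
    proof -
      have "norm (dg x) \<le> (\<Sum>i\<in>UNIV. \<bar>dg x $ i\<bar>)" by (rule norm_le_l1_cart)
      also have "\<dots> \<le> K1"
        unfolding K1_def
      proof (rule sum_mono)
        fix i
        show "\<bar>dg x $ i\<bar> \<le> 1 / \<epsilon> * A (herm i (\<lambda>_. 1))"
          using A[of "herm i (\<lambda>_. 1)" x] \<epsilon> by (simp add: dg_def divide_right_mono)
      qed
      finally show ?thesis using sum_nonneg[of UNIV K2] K0 by simp
    qed
    show "norm (ddg i x) \<le> K1 + (\<Sum>i\<in>UNIV. K2 i)" for i x
    proof -
      have "norm (ddg i x) \<le> 1 / \<epsilon> * (\<Sum>j\<in>UNIV. \<bar>1 / \<epsilon> * gker h 1 \<epsilon> (herm j (herm i (\<lambda>_. 1))) x\<bar>)"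
        unfolding ddg_def norm_scaleR using \<epsilon> norm_le_l1_cart[of "\<chi> j. 1 / \<epsilon> * gker h 1 \<epsilon> (herm j (herm i (\<lambda>_. 1))) x"]
        by (simp add: divide_right_mono)
      also have "\<dots> \<le> K2 i"
        unfolding K2_def
      proof (intro mult_left_mono sum_mono)
        fix j
        show "\<bar>1 / \<epsilon> * gker h 1 \<epsilon> (herm j (herm i (\<lambda>_. 1))) x\<bar> \<le> 1 / \<epsilon> * A (herm j (herm i (\<lambda>_. 1)))"
          using A[of "herm j (herm i (\<lambda>_. 1))" x] \<epsilon> by (simp add: divide_right_mono)
      qed (use \<epsilon> in simp)
      also have "\<dots> \<le> (\<Sum>i\<in>UNIV. K2 i)" using K0 by (intro member_le_sum) auto
      finally show ?thesis using K0 by simp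
    qed
    show "ddg i \<in> borel_measurable borel" for i
    proof -
      have [measurable]: "gker h 1 \<epsilon> p \<in> borel_measurable borel" for p by (rule gker_measurable[OF h hM \<epsilon>])
      show ?thesis unfolding ddg_def by measurable
    qed
  qed
  then show ?thesis by blast
qed

context regular_density
begin

text \<open>The mollification acts on \<open>exp w\<close> rather than on \<open>w\<close>: each
  \<open>g n\<close> is then a smooth weight between \<open>exp (- N)\<close> and
  \<open>exp N\<close>, and its logarithm converges to \<open>w\<close> at every point.\<close>

lemma exp_bound_continuous:
  assumes w: "continuous_on UNIV w" "\<And>x. \<bar>w x\<bar> \<le> N"
  shows "(\<integral>x. f x * w x \<partial>gauss_measure) - ln (\<integral>x. exp (w x) \<partial>gauss_measure) \<le> Fish * (c_const lam / 2)"
proof -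
  interpret prob_space "gauss_measure :: (real^'n) measure" by (rule prob_space_gauss)
  define h where "h x = exp (w x)" for x
  have hc: "continuous_on UNIV h" unfolding h_def using w(1) by (intro continuous_intros)
  have hm [measurable]: "h \<in> borel_measurable borel" using hc by (rule borel_measurable_continuous_onI)
  have hb: "exp (- N) \<le> h x" "h x \<le> exp N" for x using w(2)[of x] by (auto simp: h_def abs_le_iff)
  have habs: "\<bar>h x\<bar> \<le> exp N" for x using hb(2)[of x] by (simp add: h_def)
  define g where "g n = gker h 1 (1 / real (Suc n)) (\<lambda>_. 1)" for n
  have "\<exists>dg ddg K. smooth_weight (g n) dg ddg (exp (- N)) (exp N) K" for n
    unfolding g_def using hb by (intro gker_smooth_weight) auto
  then obtain dg ddg K where sw: "\<And>n. smooth_weight (g n) (dg n) (ddg n) (exp (- N)) (exp N) (K n)" by metis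
  have gm [measurable]: "g n \<in> borel_measurable borel" for n using smooth_weight.g_meas[OF sw] .
  have gb: "exp (- N) \<le> g n x" "g n x \<le> exp N" for n x
    using smooth_weight.g_ge[OF sw] smooth_weight.g_le[OF sw] by blast+
  have gpos: "g n x > 0" for n x using gb(1)[of n x] exp_gt_zero less_le_trans by blast
  have lng: "\<bar>ln (g n x)\<bar> \<le> N" for n x
  proof -
    have "ln (exp (- N)) \<le> ln (g n x)" "ln (g n x) \<le> ln (exp N)"
      using gb[of n x] gpos[of n x] by (simp_all del: ln_exp)
    then show ?thesis by simp
  qed
  have gl: "(\<lambda>n. g n x) \<longlonglongrightarrow> h x" for x unfolding g_def using hc habs by (rule gker_tendsto)
  have hpos: "h x > 0" for x by (simp add: h_def)
  have 1: "(\<lambda>n. \<integral>x. f x * ln (g n x) \<partial>gauss_measure) \<longlonglongrightarrow> (\<integral>x. f x * w x \<partial>gauss_measure)"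
  proof (rule integral_dominated_convergence[where w = "\<lambda>x. f x * N"])
    show "AE x in gauss_measure. (\<lambda>n. f x * ln (g n x)) \<longlonglongrightarrow> f x * w x"
    proof (rule AE_I2)
      fix x
      have "(\<lambda>n. ln (g n x)) \<longlonglongrightarrow> ln (h x)" using gl hpos[of x] by (intro tendsto_ln) auto
      then show "(\<lambda>n. f x * ln (g n x)) \<longlonglongrightarrow> f x * w x" by (intro tendsto_intros) (simp add: h_def)
    qed
    show "AE x in gauss_measure. norm (f x * ln (g n x)) \<le> f x * N" for n
      using lng f_nonneg by (auto simp: abs_mult intro!: AE_I2 mult_left_mono)
    show "(\<lambda>x. f x * w x) \<in> borel_measurable gauss_measure"
      using borel_measurable_continuous_onI[OF w(1)] by simp
  qed (use f_int in auto)
  have 2: "(\<lambda>n. \<integral>x. g n x \<partial>gauss_measure) \<longlonglongrightarrow> (\<integral>x. h x \<partial>gauss_measure)"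
  proof (rule integral_dominated_convergence[where w = "\<lambda>_. exp N"])
    show "AE x in gauss_measure. norm (g n x) \<le> exp N" for n
      using gb gpos by (auto intro!: AE_I2 simp: abs_of_pos)
  qed (use gl in auto)
  have "exp (- N) \<le> (\<integral>x. h x \<partial>gauss_measure)"
    using hb(1) habs by (intro integral_ge_const integrable_gauss_bounded[where K = "exp N"]) auto
  then have "(\<integral>x. h x \<partial>gauss_measure) > 0" using exp_gt_zero less_le_trans by blast
  then have "(\<lambda>n. (\<integral>x. f x * ln (g n x) \<partial>gauss_measure) - ln (\<integral>x. g n x \<partial>gauss_measure))
      \<longlonglongrightarrow> (\<integral>x. f x * w x \<partial>gauss_measure) - ln (\<integral>x. h x \<partial>gauss_measure)"
    by (intro tendsto_diff 1 tendsto_ln 2) auto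
  then show ?thesis
    unfolding h_def by (rule LIMSEQ_le_const2) (use flow_bound[OF sw] in auto)
qed

lemma exp_bound_measurable:
  assumes w: "w \<in> borel_measurable borel" "\<And>x. \<bar>w x\<bar> \<le> N"
  shows "(\<integral>x. f x * w x \<partial>gauss_measure) - ln (\<integral>x. exp (w x) \<partial>gauss_measure) \<le> Fish * (c_const lam / 2)"
proof -
  interpret prob_space "gauss_measure :: (real^'n) measure" by (rule prob_space_gauss)
  note [measurable] = w(1)
  obtain u where u: "\<And>n. continuous_on UNIV (u n)" "\<And>n x. \<bar>u n x\<bar> \<le> N"
    "AE x in lborel. (\<lambda>n::nat. u n x) \<longlonglongrightarrow> w x"
    using borel_bounded_approx[OF w] by auto
  have um [measurable]: "u n \<in> borel_measurable borel" for n using u(1) by (rule borel_measurable_continuous_onI)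
  have ul: "AE x in gauss_measure. (\<lambda>n::nat. u n x) \<longlonglongrightarrow> w x" using u(3) by (simp add: AE_gauss_iff)
  have 1: "(\<lambda>n. \<integral>x. f x * u n x \<partial>gauss_measure) \<longlonglongrightarrow> (\<integral>x. f x * w x \<partial>gauss_measure)"
  proof (rule integral_dominated_convergence[where w = "\<lambda>x. f x * N"])
    show "AE x in gauss_measure. (\<lambda>n. f x * u n x) \<longlonglongrightarrow> f x * w x"
      using ul by eventually_elim (intro tendsto_intros)
    show "AE x in gauss_measure. norm (f x * u n x) \<le> f x * N" for n
      using u(2) f_nonneg by (auto simp: abs_mult intro!: AE_I2 mult_left_mono)
  qed (use f_int in auto)
  have 2: "(\<lambda>n. \<integral>x. exp (u n x) \<partial>gauss_measure) \<longlonglongrightarrow> (\<integral>x. exp (w x) \<partial>gauss_measure)"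
  proof (rule integral_dominated_convergence[where w = "\<lambda>_. exp N"])
    show "AE x in gauss_measure. (\<lambda>n. exp (u n x)) \<longlonglongrightarrow> exp (w x)"
      using ul by eventually_elim (intro tendsto_intros)
    show "AE x in gauss_measure. norm (exp (u n x)) \<le> exp N" for n
      using u(2) by (auto intro!: AE_I2 simp: abs_le_iff)
  qed auto
  have "exp (- N) \<le> (\<integral>x. exp (w x) \<partial>gauss_measure)"
  proof -
    have "- N \<le> w x" "w x \<le> N" for x using w(2)[of x] by linarith+
    then show ?thesis by (intro integral_ge_const integrable_gauss_bounded[where K = "exp N"]) auto
  qed
  then have "(\<integral>x. exp (w x) \<partial>gauss_measure) > 0" using exp_gt_zero less_le_trans by blast
  then have "(\<lambda>n. (\<integral>x. f x * u n x \<partial>gauss_measure) - ln (\<integral>x. exp (u n x) \<partial>gauss_measure))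
      \<longlonglongrightarrow> (\<integral>x. f x * w x \<partial>gauss_measure) - ln (\<integral>x. exp (w x) \<partial>gauss_measure)"
    by (intro tendsto_diff 1 tendsto_ln 2) auto
  then show ?thesis
    by (rule LIMSEQ_le_const2) (use exp_bound_continuous[OF u(1,2)] in auto)
qed

text \<open>The optimal test function in the duality is \<open>ln f\<close>, which is unbounded in
  general; the functions \<open>w n\<close> are its truncations. Their exponentials integrate to a
  quantity tending to the mass \<open>1\<close> of \<open>nu\<close>, so the logarithmic term
  disappears in the limit.\<close>

lemma entropy_le_fisher:
  assumes ent: "integrable gauss_measure (\<lambda>x. f x * ln (f x))"
  shows "(\<integral>x. f x * ln (f x) \<partial>gauss_measure) \<le> c_const lam / 2 * Fish"
proof -
  interpret prob_space "gauss_measure :: (real^'n) measure" by (rule prob_space_gauss)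
  \<comment> \<open>\<open>ln 0\<close> is some fixed real number, so clipping it would make
    \<open>exp (w n x)\<close> tend to a positive value at zeros of \<open>f\<close>. With
    \<open>- real n\<close> it tends to \<open>f x = 0\<close>.\<close>
  define w where "w n x = (if f x = 0 then - real n else clip (real n) (ln (f x)))" for n x
  have wm [measurable]: "w n \<in> borel_measurable borel" for n unfolding w_def clip_def by measurable
  have wb: "\<bar>w n x\<bar> \<le> real n" for n x by (simp add: w_def clip_bound)
  have wl: "\<forall>\<^sub>F n in sequentially. w n x = ln (f x)" if "f x \<noteq> 0" for x
  proof -
    have "\<forall>\<^sub>F n in sequentially. real n \<ge> \<bar>ln (f x)\<bar>"
      using filterlim_real_sequentially by (rule filterlim_at_top[THEN iffD1, rule_format])
    then show ?thesis by eventually_elim (use that in \<open>simp add: w_def clip_id\<close>)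
  qed
  have 1: "(\<lambda>n. \<integral>x. f x * w n x \<partial>gauss_measure) \<longlonglongrightarrow> (\<integral>x. f x * ln (f x) \<partial>gauss_measure)"
  proof (rule integral_dominated_convergence[where w = "\<lambda>x. \<bar>f x * ln (f x)\<bar>"])
    show "AE x in gauss_measure. (\<lambda>n. f x * w n x) \<longlonglongrightarrow> f x * ln (f x)"
    proof (rule AE_I2)
      fix x
      show "(\<lambda>n. f x * w n x) \<longlonglongrightarrow> f x * ln (f x)"
      proof (cases "f x = 0")
        case False
        have "\<forall>\<^sub>F n in sequentially. f x * w n x = f x * ln (f x)"
          using wl[OF False] by eventually_elim simp
        then show ?thesis by (rule tendsto_eventually)
      qed simp
    qed
    show "AE x in gauss_measure. norm (f x * w n x) \<le> \<bar>f x * ln (f x)\<bar>" for n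
    proof (rule AE_I2)
      fix x
      have "\<bar>clip (real n) (ln (f x))\<bar> \<le> \<bar>ln (f x)\<bar>" by (auto simp: clip_def)
      then show "norm (f x * w n x) \<le> \<bar>f x * ln (f x)\<bar>"
        by (auto simp: w_def abs_mult intro!: mult_left_mono)
    qed
  qed (use ent in auto)
  have 2: "(\<lambda>n. \<integral>x. exp (w n x) \<partial>gauss_measure) \<longlonglongrightarrow> (\<integral>x. f x \<partial>gauss_measure)"
  proof (rule integral_dominated_convergence[where w = "\<lambda>x. f x + 1"])
    show "AE x in gauss_measure. (\<lambda>n. exp (w n x)) \<longlonglongrightarrow> f x"
    proof (rule AE_I2)
      fix x
      show "(\<lambda>n. exp (w n x)) \<longlonglongrightarrow> f x"
      proof (cases "f x = 0")
        case True
        have "(\<lambda>n. exp (- real n)) \<longlonglongrightarrow> 0"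
          by (intro filterlim_compose[OF exp_at_bot] filterlim_compose[OF filterlim_uminus_at_bot_at_top filterlim_real_sequentially])
        then show ?thesis using True by (simp add: w_def)
      next
        case False
        then have "f x > 0" using f_nonneg[of x] by simp
        then have "\<forall>\<^sub>F n in sequentially. exp (w n x) = f x"
          using wl[OF False] by (auto elim: eventually_mono)
        then show ?thesis by (rule tendsto_eventually)
      qed
    qed
    show "AE x in gauss_measure. norm (exp (w n x)) \<le> f x + 1" for n
    proof (rule AE_I2)
      fix x
      show "norm (exp (w n x)) \<le> f x + 1"
      proof (cases "f x = 0")
        case False
        then have fx: "f x > 0" using f_nonneg[of x] by simp
        have "w n x \<le> max 0 (ln (f x))" using False by (auto simp: w_def clip_def)
        then have "exp (w n x) \<le> exp (max 0 (ln (f x)))" by simp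
        also have "\<dots> \<le> f x + 1" using fx by (simp add: max_def)
        finally show ?thesis by simp
      qed (simp add: w_def)
    qed
  qed (use f_int in auto)
  have "(\<lambda>n. (\<integral>x. f x * w n x \<partial>gauss_measure) - ln (\<integral>x. exp (w n x) \<partial>gauss_measure))
      \<longlonglongrightarrow> (\<integral>x. f x * ln (f x) \<partial>gauss_measure) - ln (\<integral>x. f x \<partial>gauss_measure)"
    using f_prob by (intro tendsto_diff 1 tendsto_ln 2) auto
  then have "(\<integral>x. f x * ln (f x) \<partial>gauss_measure) - ln (\<integral>x. f x \<partial>gauss_measure) \<le> Fish * (c_const lam / 2)"
    by (rule LIMSEQ_le_const2) (use exp_bound_measurable[OF wm wb] in auto)
  then show ?thesis by (simp add: f_prob mult.commute)
qed

text \<open>Pinsker's inequality has \<open>2\<close> in place of \<open>4\<close>; this version only needs the Hellinger distance.\<close>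

lemma hellinger_pinsker:
  assumes ent: "integrable gauss_measure (\<lambda>x. f x * ln (f x))"
  shows "(\<integral>x. \<bar>f x - 1\<bar> \<partial>gauss_measure)\<^sup>2 \<le> 4 * (\<integral>x. f x * ln (f x) \<partial>gauss_measure)"
proof -
  interpret prob_space "gauss_measure :: (real^'n) measure" by (rule prob_space_gauss)
  define H where "H = (\<integral>x. f x * ln (f x) \<partial>gauss_measure)"
  define T where "T = (\<integral>x. \<bar>f x - 1\<bar> \<partial>gauss_measure)"
  \<comment> \<open>For \<open>f x > 0\<close> this is \<open>ln u \<le> u - 1\<close> at
    \<open>u = 1 / sqrt (f x)\<close>, multiplied by \<open>2 * f x\<close>.\<close>
  have hel: "(sqrt (f x) - 1)\<^sup>2 \<le> f x * ln (f x) - f x + 1" for x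
  proof (cases "f x = 0")
    case False
    then have fx: "f x > 0" using f_nonneg[of x] by simp
    have "ln (1 / sqrt (f x)) \<le> 1 / sqrt (f x) - 1" using fx by (intro ln_le_minus_one) auto
    then have "- ln (f x) / 2 \<le> 1 / sqrt (f x) - 1" using fx by (simp add: ln_div ln_sqrt)
    then have "f x * (- ln (f x) / 2) \<le> f x * (1 / sqrt (f x) - 1)" using fx by (intro mult_left_mono) auto
    moreover have "f x * (1 / sqrt (f x)) = sqrt (f x)" using fx by (simp add: real_div_sqrt)
    ultimately have "- (f x * ln (f x)) / 2 \<le> sqrt (f x) - f x" by (simp add: right_diff_distrib)
    then show ?thesis using fx by (simp add: power2_eq_square algebra_simps)
  qed simp
  \<comment> \<open>Factor \<open>f x - 1\<close> as
    \<open>(sqrt (f x) - 1) * (sqrt (f x) + 1)\<close> and apply Young's inequality with a free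
    weight \<open>c\<close>, which takes the place of the Cauchy-Schwarz inequality for
    integrals.\<close>
  have pt: "\<bar>f x - 1\<bar> \<le> c * (f x * ln (f x) - f x + 1) + (f x + 1) / (2 * c)" if c: "c > 0" for c x
  proof -
    define r where "r = sqrt (f x)"
    have r: "r \<ge> 0" "f x = r\<^sup>2" using f_nonneg[of x] by (auto simp: r_def)
    have "\<bar>f x - 1\<bar> = \<bar>r - 1\<bar> * (r + 1)"
    proof -
      have "f x - 1 = (r - 1) * (r + 1)" using r(2) by (simp add: power2_eq_square algebra_simps)
      then show ?thesis using r(1) by (simp add: abs_mult)
    qed
    also have "\<dots> \<le> c * (r - 1)\<^sup>2 + (r + 1)\<^sup>2 / (4 * c)"
    proof -
      have "0 \<le> (2 * c * \<bar>r - 1\<bar> - (r + 1))\<^sup>2 / (4 * c)" using c by simp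
      also have "\<dots> = c * \<bar>r - 1\<bar>\<^sup>2 + (r + 1)\<^sup>2 / (4 * c) - \<bar>r - 1\<bar> * (r + 1)"
        using c by (simp add: power2_eq_square field_simps)
      finally show ?thesis by simp
    qed
    also have "(r + 1)\<^sup>2 / (4 * c) \<le> (f x + 1) / (2 * c)"
    proof -
      have "(r + 1)\<^sup>2 \<le> 2 * (f x + 1)"
        using zero_le_power2[of "r - 1"] r(2) by (simp add: power2_eq_square algebra_simps)
      then have "(r + 1)\<^sup>2 / (4 * c) \<le> 2 * (f x + 1) / (4 * c)" using c by (intro divide_right_mono) auto
      also have "\<dots> = (f x + 1) / (2 * c)" using c by (simp add: field_simps)
      finally show ?thesis .
    qed
    also have "c * (r - 1)\<^sup>2 \<le> c * (f x * ln (f x) - f x + 1)"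
      using hel[of x] c by (intro mult_left_mono) (auto simp: r_def)
    finally show ?thesis by simp
  qed
  have T: "T \<le> c * H + 1 / c" if c: "c > 0" for c
  proof -
    have "T \<le> (\<integral>x. c * (f x * ln (f x) - f x + 1) + (f x + 1) / (2 * c) \<partial>gauss_measure)"
      unfolding T_def using ent f_int pt[OF c] by (intro integral_mono) auto
    also have "\<dots> = c * H + 1 / c"
      using ent f_int f_prob prob_space by (simp add: H_def)
    finally show ?thesis .
  qed
  have T0: "T \<ge> 0" by (simp add: T_def)
  have "T\<^sup>2 \<le> 4 * H"
  proof (cases "T = 0")
    case False
    then have "T > 0" using T0 by simp
    \<comment> \<open>The choice \<open>c = 2 / T\<close> turns \<open>1 / c\<close> into half of
      \<open>T\<close>, which the left side absorbs.\<close>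
    then have "T \<le> 2 / T * H + T / 2" using T[of "2 / T"] by simp
    then have "T * (T / 2) \<le> T * (2 / T * H)" using \<open>T > 0\<close> by (intro mult_left_mono) auto
    then show ?thesis using \<open>T > 0\<close> by (simp add: power2_eq_square)
  next
    case True
    have "0 \<le> (\<integral>x. f x * ln (f x) - f x + 1 \<partial>gauss_measure)"
      using hel by (intro Bochner_Integration.integral_nonneg) (auto intro: order_trans[OF zero_le_power2])
    also have "\<dots> = H" using ent f_int f_prob prob_space by (simp add: H_def)
    finally show ?thesis using True by simp
  qed
  then show ?thesis by (simp add: T_def H_def)
qed

end

section \<open>The constant and the total variation norm\<close>

lemma c_const_le_1:
  assumes "lam > 0"
  shows "c_const lam \<le> 1"
proof (cases "lam = 1")
  case False
  have "lam * ln lam \<le> lam * (lam - 1)"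
    using assms ln_le_minus_one[of lam] by (intro mult_left_mono) auto
  then have "1 - lam + lam * ln lam \<le> (1 - lam)\<^sup>2"
    by (simp add: power2_eq_square algebra_simps)
  then show ?thesis using False by (simp add: c_const_def)
qed (simp add: c_const_def)

text \<open>The upper bound holds because the indicators of a disjoint family sum to at most
  \<open>1\<close>. The Hahn decomposition of the signed measure into \<open>{f \<ge> 1}\<close> and
  \<open>{f < 1}\<close> attains it.\<close>

lemma tv_norm_diff_density:
  fixes f :: "'a \<Rightarrow> real"
  assumes P: "prob_space P" and f [measurable]: "f \<in> borel_measurable P" and f0: "\<And>x. f x \<ge> 0" and fi: "integrable P f"
  shows "tv_norm_diff (density P (\<lambda>x. ennreal (f x))) P = (\<integral>x. \<bar>f x - 1\<bar> \<partial>P)"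
proof -
  interpret prob_space P by (rule P)
  let ?N = "density P (\<lambda>x. ennreal (f x))"
  have diff: "measure ?N A - measure P A = (\<integral>x. indicator A x * (f x - 1) \<partial>P)" and ii: "integrable P (\<lambda>x. indicator A x * (f x - 1))"
    if A: "A \<in> sets P" for A
  proof -
    have iA: "integrable P (\<lambda>x. indicator A x * f x)"
      using integrable_mult_indicator[OF A fi] by simp
    have iA1: "integrable P (indicator A :: 'a \<Rightarrow> real)" using A by (simp add: integrable_real_indicator less_top[symmetric])
    have "emeasure ?N A = (\<integral>\<^sup>+x. ennreal (indicator A x * f x) \<partial>P)"
      using A by (subst emeasure_density) (auto simp: indicator_def intro!: nn_integral_cong)
    also have "\<dots> = ennreal (\<integral>x. indicator A x * f x \<partial>P)"
      using iA f0 by (intro nn_integral_eq_integral) auto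
    finally have "measure ?N A = (\<integral>x. indicator A x * f x \<partial>P)"
      using f0 by (simp add: measure_def)
    moreover have "measure P A = (\<integral>x. indicator A x \<partial>P)" using A by simp
    ultimately show "measure ?N A - measure P A = (\<integral>x. indicator A x * (f x - 1) \<partial>P)"
      using iA iA1 by (simp add: right_diff_distrib)
    show "integrable P (\<lambda>x. indicator A x * (f x - 1))"
      using iA iA1 by (simp add: right_diff_distrib)
  qed
  have ia: "integrable P (\<lambda>x. \<bar>f x - 1\<bar>)" using fi by auto
  have le: "(\<Sum>A\<in>F. \<bar>measure ?N A - measure P A\<bar>) \<le> (\<integral>x. \<bar>f x - 1\<bar> \<partial>P)"
    if F: "finite F" "disjoint F" "F \<subseteq> sets ?N" for F
  proof -
    have FP: "A \<in> sets P" if "A \<in> F" for A using that F(3) by auto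
    have "(\<Sum>A\<in>F. \<bar>measure ?N A - measure P A\<bar>) \<le> (\<Sum>A\<in>F. \<integral>x. \<bar>indicator A x * (f x - 1)\<bar> \<partial>P)"
      using diff[OF FP] by (intro sum_mono) (simp add: integral_abs_bound)
    also have "\<dots> = (\<integral>x. (\<Sum>A\<in>F. \<bar>indicator A x * (f x - 1)\<bar>) \<partial>P)"
      using ii[OF FP] by (subst Bochner_Integration.integral_sum) auto
    also have "\<dots> \<le> (\<integral>x. \<bar>f x - 1\<bar> \<partial>P)"
    proof (rule integral_mono[OF _ ia])
      show "integrable P (\<lambda>x. \<Sum>A\<in>F. \<bar>indicator A x * (f x - 1)\<bar>)"
        using ii[OF FP] by (intro Bochner_Integration.integrable_sum integrable_abs)
      fix x
      have "(\<Sum>A\<in>F. indicator A x :: real) \<le> 1"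
      proof (cases "\<exists>A\<in>F. x \<in> A")
        case True
        then obtain A where A: "A \<in> F" "x \<in> A" by blast
        have "(\<Sum>B\<in>F. indicator B x :: real) = (\<Sum>B\<in>F. if B = A then 1 else 0)"
          using A F(2) by (intro sum.cong) (auto simp: indicator_def disjoint_def)
        then show ?thesis using F(1) by simp
      next
        case False
        then show ?thesis by (simp add: sum.neutral indicator_def)
      qed
      then have "(\<Sum>A\<in>F. indicator A x) * \<bar>f x - 1\<bar> \<le> 1 * \<bar>f x - 1\<bar>" by (intro mult_right_mono) auto
      then show "(\<Sum>A\<in>F. \<bar>indicator A x * (f x - 1)\<bar>) \<le> \<bar>f x - 1\<bar>"
        by (simp add: abs_mult sum_distrib_right)
    qed
    finally show ?thesis .
  qed
  define A where "A = {x \<in> space P. f x \<ge> 1}"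
  define B where "B = {x \<in> space P. f x < 1}"
  have AB: "A \<in> sets P" "B \<in> sets P" unfolding A_def B_def by measurable
  \<comment> \<open>Partitions are sets, so the sum over \<open>{A, B}\<close> has two terms only if
    \<open>A\<close> and \<open>B\<close> differ. One of them may be empty, but a point of the space
    lies in exactly one.\<close>
  obtain x0 where "x0 \<in> space P" using not_empty by blast
  then have "x0 \<in> A \<longleftrightarrow> x0 \<notin> B" by (auto simp: A_def B_def)
  then have ne: "A \<noteq> B" by blast
  have "(\<Sum>C\<in>{A, B}. \<bar>measure ?N C - measure P C\<bar>) = (\<integral>x. \<bar>f x - 1\<bar> \<partial>P)"
  proof -
    have a: "\<bar>measure ?N A - measure P A\<bar> = (\<integral>x. indicator A x * (f x - 1) \<partial>P)"
      unfolding diff[OF AB(1)] by (intro abs_of_nonneg Bochner_Integration.integral_nonneg) (auto simp: A_def indicator_def)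
    have "(\<integral>x. indicator B x * (f x - 1) \<partial>P) \<le> (\<integral>x. 0 \<partial>P)"
      using ii[OF AB(2)] by (intro integral_mono) (auto simp: B_def indicator_def)
    then have b: "\<bar>measure ?N B - measure P B\<bar> = - (\<integral>x. indicator B x * (f x - 1) \<partial>P)"
      unfolding diff[OF AB(2)] by simp
    have "(\<integral>x. \<bar>f x - 1\<bar> \<partial>P) = (\<integral>x. indicator A x * (f x - 1) - indicator B x * (f x - 1) \<partial>P)"
      by (rule Bochner_Integration.integral_cong) (auto simp: A_def B_def indicator_def)
    also have "\<dots> = \<bar>measure ?N A - measure P A\<bar> + \<bar>measure ?N B - measure P B\<bar>"
      using ii AB a b by simp
    finally show ?thesis using ne by simp
  qed
  moreover have "finite {A, B}" "disjoint {A, B}" "{A, B} \<subseteq> sets ?N"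
    using AB by (auto simp: disjoint_def A_def B_def)
  ultimately show ?thesis
    unfolding tv_norm_diff_def
    using le by (intro cSup_eq_maximum) (auto intro!: image_eqI[of _ _ "{A, B}"])
qed

theorem corollary4:
  fixes f :: "real ^ 'n \<Rightarrow> real" and \<nu> :: "(real ^ 'n) measure" and lam :: real
  assumes "lam > 0"
    and "f \<in> borel_measurable borel" and "\<And>x. f x \<ge> 0"
    and "\<nu> = density gauss_measure (\<lambda>x. ennreal (f x))"
    and "prob_space \<nu>"
    and "f \<in> W11_loc" and "finite_entropy f" and "finite_fisher_info f"
    and "centered \<nu>"
    and "\<nu> \<in> poincare_class lam"
  shows "deficit_LSI f \<ge> c1_const lam / 4 * (\<integral>x. \<bar>f x - 1\<bar> \<partial>gauss_measure)\<^sup>2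
    \<and> c1_const lam / 4 * (\<integral>x. \<bar>f x - 1\<bar> \<partial>gauss_measure)\<^sup>2
        = c1_const lam / 4 * (tv_norm_diff \<nu> gauss_measure)\<^sup>2"
proof -
  have "locally_integrable f" "\<exists>G. locally_integrable G \<and> has_weak_gradient f G"
    using assms(6) by (auto simp: W11_loc_def)
  then have G: "locally_integrable f" "locally_integrable (weak_grad f)" "has_weak_gradient f (weak_grad f)"
    using someI_ex[of "\<lambda>G. locally_integrable G \<and> has_weak_gradient f G"] by (auto simp: weak_grad_def)
  interpret regular_density f "weak_grad f" lam
    using assms(1-3,5,8-10) G unfolding assms(4) finite_fisher_info_def by (intro regular_density.intro)
  have ent: "integrable gauss_measure (\<lambda>x. f x * ln (f x))"
    using assms(7) by (simp add: finite_entropy_def)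
  define T where "T = (\<integral>x. \<bar>f x - 1\<bar> \<partial>gauss_measure)"
  have F: "Fish = fisher_info f" by (simp add: Fish_def fisher_info_def)
  have H: "rel_entropy f \<le> c_const lam / 2 * fisher_info f"
    using entropy_le_fisher[OF ent] by (simp add: rel_entropy_def F)
  have P: "T\<^sup>2 \<le> 4 * rel_entropy f"
    using hellinger_pinsker[OF ent] by (simp add: rel_entropy_def T_def)
  have c1: "c_const lam \<le> 1" using assms(1) by (rule c_const_le_1)
  have I0: "fisher_info f \<ge> 0"
    unfolding fisher_info_def set_lebesgue_integral_def using f_nonneg by (intro Bochner_Integration.integral_nonneg) auto
  have "c_const lam / 2 * fisher_info f \<le> 1 / 2 * fisher_info f"
    using c1 I0 by (intro mult_right_mono) auto
  \<comment> \<open>A quarter of \<open>T\<close> squared is at most the entropy, hence at most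
    \<open>c_const lam / 2\<close> times the Fisher information. The bound
    \<open>c_const lam \<le> 1\<close> is used for this and again below, where it makes
    \<open>c1_const lam\<close> nonnegative.\<close>
  then have "T\<^sup>2 / 4 \<le> fisher_info f"
    using H P I0 by linarith
  then have "c1_const lam * (T\<^sup>2 / 4) \<le> c1_const lam * fisher_info f"
    using c1 by (intro mult_left_mono) (auto simp: c1_const_def)
  also have "\<dots> = fisher_info f / 2 - c_const lam / 2 * fisher_info f"
    by (simp add: c1_const_def field_simps)
  also have "\<dots> \<le> deficit_LSI f"
    using H by (simp add: deficit_LSI_def)
  finally have "deficit_LSI f \<ge> c1_const lam / 4 * T\<^sup>2" by simp
  moreover have "tv_norm_diff \<nu> gauss_measure = T"
    unfolding T_def assms(4) using prob_space_gauss f_int f_nonneg by (intro tv_norm_diff_density) auto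
  ultimately show ?thesis by (simp add: T_def)
qed

end
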